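(* Let $d\ge 1$, $\beta>0$, and let $Z=(Z(t))_{t\ge 0}$ be a strictly dyadic branching Brownian motion in $\mathbb{R}^d$ with constant branching rate $\beta$, started with a single particle at the origin. Let $0<\theta<1$, $0\leq k<(1-\theta^2)/d$, $r_0>0$, and for $t>0$ let $r_t=r_0e^{-\beta kt}$, $\rho_t=\theta\sqrt{2\beta}\,t$ and $$Z_t^{r_t}=\bigcup_{x\in\operatorname{supp}(Z(t))}B(x,r_t).$$ Then $P(\Omega_0)=1$, where $$\Omega_0=\left\{\omega:\ \exists\, t_0=t_0(\omega)\ \text{such that}\ \forall\, t\geq t_0,\ B(0,\rho_t)\subseteq Z_t^{r_t}(\omega)\right\}.$$
   Context: Strictly dyadic branching Brownian motion (BBM) with branching rate $\beta>0$ in $\mathbb{R}^d$: the process starts with a single particle, which performs a standard $d$-dimensional Brownian motion for an exponentially distributed random time of parameter $\beta$, at which it dies and simultaneously gives birth to exactly two offspring; each offspring, starting from the position where its parent died, repeats the same procedure independently of the others and of the parent. All Brownian motions and exponential lifetimes are independent. $Z(t)$ is the (random) discrete measure on $\mathbb{R}^d$ given by the sum of Dirac masses at the positions of the particles alive at time $t$, so $\operatorname{supp}(Z(t))$ is the set of these positions. $P$ is the law of the process with $Z(0)=\delta_0$. $B(x,r)$ is the open Euclidean ball of center $x$ and radius $r$. Time $t$ is a continuous (real) parameter. *)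

theory Defs
  imports "HOL-Probability.Probability"
begin

text \<open>Standard Brownian motion in \<open>\<real>\<^sup>d\<close> started at the origin; time ranges over \<open>{0..}\<close>,
  values of \<open>W\<close> at negative times are irrelevant. The density in \<open>increment_distr\<close> is that of the
  centred Gaussian law with covariance matrix \<open>(t - s) I\<close> (\<open>normal_density\<close> takes the standard
  deviation, not the variance).\<close>

locale brownian_motion = prob_space M
  for M :: "'w measure" and W :: "real \<Rightarrow> 'w \<Rightarrow> real ^ 'd" +
  assumes measurable_at: "0 \<le> t \<Longrightarrow> random_variable borel (W t)"
    and starts_at_0: "AE \<omega> in M. W 0 \<omega> = 0"
    and continuous_paths: "AE \<omega> in M. continuous_on {0..} (\<lambda>t. W t \<omega>)"
    and increment_distr: "0 \<le> s \<Longrightarrow> s < t \<Longrightarrow>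
      distributed M lborel (\<lambda>\<omega>. W t \<omega> - W s \<omega>)
        (\<lambda>x. ennreal (\<Prod>i\<in>UNIV. normal_density 0 (sqrt (t - s)) (x $ i)))"
    and increments_indep: "\<And>(n::nat) (t :: nat \<Rightarrow> real). 0 \<le> t 0 \<Longrightarrow> (\<And>i. i < n \<Longrightarrow> t i < t (Suc i)) \<Longrightarrow>
      indep_vars (\<lambda>_. borel) (\<lambda>i \<omega>. W (t (Suc i)) \<omega> - W (t i) \<omega>) {..<n}"

text \<open>Particles are labelled by finite binary words: \<open>[]\<close> is the initial particle and the two
  offspring of \<open>u\<close> are \<open>False # u\<close> and \<open>True # u\<close>, so that the tail of a word is its parent.
  \<open>\<tau> u\<close> is the lifetime of \<open>u\<close> and \<open>w u s\<close> its displacement, at age \<open>s\<close>, from its place of birth.\<close>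

primrec birth_time :: "(bool list \<Rightarrow> real) \<Rightarrow> bool list \<Rightarrow> real" where
  "birth_time \<tau> [] = 0"
| "birth_time \<tau> (b # u) = birth_time \<tau> u + \<tau> u"

primrec birth_place ::
    "(bool list \<Rightarrow> real) \<Rightarrow> (bool list \<Rightarrow> real \<Rightarrow> real ^ 'd) \<Rightarrow> bool list \<Rightarrow> real ^ 'd" where
  "birth_place \<tau> w [] = 0"
| "birth_place \<tau> w (b # u) = birth_place \<tau> w u + w u (\<tau> u)"

definition alive :: "(bool list \<Rightarrow> real) \<Rightarrow> real \<Rightarrow> bool list set" where
  "alive \<tau> t = {u. birth_time \<tau> u \<le> t \<and> t < birth_time \<tau> u + \<tau> u}"

definition position ::
    "(bool list \<Rightarrow> real) \<Rightarrow> (bool list \<Rightarrow> real \<Rightarrow> real ^ 'd) \<Rightarrow> real \<Rightarrow> bool list \<Rightarrow> real ^ 'd" where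
  "position \<tau> w t u = birth_place \<tau> w u + w u (t - birth_time \<tau> u)"

text \<open>All lifetimes and all Brownian motions are mutually independent. They take values in different
  types, so this is said for the \<open>\<sigma>\<close>-algebras they generate: \<open>Inl u\<close> stands for the lifetime of \<open>u\<close>
  and \<open>Inr u\<close> for its whole path.\<close>

locale dyadic_bbm = prob_space M
  for M :: "'w measure" and \<beta> :: real
    and T :: "bool list \<Rightarrow> 'w \<Rightarrow> real"
    and W :: "bool list \<Rightarrow> real \<Rightarrow> 'w \<Rightarrow> real ^ 'd" +
  assumes lifetime_distr: "distributed M lborel (T u) (exponential_density \<beta>)"
    and motion: "brownian_motion M (W u)"
    and lifetimes_motions_indep:
      "indep_sets (\<lambda>i. case i of
          Inl u \<Rightarrow> sets (vimage_algebra (space M) (T u) borel)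
        | Inr u \<Rightarrow> sets (vimage_algebra (space M) (\<lambda>\<omega>. \<lambda>s\<in>{0..}. W u s \<omega>) (\<Pi>\<^sub>M s\<in>{0..}. borel)))
        (UNIV :: (bool list + bool list) set)"

text \<open>The sum of the Dirac masses (with multiplicity) at the positions of the living particles.\<close>

definition bbm_measure ::
    "(bool list \<Rightarrow> 'w \<Rightarrow> real) \<Rightarrow> (bool list \<Rightarrow> real \<Rightarrow> 'w \<Rightarrow> real ^ 'd) \<Rightarrow> real \<Rightarrow> 'w \<Rightarrow> (real ^ 'd) measure"
  where "bbm_measure T W t \<omega> =
    (let \<tau> = (\<lambda>u. T u \<omega>); w = (\<lambda>u s. W u s \<omega>)
     in distr (count_space (alive \<tau> t)) borel (position \<tau> w t))"

definition msupp :: "'a::topological_space measure \<Rightarrow> 'a set" where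
  "msupp \<mu> = {x. \<forall>U. open U \<longrightarrow> x \<in> U \<longrightarrow> 0 < emeasure \<mu> U}"

lemma emeasure_bbm_measure:
  assumes "A \<in> sets borel"
  shows "emeasure (bbm_measure T W t \<omega>) A =
    emeasure (count_space UNIV)
      {u \<in> alive (\<lambda>u. T u \<omega>) t. position (\<lambda>u. T u \<omega>) (\<lambda>u s. W u s \<omega>) t u \<in> A}"
proof -
  let ?V = "alive (\<lambda>u. T u \<omega>) t" and ?X = "position (\<lambda>u. T u \<omega>) (\<lambda>u s. W u s \<omega>) t"
  have "emeasure (bbm_measure T W t \<omega>) A = emeasure (count_space ?V) (?X -` A \<inter> ?V)"
    unfolding bbm_measure_def Let_def using assms by (subst emeasure_distr) auto
  also have "?X -` A \<inter> ?V = {u \<in> ?V. ?X u \<in> A}" by auto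
  also have "emeasure (count_space ?V) {u \<in> ?V. ?X u \<in> A} =
      emeasure (count_space UNIV) {u \<in> ?V. ?X u \<in> A}"
    by (cases "finite {u \<in> ?V. ?X u \<in> A}") auto
  finally show ?thesis .
qed

text \<open>The closure is redundant when the population is finite, which holds simultaneously for all
  times with probability one.\<close>

lemma msupp_bbm_measure:
  "msupp (bbm_measure T W t \<omega>) =
    closure (position (\<lambda>u. T u \<omega>) (\<lambda>u s. W u s \<omega>) t ` alive (\<lambda>u. T u \<omega>) t)"
proof -
  let ?V = "alive (\<lambda>u. T u \<omega>) t" and ?X = "position (\<lambda>u. T u \<omega>) (\<lambda>u s. W u s \<omega>) t"
  have pos: "0 < emeasure (bbm_measure T W t \<omega>) U \<longleftrightarrow> (\<exists>u\<in>?V. ?X u \<in> U)" if "open U" for U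
  proof -
    have "0 < emeasure (bbm_measure T W t \<omega>) U \<longleftrightarrow> {u \<in> ?V. ?X u \<in> U} \<noteq> {}"
      using that by (subst emeasure_bbm_measure) (auto simp: zero_less_iff_neq_zero emeasure_count_space_eq_0)
    then show ?thesis by auto
  qed
  show ?thesis
    unfolding msupp_def closure_iff_nhds_not_empty set_eq_iff mem_Collect_eq
    using pos by (auto simp: disjoint_iff) blast+
qed

corollary msupp_bbm_measure_finite:
  assumes "finite (alive (\<lambda>u. T u \<omega>) t)"
  shows "msupp (bbm_measure T W t \<omega>) =
    position (\<lambda>u. T u \<omega>) (\<lambda>u s. W u s \<omega>) t ` alive (\<lambda>u. T u \<omega>) t"
  using assms by (simp add: msupp_bbm_measure finite_imp_closed closure_closed)

definition enlarged_support :: "(real ^ 'd) measure \<Rightarrow> real \<Rightarrow> (real ^ 'd) set" where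
  "enlarged_support \<mu> r = (\<Union>x\<in>msupp \<mu>. ball x r)"

end

theory Submission
  imports Defs "HOL-Real_Asymp.Real_Asymp"
begin

text \<open>
  Instead of the Markov property at fixed times, the proof uses that the subtrees rooted in one
  generation are independent of each other and of the preceding generations.

  Fix a large integer \<open>j\<close>, a time \<open>t\<close> near \<open>j\<close> and a target \<open>x\<close> with \<open>norm x \<le> \<phi> sqrt (2 \<beta>) j\<close>, where
  \<open>\<theta> < \<phi> < 1\<close>. With overwhelming probability all \<open>2 ^ g\<close> particles of generation \<open>g\<close>, of order
  \<open>\<epsilon> j\<close>, are born before time \<open>\<epsilon> j\<close> and within distance of order \<open>\<epsilon> j\<close> from the origin. From each of
  them, follow lineages that in every block of \<open>G = 2 \<beta> a\<close> generations take time about \<open>a\<close> and move by about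
  \<open>a x / j\<close>: a particle has at least \<open>exp (a (\<beta> (1 - \<phi>\<^sup>2) - o(1)))\<close> such descendants on average. The
  last particle of a lineage reaches the target without branching with probability at least
  \<open>exp (- O(\<epsilon>) j)\<close> times \<open>exp (- \<beta> k d j)\<close>. Since \<open>k d < 1 - \<phi>\<^sup>2\<close>, a backward recursion over the blocks
  bounds the probability that a given particle of generation \<open>g\<close> has a descendant at the target from
  below by a constant. Hence a target is missed with probability at most \<open>(1 - c) ^ 2 ^ g\<close>, which is doubly
  exponentially small and beats the exponential number of targets and times on a fine grid. Borel-Cantelli
  over \<open>j\<close> concludes. Between grid times, the particle that realises a hit is required not to branch and
  hardly to move.
\<close>

section \<open>Isotropic Gaussian vectors\<close>

text \<open>Words of a given length form a fixed index set, unlike the population at a fixed time,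
  so independence of subtrees becomes disjointness of label sets. The price is that births of one
  generation are scattered in time. Nothing is therefore timed exactly: each block may be off by one
  unit in time and in every coordinate, the errors add up to order \<open>\<epsilon> j\<close>, and
  the last particle of the lineage repairs them in one long jump.

  A large mean number of good descendants does not by itself produce a hit. If \<open>X\<close> of
  the \<open>2 ^ G\<close> offspring of a block are good and each hits with probability at least
  \<open>h\<close>, all fail with probability at most \<open>(1 - h) ^ X\<close>. Keeping
  \<open>h \<le> 2 ^ (- G)\<close> makes \<open>h X \<le> 1\<close>, so this is at most
  \<open>1 - h X / 2\<close>, and only the mean of \<open>X\<close> enters; no second moment has to
  be controlled. The recursion thus saturates at \<open>2 ^ (- G)\<close>, which is a constant
  because \<open>G\<close> is fixed before \<open>j\<close> tends to infinity.

  The rates: among \<open>2 ^ G\<close> lineages with \<open>G = 2 \<beta> a\<close>, about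
  \<open>exp (\<beta> a)\<close> take time near \<open>a\<close>, and following a drift of speed
  \<open>\<phi> sqrt (2 \<beta>)\<close> costs \<open>exp (- \<beta> \<phi>^2 a)\<close>.\<close>

definition gauss_density :: "real \<Rightarrow> real ^ 'd \<Rightarrow> real" where
  "gauss_density s x = (\<Prod>i\<in>UNIV. normal_density 0 (sqrt s) (x $ i))"

lemma gauss_density_nonneg [simp]: "0 \<le> gauss_density s x"
  by (auto simp: gauss_density_def intro!: prod_nonneg)

lemma borel_measurable_vec_nth [measurable]:
  fixes f :: "'a \<Rightarrow> real ^ 'd"
  assumes "f \<in> borel_measurable M"
  shows "(\<lambda>x. f x $ i) \<in> borel_measurable M"
  using assms borel_measurable_inner[OF assms borel_measurable_const, of "axis i 1"]
  by (simp add: inner_axis)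

lemma borel_measurable_gauss_density [measurable]: "gauss_density s \<in> borel_measurable borel"
  unfolding gauss_density_def by measurable

lemma nn_integral_lborel_prod_vec:
  fixes f :: "'d::finite \<Rightarrow> real \<Rightarrow> ennreal"
  assumes "\<And>i. f i \<in> borel_measurable borel"
  shows "(\<integral>\<^sup>+x. (\<Prod>i\<in>UNIV. f i (x $ i)) \<partial>(lborel :: (real ^ 'd) measure)) = (\<Prod>i\<in>UNIV. \<integral>\<^sup>+x. f i x \<partial>lborel)"
proof -
  \<comment> \<open>The product rule runs over \<open>Basis\<close>, so the family is re-indexed by
    basis vectors; the choice recovers \<open>f i\<close> because \<open>axis\<close> is injective
    in \<open>i\<close>.\<close>
  define g where "g b = f (SOME i. b = axis i 1)" for b :: "real ^ 'd"
  have B: "(Basis :: (real ^ 'd) set) = (\<lambda>i. axis i 1) ` UNIV"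
    by (auto simp: Basis_vec_def)
  have inj: "inj (\<lambda>i::'d. axis i (1::real))"
    by (auto simp: inj_on_def axis_eq_axis)
  have g: "g (axis i 1) = f i" for i
    unfolding g_def by (rule arg_cong[where f = f]) (auto simp: axis_eq_axis)
  have "(\<integral>\<^sup>+x. (\<Prod>b\<in>Basis. g b (x \<bullet> b)) \<partial>(lborel :: (real ^ 'd) measure)) = (\<Prod>b\<in>Basis. (\<integral>\<^sup>+x. g b x \<partial>lborel))"
    using assms by (intro nn_integral_lborel_prod) (auto simp: g_def)
  then show ?thesis
    by (simp add: B prod.reindex[OF inj] g inner_axis)
qed

lemma nn_integral_lborel_shift:
  fixes f :: "'a::euclidean_space \<Rightarrow> ennreal"
  assumes [measurable]: "f \<in> borel_measurable borel"
  shows "(\<integral>\<^sup>+x. f (x - a) \<partial>lborel) = (\<integral>\<^sup>+x. f x \<partial>lborel)"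
proof -
  have "(\<integral>\<^sup>+x. f x \<partial>lborel) = (\<integral>\<^sup>+x. f x \<partial>(distr lborel borel ((+) (- a))))"
    by (simp add: lborel_distr_plus)
  also have "\<dots> = (\<integral>\<^sup>+x. f (x - a) \<partial>lborel)"
    by (subst nn_integral_distr) auto
  finally show ?thesis by simp
qed

lemma gauss_density_convolution:
  fixes x :: "real ^ 'd"
  assumes "0 < s" "0 < t"
  shows "(\<integral>\<^sup>+y. ennreal (gauss_density s (x - y)) * ennreal (gauss_density t y) \<partial>lborel) = gauss_density (s + t) x"
proof -
  have "(\<integral>\<^sup>+y. ennreal (gauss_density s (x - y)) * ennreal (gauss_density t y) \<partial>lborel) =
     (\<integral>\<^sup>+y. (\<Prod>i\<in>UNIV. ennreal (normal_density 0 (sqrt s) (x $ i - y $ i) * normal_density 0 (sqrt t) (y $ i))) \<partial>lborel)"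
    by (intro nn_integral_cong)
      (simp add: gauss_density_def ennreal_mult[symmetric] prod_nonneg prod.distrib[symmetric] prod_ennreal)
  also have "\<dots> = (\<Prod>i\<in>UNIV. \<integral>\<^sup>+y. ennreal (normal_density 0 (sqrt s) (x $ i - y) * normal_density 0 (sqrt t) y) \<partial>lborel)"
    by (rule nn_integral_lborel_prod_vec) measurable
  also have "\<dots> = (\<Prod>i\<in>UNIV. ennreal (normal_density 0 (sqrt (s + t)) (x $ i)))"
    using conv_normal_density_zero_mean[of "sqrt s" "sqrt t"] assms by (simp add: fun_eq_iff)
  also have "\<dots> = gauss_density (s + t) x"
    by (simp add: gauss_density_def prod_ennreal)
  finally show ?thesis .
qed

lemma nn_integral_gauss_density:
  assumes "0 < s"
  shows "(\<integral>\<^sup>+x. ennreal (gauss_density s x) \<partial>(lborel :: (real ^ 'd) measure)) = 1"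
proof -
  have 1: "(\<integral>\<^sup>+x. ennreal (normal_density 0 (sqrt s) x) \<partial>lborel) = 1"
    using prob_space.emeasure_space_1[OF prob_space_normal_density[of "sqrt s" 0]] assms
    by (simp add: emeasure_density)
  have "(\<integral>\<^sup>+x. ennreal (gauss_density s x) \<partial>(lborel :: (real ^ 'd) measure)) =
    (\<integral>\<^sup>+x. (\<Prod>i\<in>UNIV. ennreal (normal_density 0 (sqrt s) (x $ i))) \<partial>(lborel :: (real ^ 'd) measure))"
    by (intro nn_integral_cong) (simp add: gauss_density_def prod_ennreal)
  also have "\<dots> = 1"
    by (subst nn_integral_lborel_prod_vec) (auto simp: 1)
  finally show ?thesis .
qed

text \<open>Serves to add independent motions of fixed durations along a line of descent. Shifting
  the integration variable under the joint density leaves a convolution, computed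
  coordinatewise.\<close>

lemma (in prob_space) distributed_add_gauss:
  fixes X Y :: "'a \<Rightarrow> real ^ 'd"
  assumes ind: "indep_var lborel X lborel Y"
    and X: "distributed M lborel X (gauss_density s)" and Y: "distributed M lborel Y (gauss_density t)"
    and "0 < s" "0 < t"
  shows "distributed M lborel (\<lambda>\<omega>. X \<omega> + Y \<omega>) (gauss_density (s + t))"
  unfolding distributed_def
proof (intro conjI)
  have [measurable]: "random_variable borel X" "random_variable borel Y"
    using distributed_measurable[OF X] distributed_measurable[OF Y] by simp_all
  show m: "(\<lambda>\<omega>. X \<omega> + Y \<omega>) \<in> M \<rightarrow>\<^sub>M lborel" "(\<lambda>x. ennreal (gauss_density (s + t) x)) \<in> borel_measurable lborel"
    by simp_all
  have J: "distributed M (lborel \<Otimes>\<^sub>M lborel) (\<lambda>\<omega>. (X \<omega>, Y \<omega>)) (\<lambda>(x, y). ennreal (gauss_density s x) * ennreal (gauss_density t y))"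
    by (rule distributed_joint_indep[OF _ _ X Y ind]) (auto simp: sigma_finite_lborel)
  show "distr M lborel (\<lambda>\<omega>. X \<omega> + Y \<omega>) = density lborel (\<lambda>x. ennreal (gauss_density (s + t) x))"
  proof (rule measure_eqI)
    fix B assume "B \<in> sets (distr M lborel (\<lambda>\<omega>. X \<omega> + Y \<omega>))"
    then have [measurable]: "B \<in> sets borel" by simp
    have "emeasure (distr M lborel (\<lambda>\<omega>. X \<omega> + Y \<omega>)) B = (\<integral>\<^sup>+\<omega>. indicator B (X \<omega> + Y \<omega>) \<partial>M)"
      by (subst nn_integral_indicator[symmetric], simp, subst nn_integral_distr) auto
    also have "\<dots> = (\<integral>\<^sup>+z. (ennreal (gauss_density s (fst z)) * ennreal (gauss_density t (snd z))) * indicator B (fst z + snd z) \<partial>(lborel \<Otimes>\<^sub>M lborel))"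
      using distributed_nn_integral[OF J, of "\<lambda>z. indicator B (fst z + snd z)"]
      by (simp add: case_prod_beta)
    also have "\<dots> = (\<integral>\<^sup>+y. \<integral>\<^sup>+x. ennreal (gauss_density s x) * ennreal (gauss_density t y) * indicator B (x + y) \<partial>lborel \<partial>lborel)"
      by (subst lborel_pair.nn_integral_snd[symmetric]) (auto simp: case_prod_beta)
    also have "\<dots> = (\<integral>\<^sup>+y. \<integral>\<^sup>+x. ennreal (gauss_density s (x - y)) * ennreal (gauss_density t y) * indicator B x \<partial>lborel \<partial>lborel)"
    proof (rule nn_integral_cong)
      fix y :: "real ^ 'd"
      show "(\<integral>\<^sup>+x. ennreal (gauss_density s x) * ennreal (gauss_density t y) * indicator B (x + y) \<partial>lborel) =
        (\<integral>\<^sup>+x. ennreal (gauss_density s (x - y)) * ennreal (gauss_density t y) * indicator B x \<partial>lborel)"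
        using nn_integral_lborel_shift[of "\<lambda>x. ennreal (gauss_density s x) * ennreal (gauss_density t y) * indicator B (x + y)" y]
        by simp
    qed
    also have "\<dots> = (\<integral>\<^sup>+x. \<integral>\<^sup>+y. ennreal (gauss_density s (x - y)) * ennreal (gauss_density t y) * indicator B x \<partial>lborel \<partial>lborel)"
      by (rule lborel_pair.Fubini') measurable
    also have "\<dots> = (\<integral>\<^sup>+x. ennreal (gauss_density (s + t) x) * indicator B x \<partial>lborel)"
      by (intro nn_integral_cong) (simp add: nn_integral_multc gauss_density_convolution assms)
    also have "\<dots> = emeasure (density lborel (\<lambda>x. ennreal (gauss_density (s + t) x))) B"
      by (subst emeasure_density) auto
    finally show "emeasure (distr M lborel (\<lambda>\<omega>. X \<omega> + Y \<omega>)) B = \<dots>" .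
  qed simp
qed

text \<open>The exponent is split in two halves: one gives the bound outside the ball, the other is,
  up to a factor \<open>sqrt 2\<close> per coordinate, the density of variance \<open>2 * s\<close>,
  which integrates to one.\<close>

lemma (in prob_space) gauss_tail:
  fixes X :: "'a \<Rightarrow> real ^ 'd"
  assumes X: "distributed M lborel X (gauss_density s)" and s: "0 < s" "s \<le> S" and b: "0 \<le> b"
  shows "prob {\<omega> \<in> space M. b < norm (X \<omega>)} \<le> 2 ^ CARD('d) * exp (- b\<^sup>2 / (4 * S))"
proof -
  note [measurable] = distributed_measurable[OF X]
  have ratio: "normal_density 0 (sqrt s) x = sqrt 2 * exp (- x\<^sup>2 / (4 * s)) * normal_density 0 (sqrt (2 * s)) x" for x
    using s by (simp add: normal_density_def real_sqrt_mult exp_add[symmetric] field_simps)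
  have le: "ennreal (gauss_density s x) * indicator {x. b < norm x} x \<le>
      ennreal (2 ^ CARD('d) * exp (- b\<^sup>2 / (4 * S))) * ennreal (gauss_density (2 * s) x)" for x :: "real ^ 'd"
  proof (cases "b < norm x")
    case True
    have nx: "(norm x)\<^sup>2 = (\<Sum>i\<in>UNIV. (x $ i)\<^sup>2)"
      by (simp add: norm_vec_def L2_set_def sum_nonneg)
    have "gauss_density s x = (\<Prod>i\<in>UNIV. sqrt 2 * exp (- (x $ i)\<^sup>2 / (4 * s)) * normal_density 0 (sqrt (2 * s)) (x $ i))"
      unfolding gauss_density_def by (subst ratio) simp
    also have "\<dots> = sqrt 2 ^ CARD('d) * exp (- (norm x)\<^sup>2 / (4 * s)) * gauss_density (2 * s) x"
      by (simp add: prod.distrib exp_sum[symmetric] gauss_density_def nx sum_divide_distrib sum_negf)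
    also have "\<dots> \<le> 2 ^ CARD('d) * exp (- b\<^sup>2 / (4 * S)) * gauss_density (2 * s) x"
    proof (intro mult_right_mono mult_mono)
      show "sqrt 2 ^ CARD('d) \<le> 2 ^ CARD('d)"
        by (intro power_mono) (auto simp: real_le_lsqrt)
      have "b\<^sup>2 / (4 * S) \<le> (norm x)\<^sup>2 / (4 * s)"
        using True b s by (intro frac_le power_mono) auto
      then show "exp (- (norm x)\<^sup>2 / (4 * s)) \<le> exp (- b\<^sup>2 / (4 * S))" by simp
    qed auto
    finally show ?thesis using True by (simp add: ennreal_mult[symmetric] ennreal_leI)
  qed simp
  have "emeasure M {\<omega> \<in> space M. b < norm (X \<omega>)} = (\<integral>\<^sup>+x. ennreal (gauss_density s x) * indicator {x. b < norm x} x \<partial>(lborel :: (real ^ 'd) measure))"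
    using distributed_emeasure[OF X, of "{x. b < norm x}"] by (simp add: vimage_def Int_def conj_commute)
  also have "\<dots> \<le> (\<integral>\<^sup>+x. ennreal (2 ^ CARD('d) * exp (- b\<^sup>2 / (4 * S))) * ennreal (gauss_density (2 * s) x) \<partial>(lborel::(real^'d) measure))"
    by (intro nn_integral_mono le)
  also have "\<dots> = ennreal (2 ^ CARD('d) * exp (- b\<^sup>2 / (4 * S)))"
    by (subst nn_integral_cmult) (auto simp: nn_integral_gauss_density s)
  finally show ?thesis
    by (simp add: emeasure_eq_measure)
qed

text \<open>On the box the density is bounded below by its value at the corner farthest from the
  origin. As only \<open>s1 \<le> s \<le> s2\<close> is known, \<open>s1\<close> enters the exponent
  and \<open>s2\<close> the normalisation.\<close>

lemma (in prob_space) gauss_box: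
  fixes X :: "'a \<Rightarrow> real ^ 'd"
  assumes X: "distributed M lborel X (gauss_density s)" and s: "0 < s1" "s1 \<le> s" "s \<le> s2" and b: "0 < b"
  shows "(2 * b / sqrt (2 * pi * s2)) ^ CARD('d) * exp (- (\<Sum>i\<in>UNIV. (\<bar>z $ i\<bar> + b)\<^sup>2) / (2 * s1))
    \<le> prob {\<omega> \<in> space M. \<forall>i. \<bar>X \<omega> $ i - z $ i\<bar> \<le> b}"
proof -
  note [measurable] = distributed_measurable[OF X]
  define c where "c i = 1 / sqrt (2 * pi * s2) * exp (- (\<bar>z $ i\<bar> + b)\<^sup>2 / (2 * s1))" for i
  have c0: "0 \<le> c i" for i using s by (auto simp: c_def)
  have le: "c i \<le> normal_density 0 (sqrt s) u" if "\<bar>u - z $ i\<bar> \<le> b" for u i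
  proof -
    have "u\<^sup>2 \<le> (\<bar>z $ i\<bar> + b)\<^sup>2" using that by (intro power2_le_iff_abs_le[THEN iffD2]) auto
    then have "u\<^sup>2 / (2 * s) \<le> (\<bar>z $ i\<bar> + b)\<^sup>2 / (2 * s1)" using s by (intro frac_le) auto
    moreover have "1 / sqrt (2 * pi * s2) \<le> 1 / sqrt (2 * pi * s)"
      using s by (intro divide_left_mono) auto
    ultimately show ?thesis unfolding c_def normal_density_def using s by (intro mult_mono) auto
  qed
  have leb: "(\<integral>\<^sup>+u. ennreal (c i) * indicator {z $ i - b .. z $ i + b} u \<partial>lborel) = ennreal (c i * (2 * b))" for i
    using b c0 by (subst nn_integral_cmult_indicator) (auto simp: ennreal_mult')
  have "ennreal (\<Prod>i\<in>UNIV. c i * (2 * b)) = (\<Prod>i\<in>UNIV. \<integral>\<^sup>+u. ennreal (c i) * indicator {z $ i - b .. z $ i + b} u \<partial>lborel)"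
    using b c0 by (simp add: leb prod_ennreal)
  also have "\<dots> = (\<integral>\<^sup>+x. (\<Prod>i\<in>UNIV. ennreal (c i) * indicator {z $ i - b .. z $ i + b} (x $ i)) \<partial>(lborel :: (real ^ 'd) measure))"
    by (rule nn_integral_lborel_prod_vec[symmetric]) measurable
  also have "\<dots> \<le> (\<integral>\<^sup>+x. ennreal (gauss_density s x) * indicator {x. \<forall>i. \<bar>x $ i - z $ i\<bar> \<le> b} x \<partial>lborel)"
  proof (rule nn_integral_mono)
    fix x :: "real ^ 'd"
    show "(\<Prod>i\<in>UNIV. ennreal (c i) * indicator {z $ i - b .. z $ i + b} (x $ i)) \<le> ennreal (gauss_density s x) * indicator {x. \<forall>i. \<bar>x $ i - z $ i\<bar> \<le> b} x"
    proof (cases "\<forall>i. \<bar>x $ i - z $ i\<bar> \<le> b")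
      case True
      then have "x $ i \<in> {z $ i - b .. z $ i + b}" for i by (auto simp: abs_le_iff algebra_simps dest: spec[of _ i])
      then have "(\<Prod>i\<in>UNIV. ennreal (c i) * indicator {z $ i - b .. z $ i + b} (x $ i)) = ennreal (\<Prod>i\<in>UNIV. c i)"
        using c0 by (simp add: prod_ennreal)
      also have "\<dots> \<le> ennreal (gauss_density s x)"
        unfolding gauss_density_def using c0 le True by (intro ennreal_leI prod_mono) auto
      finally show ?thesis using True by simp
    next
      case False
      then obtain i where "\<not> \<bar>x $ i - z $ i\<bar> \<le> b" by auto
      then have "x $ i \<notin> {z $ i - b .. z $ i + b}" by auto
      then have "(\<Prod>i\<in>UNIV. ennreal (c i) * indicator {z $ i - b .. z $ i + b} (x $ i)) = 0"
        by (intro prod_zero bexI[of _ i]) auto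
      then show ?thesis by (simp only: zero_le)
    qed
  qed
  also have "\<dots> = emeasure M {\<omega> \<in> space M. \<forall>i. \<bar>X \<omega> $ i - z $ i\<bar> \<le> b}"
    using distributed_emeasure[OF X, of "{x. \<forall>i. \<bar>x $ i - z $ i\<bar> \<le> b}"] by (simp add: vimage_def Int_def conj_commute)
  finally have "(\<Prod>i\<in>UNIV. c i * (2 * b)) \<le> prob {\<omega> \<in> space M. \<forall>i. \<bar>X \<omega> $ i - z $ i\<bar> \<le> b}"
    by (simp add: emeasure_eq_measure)
  moreover have "(\<Prod>i\<in>UNIV. c i * (2 * b)) = (2 * b / sqrt (2 * pi * s2)) ^ CARD('d) * exp (- (\<Sum>i\<in>UNIV. (\<bar>z $ i\<bar> + b)\<^sup>2) / (2 * s1))"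
  proof -
    have "c i * (2 * b) = 2 * b / sqrt (2 * pi * s2) * exp (- (\<bar>z $ i\<bar> + b)\<^sup>2 / (2 * s1))" for i
      by (simp add: c_def)
    then show ?thesis
      by (simp only: prod.distrib exp_sum[symmetric, OF finite] prod_constant)
        (simp add: sum_divide_distrib sum_negf)
  qed
  ultimately show ?thesis by simp
qed

section \<open>Independence of the labels\<close>

lemma (in prob_space) indep_var_subalgebra:
  assumes F: "space F = space M" "sets F \<subseteq> sets M" and G: "space G = space M" "sets G \<subseteq> sets M"
    and ind: "indep_set (sets F) (sets G)"
    and X: "X \<in> F \<rightarrow>\<^sub>M N1" and Y: "Y \<in> G \<rightarrow>\<^sub>M N2"
  shows "indep_var N1 X N2 Y"
proof -
  have "sigma_sets (space M) {X -` A \<inter> space M |A. A \<in> sets N1} \<subseteq> sets F"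
    unfolding F(1)[symmetric] by (rule sets.sigma_sets_subset) (auto intro: measurable_sets[OF X])
  moreover have "sigma_sets (space M) {Y -` A \<inter> space M |A. A \<in> sets N2} \<subseteq> sets G"
    unfolding G(1)[symmetric] by (rule sets.sigma_sets_subset) (auto intro: measurable_sets[OF Y])
  ultimately have "indep_set (sigma_sets (space M) {X -` A \<inter> space M |A. A \<in> sets N1})
      (sigma_sets (space M) {Y -` A \<inter> space M |A. A \<in> sets N2})"
    using ind F G unfolding indep_sets2_eq by blast
  moreover have "X \<in> M \<rightarrow>\<^sub>M N1" "Y \<in> M \<rightarrow>\<^sub>M N2"
    using X Y F G by (auto simp: measurable_def)
  ultimately show ?thesis unfolding indep_var_eq by blast
qed

text \<open>Independence means that the diagonal map into \<open>F \<Otimes>\<^sub>M G\<close> has a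
  product law. Two ingredients of an event may hence be given separate sample points and one of them
  frozen; this does the work of conditioning.\<close>

lemma (in prob_space) indep_subalgebra_diagonal:
  assumes F: "space F = space M" "sets F \<subseteq> sets M" and G: "space G = space M" "sets G \<subseteq> sets M"
    and ind: "indep_set (sets F) (sets G)" and f [measurable]: "f \<in> borel_measurable (F \<Otimes>\<^sub>M G)"
  shows "(\<integral>\<^sup>+\<omega>. f (\<omega>, \<omega>) \<partial>M) = (\<integral>\<^sup>+\<omega>. \<integral>\<^sup>+\<omega>'. f (\<omega>, \<omega>') \<partial>M \<partial>M)"
proof -
  have idF [measurable]: "(\<lambda>\<omega>. \<omega>) \<in> M \<rightarrow>\<^sub>M F" and idG [measurable]: "(\<lambda>\<omega>. \<omega>) \<in> M \<rightarrow>\<^sub>M G"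
    using F G by (auto simp: measurable_def)
  have "indep_var F (\<lambda>\<omega>. \<omega>) G (\<lambda>\<omega>. \<omega>)"
    by (rule indep_var_subalgebra[OF F G ind]) auto
  then have eq: "distr M F (\<lambda>\<omega>. \<omega>) \<Otimes>\<^sub>M distr M G (\<lambda>\<omega>. \<omega>) = distr M (F \<Otimes>\<^sub>M G) (\<lambda>\<omega>. (\<omega>, \<omega>))"
    unfolding indep_var_distribution_eq by blast
  interpret F: prob_space "distr M F (\<lambda>\<omega>. \<omega>)" by (rule prob_space_distr) simp
  interpret G: prob_space "distr M G (\<lambda>\<omega>. \<omega>)" by (rule prob_space_distr) simp
  have "(\<integral>\<^sup>+\<omega>. f (\<omega>, \<omega>) \<partial>M) = (\<integral>\<^sup>+z. f z \<partial>distr M (F \<Otimes>\<^sub>M G) (\<lambda>\<omega>. (\<omega>, \<omega>)))"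
    by (subst nn_integral_distr) auto
  also have "\<dots> = (\<integral>\<^sup>+\<omega>. \<integral>\<^sup>+\<omega>'. f (\<omega>, \<omega>') \<partial>distr M G (\<lambda>\<omega>. \<omega>) \<partial>distr M F (\<lambda>\<omega>. \<omega>))"
    unfolding eq[symmetric] by (subst G.nn_integral_fst[symmetric]) auto
  also have "\<dots> = (\<integral>\<^sup>+\<omega>. \<integral>\<^sup>+\<omega>'. f (\<omega>, \<omega>') \<partial>distr M G (\<lambda>\<omega>. \<omega>) \<partial>M)"
    by (subst nn_integral_distr) (auto intro: G.borel_measurable_nn_integral)
  also have "\<dots> = (\<integral>\<^sup>+\<omega>. \<integral>\<^sup>+\<omega>'. f (\<omega>, \<omega>') \<partial>M \<partial>M)"
    by (intro nn_integral_cong) (subst nn_integral_distr, auto simp: F(1))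
  finally show ?thesis .
qed

context dyadic_bbm
begin

definition label_events :: "bool list + bool list \<Rightarrow> 'w set set" where
  "label_events i = (case i of
      Inl u \<Rightarrow> sets (vimage_algebra (space M) (T u) borel)
    | Inr u \<Rightarrow> sets (vimage_algebra (space M) (\<lambda>\<omega>. \<lambda>s\<in>{0..}. W u s \<omega>) (\<Pi>\<^sub>M s\<in>{0..}. borel)))"

definition label_sigma :: "(bool list + bool list) set \<Rightarrow> 'w measure" where
  "label_sigma I = sigma (space M) (\<Union>i\<in>I. label_events i)"

lemma label_events_subset_Pow: "label_events i \<subseteq> Pow (space M)"
  using sets.sets_into_space by (fastforce simp: label_events_def split: sum.splits)

lemma space_label_sigma [simp]: "space (label_sigma I) = space M"
  unfolding label_sigma_def using label_events_subset_Pow by (intro space_measure_of) auto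

lemma sets_label_sigma: "sets (label_sigma I) = sigma_sets (space M) (\<Union>i\<in>I. label_events i)"
  unfolding label_sigma_def using label_events_subset_Pow by (intro sets_measure_of) auto

lemma indep_label_events: "indep_sets label_events UNIV"
  using lifetimes_motions_indep unfolding label_events_def by simp

lemma label_events_subset_events: "label_events i \<subseteq> events"
  using indep_label_events unfolding indep_sets_def by auto

lemma sets_label_sigma_subset: "sets (label_sigma I) \<subseteq> events"
  unfolding sets_label_sigma using label_events_subset_events by (intro sets.sigma_sets_subset) auto

lemma sets_label_sigma_mono: "I \<subseteq> J \<Longrightarrow> sets (label_sigma I) \<subseteq> sets (label_sigma J)"
  unfolding sets_label_sigma by (intro sigma_sets_mono') auto

lemma Int_stable_label_events: "Int_stable (label_events i)"
  by (cases i) (auto simp: label_events_def Int_stable_def)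

lemma indep_label_sigma_family:
  assumes "disjoint_family_on I J"
  shows "indep_sets (\<lambda>j. sets (label_sigma (I j))) J"
  unfolding sets_label_sigma
  by (rule indep_sets_collect_sigma)
    (auto intro: indep_sets_mono_index[OF _ indep_label_events] Int_stable_label_events assms)

lemma indep_label_sigma:
  assumes "I \<inter> J = {}"
  shows "indep_set (sets (label_sigma I)) (sets (label_sigma J))"
proof -
  have "disjoint_family (case_bool I J)"
    using assms by (auto simp: disjoint_family_on_def split: bool.splits)
  from indep_label_sigma_family[OF this] show ?thesis
    unfolding indep_set_def by (rule indep_sets_mono_sets) (auto split: bool.splits)
qed

lemma indep_var_label_sigma:
  assumes "I \<inter> J = {}" "X \<in> label_sigma I \<rightarrow>\<^sub>M N1" "Y \<in> label_sigma J \<rightarrow>\<^sub>M N2"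
  shows "indep_var N1 X N2 Y"
  using assms by (intro indep_var_subalgebra[OF _ _ _ _ indep_label_sigma]) (auto simp: sets_label_sigma_subset)

lemmas diagonal_label_sigma = indep_subalgebra_diagonal[OF space_label_sigma sets_label_sigma_subset space_label_sigma sets_label_sigma_subset indep_label_sigma]

lemma measurable_label_sigma_mono: "f \<in> label_sigma I \<rightarrow>\<^sub>M N \<Longrightarrow> I \<subseteq> J \<Longrightarrow> f \<in> label_sigma J \<rightarrow>\<^sub>M N"
  using sets_label_sigma_mono[of I J] by (auto simp: measurable_def)

lemma measurable_label_sigma_M: "f \<in> label_sigma I \<rightarrow>\<^sub>M N \<Longrightarrow> f \<in> M \<rightarrow>\<^sub>M N"
  using sets_label_sigma_subset[of I] by (auto simp: measurable_def)

lemma measurable_T_label_sigma: "Inl u \<in> I \<Longrightarrow> T u \<in> borel_measurable (label_sigma I)"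
proof -
  assume I: "Inl u \<in> I"
  have "T u -` A \<inter> space M \<in> label_events (Inl u)" if "A \<in> sets borel" for A
    using in_vimage_algebra[OF that] by (simp add: label_events_def)
  then show ?thesis using I
    by (intro measurableI) (auto simp: sets_label_sigma)
qed

lemma measurable_W_label_sigma:
  assumes I: "Inr u \<in> I" and s: "0 \<le> s"
  shows "W u s \<in> borel_measurable (label_sigma I)"
proof (rule measurableI)
  fix A :: "(real ^ 'd) set" assume "A \<in> sets borel"
  then have "(\<lambda>f. f s) -` A \<inter> space (\<Pi>\<^sub>M s\<in>{0..}. borel) \<in> sets (\<Pi>\<^sub>M s\<in>{0..}. borel)"
    using s by (intro measurable_sets[OF measurable_component_singleton]) auto
  from in_vimage_algebra[OF this, of "\<lambda>\<omega>. \<lambda>s\<in>{0..}. W u s \<omega>" "space M"]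
  have "(\<lambda>\<omega>. \<lambda>s\<in>{0..}. W u s \<omega>) -` ((\<lambda>f. f s) -` A \<inter> space (\<Pi>\<^sub>M s\<in>{0..}. borel)) \<inter> space M \<in> label_events (Inr u)"
    by (simp add: label_events_def)
  moreover have "(\<lambda>\<omega>. \<lambda>s\<in>{0..}. W u s \<omega>) -` ((\<lambda>f. f s) -` A \<inter> space (\<Pi>\<^sub>M s\<in>{0..}. borel)) \<inter> space M
      = W u s -` A \<inter> space M"
    using s by (auto simp: space_PiM)
  ultimately show "W u s -` A \<inter> space (label_sigma I) \<in> sets (label_sigma I)"
    using I by (auto simp: sets_label_sigma)
qed auto

text \<open>A version of the path of \<open>u\<close> that is jointly measurable in time and \<open>\<omega>\<close>, so that it may be
  evaluated at random times.\<close>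

definition path_at :: "bool list \<Rightarrow> real \<Rightarrow> 'w \<Rightarrow> real ^ 'd" where
  "path_at u s \<omega> = lim (\<lambda>n. W u (real (nat \<lceil>2 ^ n * s\<rceil>) / 2 ^ n) \<omega>)"

text \<open>The rounded times take countably many values. \<open>nat\<close> sends negative times to
  0, so only nonnegative times occur, which are those that \<open>label_events\<close>
  covers.\<close>

lemma measurable_path_at:
  assumes [measurable]: "f \<in> borel_measurable N" and g: "g \<in> N \<rightarrow>\<^sub>M label_sigma I" and I: "Inr u \<in> I"
  shows "(\<lambda>x. path_at u (f x) (g x)) \<in> borel_measurable N"
  unfolding path_at_def
proof (rule borel_measurable_lim_metric)
  fix n
  have k: "(\<lambda>x. nat \<lceil>2 ^ n * f x\<rceil>) \<in> N \<rightarrow>\<^sub>M count_space UNIV" by measurable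
  have "(\<lambda>x. W u (real i / 2 ^ n) (g x)) \<in> borel_measurable N" for i
    by (rule measurable_compose[OF g measurable_W_label_sigma[OF I]]) simp
  then show "(\<lambda>x. W u (real (nat \<lceil>2 ^ n * f x\<rceil>) / 2 ^ n) (g x)) \<in> borel_measurable N"
    by (rule measurable_compose_countable[OF _ k])
qed

lemma path_at_eq:
  assumes c: "continuous_on {0..} (\<lambda>s. W u s \<omega>)" and s: "0 \<le> s"
  shows "path_at u s \<omega> = W u s \<omega>"
proof -
  define q where "q n = real (nat \<lceil>2 ^ n * s\<rceil>) / 2 ^ n" for n :: nat
  have b: "s \<le> q n \<and> q n \<le> s + (1 / 2) ^ n" for n
  proof -
    have "2 ^ n * s \<le> real (nat \<lceil>2 ^ n * s\<rceil>)" "real (nat \<lceil>2 ^ n * s\<rceil>) \<le> 2 ^ n * s + 1"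
      using s by (simp_all add: of_nat_nat ceiling_mono[of 0, simplified])
    then show ?thesis by (simp add: q_def field_simps power_divide)
  qed
  have "q \<longlonglongrightarrow> s"
  proof (rule tendsto_sandwich[of "\<lambda>_. s" _ _ "\<lambda>n. s + (1 / 2) ^ n"])
    show "(\<lambda>n. s + (1 / 2) ^ n) \<longlonglongrightarrow> s" by real_asymp
  qed (use b in auto)
  moreover have "q n \<in> {0..}" for n by (simp add: q_def)
  ultimately have "(\<lambda>n. W u (q n) \<omega>) \<longlonglongrightarrow> W u s \<omega>"
    using continuous_on_tendsto_compose[OF c, of q s] s by simp
  then show ?thesis unfolding path_at_def q_def by (rule limI)
qed

definition regular :: "'w \<Rightarrow> bool" where
  "regular \<omega> \<longleftrightarrow> (\<forall>u. 0 < T u \<omega> \<and> W u 0 \<omega> = 0 \<and> continuous_on {0..} (\<lambda>s. W u s \<omega>))"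

lemma AE_regular:
  assumes "0 < \<beta>"
  shows "AE \<omega> in M. regular \<omega>"
proof -
  have "AE \<omega> in M. 0 < T u \<omega>" for u
  proof -
    have "AE x in lborel. ennreal (exponential_density \<beta> x) > 0 \<longrightarrow> x > 0"
      using AE_lborel_singleton[of "0::real"] by eventually_elim (auto simp: exponential_density_def split: if_splits)
    then show ?thesis
      by (subst distributed_AE2[OF lifetime_distr]) (auto simp: ennreal_0)
  qed
  then show ?thesis
    unfolding regular_def AE_all_countable using brownian_motion.starts_at_0[OF motion]
      brownian_motion.continuous_paths[OF motion] by (auto intro!: AE_conjI)
qed

section \<open>Increments along a line of descent\<close>

text \<open>Increments of time and place between the births of \<open>u\<close> and of its descendant \<open>w @ u\<close>. The
  displacement takes the lifetimes from its first sample point and the motions from its second one,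
  so that the lifetimes can be frozen.\<close>

primrec elapsed :: "bool list \<Rightarrow> bool list \<Rightarrow> 'w \<Rightarrow> real" where
  "elapsed u [] \<omega> = 0"
| "elapsed u (b # w) \<omega> = elapsed u w \<omega> + T (w @ u) \<omega>"

primrec displacement :: "bool list \<Rightarrow> bool list \<Rightarrow> 'w \<Rightarrow> 'w \<Rightarrow> real ^ 'd" where
  "displacement u [] \<omega> \<omega>' = 0"
| "displacement u (b # w) \<omega> \<omega>' = displacement u w \<omega> \<omega>' + path_at (w @ u) (T (w @ u) \<omega>) \<omega>'"

text \<open>The particles whose labels determine \<open>elapsed u w\<close> and
  \<open>displacement u w\<close> for \<open>length w = n\<close>. The inequality is strict because
  \<open>w @ u\<close> itself contributes nothing before its birth; this keeps the block disjoint
  from the subtrees that start at generation \<open>n\<close>.\<close>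

definition block :: "bool list \<Rightarrow> nat \<Rightarrow> bool list set" where
  "block u n = {w @ u | w. length w < n}"

lemma mem_block [simp]: "w @ u \<in> block u n \<longleftrightarrow> length w < n"
  by (auto simp: block_def)

lemma measurable_elapsed:
  assumes "Inl ` block u (length w) \<subseteq> I"
  shows "elapsed u w \<in> borel_measurable (label_sigma I)"
proof -
  have "\<And>n. length w \<le> n \<Longrightarrow> Inl ` block u n \<subseteq> I \<Longrightarrow> ?thesis"
  proof (induction w)
    case Nil
    have "elapsed u [] = (\<lambda>_. 0)" by auto
    then show ?case by simp
  next
    case (Cons b w)
    from Cons.prems have "Inl (w @ u) \<in> I" by auto
    note [measurable] = measurable_T_label_sigma[OF this]
    have [measurable]: "elapsed u w \<in> borel_measurable (label_sigma I)"
      by (rule Cons.IH[of n]) (use Cons.prems in auto)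
    have "elapsed u (b # w) = (\<lambda>\<omega>. elapsed u w \<omega> + T (w @ u) \<omega>)" by auto
    then show ?case by simp
  qed
  then show ?thesis using assms by blast
qed

lemma measurable_displacement:
  assumes "Inl ` block u (length w) \<subseteq> I" "Inr ` block u (length w) \<subseteq> J"
    and f: "f \<in> N \<rightarrow>\<^sub>M label_sigma I" and g: "g \<in> N \<rightarrow>\<^sub>M label_sigma J"
  shows "(\<lambda>x. displacement u w (f x) (g x)) \<in> borel_measurable N"
proof -
  have "\<And>n. length w \<le> n \<Longrightarrow> Inl ` block u n \<subseteq> I \<Longrightarrow> Inr ` block u n \<subseteq> J \<Longrightarrow> ?thesis"
  proof (induction w)
    case (Cons b w)
    from Cons.prems have "Inl (w @ u) \<in> I" and r: "Inr (w @ u) \<in> J" by auto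
    note m [measurable] = measurable_compose[OF f measurable_T_label_sigma[OF this(1)]]
    note [measurable] = measurable_path_at[OF m g r]
    have [measurable]: "(\<lambda>x. displacement u w (f x) (g x)) \<in> borel_measurable N"
      by (rule Cons.IH[of n]) (use Cons.prems in auto)
    show ?case by simp
  qed simp
  then show ?thesis using assms by blast
qed

lemma measurable_path_at_const: "Inr u \<in> I \<Longrightarrow> path_at u s \<in> borel_measurable (label_sigma I)"
  by (rule measurable_path_at[of "\<lambda>_. s" "label_sigma I" "\<lambda>x. x"]) auto

lemma birth_time_append: "birth_time (\<lambda>u. T u \<omega>) (w @ u) = birth_time (\<lambda>u. T u \<omega>) u + elapsed u w \<omega>"
  by (induction w) auto

lemma elapsed_nonneg: "regular \<omega> \<Longrightarrow> 0 \<le> elapsed u w \<omega>"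
  by (induction w) (auto simp: regular_def less_imp_le)

lemma elapsed_pos: "regular \<omega> \<Longrightarrow> w \<noteq> [] \<Longrightarrow> 0 < elapsed u w \<omega>"
  using elapsed_nonneg by (cases w) (auto simp: regular_def add_nonneg_pos)

lemma birth_place_append:
  assumes "regular \<omega>"
  shows "birth_place (\<lambda>u. T u \<omega>) (\<lambda>u s. W u s \<omega>) (w @ u) =
    birth_place (\<lambda>u. T u \<omega>) (\<lambda>u s. W u s \<omega>) u + displacement u w \<omega> \<omega>"
  using assms by (induction w) (auto simp: regular_def path_at_eq less_imp_le)

text \<open>A sum of \<open>length w\<close> independent exponential times.
  \<open>erlang_density k\<close> is the Gamma density of shape \<open>k + 1\<close>, hence the
  index \<open>length w - 1\<close>.\<close>

lemma elapsed_distributed: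
  assumes "0 < \<beta>" and "w \<noteq> []"
  shows "distributed M lborel (elapsed u w) (erlang_density (length w - 1) \<beta>)"
  using assms(2)
proof (induction w)
  case (Cons b w)
  have eq: "elapsed u (b # w) = (\<lambda>\<omega>. elapsed u w \<omega> + T (w @ u) \<omega>)" by auto
  show ?case
  proof (cases "w = []")
    case True
    then show ?thesis using lifetime_distr[of u] by (simp add: eq)
  next
    case False
    have "indep_var borel (elapsed u w) borel (T (w @ u))"
      by (rule indep_var_label_sigma[of "Inl ` block u (length w)" "{Inl (w @ u)}"])
        (auto intro!: measurable_elapsed measurable_T_label_sigma simp: block_def)
    from sum_indep_erlang[OF this assms(1) Cons.IH[OF False] lifetime_distr]
    show ?thesis using False unfolding eq by (cases w) auto
  qed
qed simp

lemma path_at_distributed: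
  assumes "0 < s"
  shows "distributed M lborel (path_at u s) (gauss_density s)"
proof -
  interpret W: brownian_motion M "W u" by (rule motion)
  have d: "distributed M lborel (\<lambda>\<omega>. W u s \<omega> - W u 0 \<omega>) (gauss_density s)"
    using W.increment_distr[of 0 s] assms by (simp add: gauss_density_def)
  have [measurable]: "path_at u s \<in> borel_measurable M"
    using measurable_label_sigma_M[OF measurable_path_at_const[of u UNIV]] by simp
  have "AE \<omega> in M. W u s \<omega> - W u 0 \<omega> = path_at u s \<omega>"
    using W.starts_at_0 W.continuous_paths by eventually_elim (use assms in \<open>simp add: path_at_eq\<close>)
  then have "distr M lborel (\<lambda>\<omega>. W u s \<omega> - W u 0 \<omega>) = distr M lborel (path_at u s)"
    using distributed_measurable[OF d] by (intro distr_cong_AE) auto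
  with d show ?thesis unfolding distributed_def by auto
qed

text \<open>With the lifetimes frozen at \<open>\<omega>\<close>, the displacement is a sum of
  independent paths evaluated at deterministic times, so the variances, which are the lifetimes, add
  up to \<open>elapsed u w \<omega>\<close>.\<close>

lemma displacement_distributed:
  assumes "regular \<omega>" and \<omega>: "\<omega> \<in> space M" and "w \<noteq> []"
  shows "distributed M lborel (displacement u w \<omega>) (gauss_density (elapsed u w \<omega>))"
  using assms(3)
proof (induction w)
  case (Cons b w)
  have eq: "displacement u (b # w) \<omega> = (\<lambda>\<omega>'. displacement u w \<omega> \<omega>' + path_at (w @ u) (T (w @ u) \<omega>) \<omega>')" by auto
  have T: "0 < T (w @ u) \<omega>" using assms by (simp add: regular_def)
  show ?case
  proof (cases "w = []")
    case True
    then show ?thesis using path_at_distributed[OF T] by (simp add: eq)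
  next
    case False
    have "displacement u w \<omega> \<in> borel_measurable (label_sigma (Inr ` block u (length w)))"
      by (rule measurable_displacement[of _ _ UNIV "Inr ` block u (length w)" "\<lambda>_. \<omega>" _ "\<lambda>x. x"]) (auto simp: \<omega>)
    then have "indep_var lborel (displacement u w \<omega>) lborel (path_at (w @ u) (T (w @ u) \<omega>))"
      by (intro indep_var_label_sigma[of "Inr ` block u (length w)" "{Inr (w @ u)}"])
        (auto intro!: measurable_path_at_const simp: block_def)
    from distributed_add_gauss[OF this Cons.IH[OF False] path_at_distributed[OF T] elapsed_pos[OF assms(1) False] T]
    show ?thesis unfolding eq by simp
  qed
qed simp

text \<open>Lifetimes carry the labels \<open>Inl\<close>, motions the labels \<open>Inr\<close>.
  These are disjoint, so the Gaussian law for fixed lifetimes can be used inside an integral over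
  the lifetimes.\<close>

lemma distributed_elapsed_displacement:
  assumes "0 < \<beta>" "w \<noteq> []" and P [measurable]: "Measurable.pred (borel \<Otimes>\<^sub>M borel) P"
  shows "emeasure M {\<omega> \<in> space M. P (elapsed u w \<omega>, displacement u w \<omega> \<omega>)} =
    (\<integral>\<^sup>+\<omega>. emeasure M {\<omega>' \<in> space M. P (elapsed u w \<omega>, displacement u w \<omega> \<omega>')} \<partial>M)"
proof -
  let ?I = "range Inl :: (bool list + bool list) set" and ?J = "range Inr :: (bool list + bool list) set"
  have id: "(\<lambda>\<omega>. \<omega>) \<in> M \<rightarrow>\<^sub>M label_sigma UNIV"
    by (rule measurable_label_sigma_M[of _ UNIV]) auto
  have m: "elapsed u w \<in> borel_measurable M"
    by (rule measurable_label_sigma_M[of _ UNIV]) (auto intro: measurable_elapsed)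
  have m2: "(\<lambda>\<omega>. displacement u w \<omega> \<omega>) \<in> borel_measurable M"
    by (rule measurable_displacement[of _ _ UNIV UNIV]) (auto intro: id)
  have m3: "(\<lambda>\<omega>'. displacement u w \<omega> \<omega>') \<in> borel_measurable M" if "\<omega> \<in> space M" for \<omega>
    by (rule measurable_displacement[of _ _ UNIV UNIV]) (auto simp: that intro: id)
  have e: "emeasure M {\<omega> \<in> space M. Q \<omega>} = (\<integral>\<^sup>+\<omega>. (if Q \<omega> then 1 else 0) \<partial>M)"
    if [measurable]: "Measurable.pred M Q" for Q
  proof -
    have "(\<integral>\<^sup>+\<omega>. (if Q \<omega> then 1 else 0) \<partial>M) = (\<integral>\<^sup>+\<omega>. indicator {\<omega> \<in> space M. Q \<omega>} \<omega> \<partial>M)"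
      by (intro nn_integral_cong) (auto simp: indicator_def)
    also have "\<dots> = emeasure M {\<omega> \<in> space M. Q \<omega>}"
      by (rule nn_integral_indicator) measurable
    finally show ?thesis by simp
  qed
  have [measurable]: "elapsed u w \<in> borel_measurable (label_sigma ?I)"
    "(\<lambda>x. displacement u w (fst x) (snd x)) \<in> borel_measurable (label_sigma ?I \<Otimes>\<^sub>M label_sigma ?J)"
    by (auto intro!: measurable_elapsed measurable_displacement[of _ _ ?I ?J])
  let ?f = "\<lambda>x. (if P (elapsed u w (fst x), displacement u w (fst x) (snd x)) then 1 else 0) :: ennreal"
  have f: "?f \<in> borel_measurable (label_sigma ?I \<Otimes>\<^sub>M label_sigma ?J)" by measurable
  have "emeasure M {\<omega> \<in> space M. P (elapsed u w \<omega>, displacement u w \<omega> \<omega>)} = (\<integral>\<^sup>+\<omega>. ?f (\<omega>, \<omega>) \<partial>M)"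
    using m m2 by (subst e) auto
  also have "\<dots> = (\<integral>\<^sup>+\<omega>. \<integral>\<^sup>+\<omega>'. ?f (\<omega>, \<omega>') \<partial>M \<partial>M)"
    by (rule diagonal_label_sigma[OF _ f]) auto
  also have "\<dots> = (\<integral>\<^sup>+\<omega>. emeasure M {\<omega>' \<in> space M. P (elapsed u w \<omega>, displacement u w \<omega> \<omega>')} \<partial>M)"
    using m3 by (intro nn_integral_cong) (subst e, auto)
  finally show ?thesis .
qed

section \<open>Quantitative bounds for times and places of birth\<close>

lemma measurable_elapsed_M [measurable]: "elapsed u w \<in> borel_measurable M"
  by (rule measurable_label_sigma_M[of _ UNIV]) (auto intro: measurable_elapsed)

lemma measurable_displacement_diag:
  assumes "Inl ` block u (length w) \<subseteq> I" "Inr ` block u (length w) \<subseteq> I"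
  shows "(\<lambda>\<omega>. displacement u w \<omega> \<omega>) \<in> borel_measurable (label_sigma I)"
  by (rule measurable_displacement[OF assms]) auto

lemma measurable_displacement_M [measurable]: "(\<lambda>\<omega>. displacement u w \<omega> \<omega>) \<in> borel_measurable M"
  by (rule measurable_label_sigma_M[of _ UNIV]) (auto intro: measurable_displacement_diag)

text \<open>On an interval of length one, the Erlang density is at least its power factor at the
  left end times its exponential factor at the right end.\<close>

lemma elapsed_ge:
  assumes "0 < \<beta>" "w \<noteq> []" "0 < a"
  shows "\<beta> ^ length w * a ^ (length w - 1) * exp (- \<beta> * (a + 1)) / fact (length w - 1)
    \<le> prob {\<omega> \<in> space M. a \<le> elapsed u w \<omega> \<and> elapsed u w \<omega> \<le> a + 1}"
proof -
  define k where "k = length w - 1"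
  have k: "length w = Suc k" using assms by (cases w) (auto simp: k_def)
  define c where "c = \<beta> ^ length w * a ^ (length w - 1) * exp (- \<beta> * (a + 1)) / fact (length w - 1)"
  have c0: "0 \<le> c" using assms by (simp add: c_def)
  have "ennreal c = (\<integral>\<^sup>+x. ennreal c * indicator {a .. a + 1} x \<partial>lborel)"
    by (subst nn_integral_cmult_indicator) auto
  also have "\<dots> \<le> (\<integral>\<^sup>+x. ennreal (erlang_density k \<beta> x) * indicator {a .. a + 1} x \<partial>lborel)"
  proof (rule nn_integral_mono)
    fix x
    have "c \<le> erlang_density k \<beta> x" if "x \<in> {a .. a + 1}"
      using assms that unfolding c_def erlang_density_def k
      by (auto intro!: divide_right_mono mult_mono power_mono)
    then show "ennreal c * indicator {a .. a + 1} x \<le> ennreal (erlang_density k \<beta> x) * indicator {a .. a + 1} x"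
      by (auto simp: indicator_def intro!: ennreal_leI)
  qed
  also have "\<dots> = emeasure M {\<omega> \<in> space M. a \<le> elapsed u w \<omega> \<and> elapsed u w \<omega> \<le> a + 1}"
    using distributed_emeasure[OF elapsed_distributed[OF assms(1,2)], of "{a .. a + 1}" u]
    by (simp add: vimage_def Int_def conj_ac k_def)
  finally show ?thesis using c0 by (simp add: emeasure_eq_measure c_def)
qed

text \<open>Half of the exponent yields the bound; the other half completes an Erlang density of
  rate \<open>\<beta> / 2\<close>, at the price of a factor 2 for every lifetime.\<close>

lemma elapsed_tail:
  assumes "0 < \<beta>" "w \<noteq> []"
  shows "prob {\<omega> \<in> space M. a < elapsed u w \<omega>} \<le> 2 ^ length w * exp (- \<beta> * a / 2)"
proof -
  define k where "k = length w - 1"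
  have k: "length w = Suc k" using assms by (cases w) (auto simp: k_def)
  have "emeasure M {\<omega> \<in> space M. a < elapsed u w \<omega>} = (\<integral>\<^sup>+x. ennreal (erlang_density k \<beta> x) * indicator {a <..} x \<partial>lborel)"
    using distributed_emeasure[OF elapsed_distributed[OF assms(1,2)], of "{a <..}" u]
    by (simp add: vimage_def Int_def conj_ac k_def)
  also have "\<dots> \<le> (\<integral>\<^sup>+x. ennreal (2 ^ length w * exp (- \<beta> * a / 2)) * ennreal (erlang_density k (\<beta> / 2) x * x ^ 0) \<partial>lborel)"
  proof (rule nn_integral_mono)
    fix x :: real
    show "ennreal (erlang_density k \<beta> x) * indicator {a <..} x \<le> ennreal (2 ^ length w * exp (- \<beta> * a / 2)) * ennreal (erlang_density k (\<beta> / 2) x * x ^ 0)"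
    proof (cases "0 \<le> x \<and> a < x")
      case True
      have "exp (- \<beta> * x) = exp (- \<beta> * x / 2) * exp (- \<beta> * x / 2)" by (simp add: exp_add[symmetric])
      also have "\<dots> \<le> exp (- \<beta> * a / 2) * exp (- \<beta> * x / 2)"
        using True assms by (intro mult_right_mono) auto
      finally have "\<beta> ^ Suc k * x ^ k * exp (- \<beta> * x) / fact k \<le> \<beta> ^ Suc k * x ^ k * (exp (- \<beta> * a / 2) * exp (- \<beta> * x / 2)) / fact k"
        using True assms by (intro divide_right_mono mult_left_mono) auto
      then have "erlang_density k \<beta> x \<le> 2 ^ length w * exp (- \<beta> * a / 2) * erlang_density k (\<beta> / 2) x"
        using True by (simp add: erlang_density_def k power_divide field_simps)
      then show ?thesis using True assms by (simp add: ennreal_mult[symmetric] ennreal_leI)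
    next
      case False
      then have "ennreal (erlang_density k \<beta> x) * indicator {a <..} x = 0"
        by (auto simp: erlang_density_def indicator_def)
      then show ?thesis by (simp only: zero_le)
    qed
  qed
  also have "\<dots> = ennreal (2 ^ length w * exp (- \<beta> * a / 2))"
    using nn_integral_erlang_ith_moment[of "\<beta> / 2" k 0] assms by (subst nn_integral_cmult) auto
  finally show ?thesis by (simp add: emeasure_eq_measure)
qed

lemma displacement_tail:
  assumes "0 < \<beta>" "w \<noteq> []" "0 < S" "0 \<le> b"
  shows "prob {\<omega> \<in> space M. elapsed u w \<omega> \<le> S \<and> b < norm (displacement u w \<omega> \<omega>)} \<le> 2 ^ CARD('d) * exp (- b\<^sup>2 / (4 * S))"
proof -
  let ?c = "2 ^ CARD('d) * exp (- b\<^sup>2 / (4 * S))"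
  have "emeasure M {\<omega> \<in> space M. elapsed u w \<omega> \<le> S \<and> b < norm (displacement u w \<omega> \<omega>)} =
    (\<integral>\<^sup>+\<omega>. emeasure M {\<omega>' \<in> space M. elapsed u w \<omega> \<le> S \<and> b < norm (displacement u w \<omega> \<omega>')} \<partial>M)"
    using distributed_elapsed_displacement[OF assms(1,2), of "\<lambda>(s, x). s \<le> S \<and> b < norm x" u] by simp
  also have "\<dots> \<le> (\<integral>\<^sup>+\<omega>. ennreal ?c \<partial>M)"
  proof (rule nn_integral_mono_AE)
    show "AE \<omega> in M. emeasure M {\<omega>' \<in> space M. elapsed u w \<omega> \<le> S \<and> b < norm (displacement u w \<omega> \<omega>')} \<le> ennreal ?c"
      using AE_regular[OF assms(1)] AE_space
    proof eventually_elim
      fix \<omega> assume r: "regular \<omega>" "\<omega> \<in> space M"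
      show "emeasure M {\<omega>' \<in> space M. elapsed u w \<omega> \<le> S \<and> b < norm (displacement u w \<omega> \<omega>')} \<le> ennreal ?c"
      proof (cases "elapsed u w \<omega> \<le> S")
        case True
        from gauss_tail[OF displacement_distributed[OF r assms(2)] elapsed_pos[OF r(1) assms(2)] True assms(4)]
        show ?thesis using True by (simp add: emeasure_eq_measure ennreal_leI)
      qed simp
    qed
  qed
  also have "\<dots> = ennreal ?c" by (simp add: emeasure_space_1)
  finally show ?thesis by (simp add: emeasure_eq_measure)
qed

lemma elapsed_displacement_ge:
  assumes "0 < \<beta>" "w \<noteq> []" "0 < a" "0 < b"
  shows "prob {\<omega> \<in> space M. a \<le> elapsed u w \<omega> \<and> elapsed u w \<omega> \<le> a + 1} *
      ((2 * b / sqrt (2 * pi * (a + 1))) ^ CARD('d) * exp (- (\<Sum>i\<in>UNIV. (\<bar>z $ i\<bar> + b)\<^sup>2) / (2 * a)))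
    \<le> prob {\<omega> \<in> space M. (a \<le> elapsed u w \<omega> \<and> elapsed u w \<omega> \<le> a + 1) \<and> (\<forall>i. \<bar>displacement u w \<omega> \<omega> $ i - z $ i\<bar> \<le> b)}"
    (is "prob ?A * ?q \<le> prob ?B")
proof -
  have q0: "0 \<le> ?q" using assms by simp
  have "ennreal (prob ?A * ?q) = (\<integral>\<^sup>+\<omega>. ennreal ?q * indicator ?A \<omega> \<partial>M)"
    using q0 by (subst nn_integral_cmult_indicator) (auto simp: emeasure_eq_measure ennreal_mult mult.commute)
  also have "\<dots> \<le> (\<integral>\<^sup>+\<omega>. emeasure M {\<omega>' \<in> space M. (a \<le> elapsed u w \<omega> \<and> elapsed u w \<omega> \<le> a + 1) \<and> (\<forall>i. \<bar>displacement u w \<omega> \<omega>' $ i - z $ i\<bar> \<le> b)} \<partial>M)"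
  proof (rule nn_integral_mono_AE)
    show "AE \<omega> in M. ennreal ?q * indicator ?A \<omega> \<le> emeasure M {\<omega>' \<in> space M. (a \<le> elapsed u w \<omega> \<and> elapsed u w \<omega> \<le> a + 1) \<and> (\<forall>i. \<bar>displacement u w \<omega> \<omega>' $ i - z $ i\<bar> \<le> b)}"
      using AE_regular[OF assms(1)] AE_space
    proof eventually_elim
      fix \<omega> assume r: "regular \<omega>" "\<omega> \<in> space M"
      show "ennreal ?q * indicator ?A \<omega> \<le> emeasure M {\<omega>' \<in> space M. (a \<le> elapsed u w \<omega> \<and> elapsed u w \<omega> \<le> a + 1) \<and> (\<forall>i. \<bar>displacement u w \<omega> \<omega>' $ i - z $ i\<bar> \<le> b)}"
      proof (cases "\<omega> \<in> ?A")
        case True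
        then have t: "a \<le> elapsed u w \<omega>" "elapsed u w \<omega> \<le> a + 1" by auto
        from gauss_box[OF displacement_distributed[OF r assms(2)] assms(3) t assms(4), of z]
        show ?thesis using True t by (simp add: emeasure_eq_measure ennreal_leI)
      qed simp
    qed
  qed
  also have "\<dots> = emeasure M ?B"
    using distributed_elapsed_displacement[OF assms(1,2), of "\<lambda>(s, x). (a \<le> s \<and> s \<le> a + 1) \<and> (\<forall>i. \<bar>x $ i - z $ i\<bar> \<le> b)" u] by simp
  finally show ?thesis by (simp add: emeasure_eq_measure)
qed

end

section \<open>Hitting probabilities by blocks of generations\<close>

text \<open>The binomial expansion cut after the quadratic term is an upper bound, and under
  \<open>h k \<le> 1\<close> the quadratic term eats at most half of the linear one.\<close>

lemma power_one_minus_le: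
  fixes h :: real
  assumes h: "0 \<le> h" "h \<le> 1" and k: "h * real k \<le> 1"
  shows "(1 - h) ^ k \<le> 1 - h * real k / 2"
proof -
  have *: "(1 - h) ^ k \<le> 1 - h * real k + h\<^sup>2 * (real k)\<^sup>2 / 2" for k
  proof (induction k)
    case (Suc k)
    have "(1 - h) ^ Suc k \<le> (1 - h) * (1 - h * real k + h\<^sup>2 * (real k)\<^sup>2 / 2)"
      using Suc h by (simp add: mult_left_mono)
    also have "\<dots> = 1 - h * real (Suc k) + h\<^sup>2 * (real (Suc k))\<^sup>2 / 2 - h\<^sup>2 / 2 - h * (h\<^sup>2 * (real k)\<^sup>2) / 2"
      by (simp add: field_simps power2_eq_square)
    also have "\<dots> \<le> 1 - h * real (Suc k) + h\<^sup>2 * (real (Suc k))\<^sup>2 / 2"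
    proof -
      have "0 \<le> h\<^sup>2 / 2" "0 \<le> h * (h\<^sup>2 * (real k)\<^sup>2) / 2" using h by simp_all
      then show ?thesis by linarith
    qed
    finally show ?case .
  qed simp
  have "h\<^sup>2 * (real k)\<^sup>2 = (h * real k) * (h * real k)" by (simp add: power2_eq_square)
  also have "\<dots> \<le> 1 * (h * real k)" using h k by (intro mult_right_mono) auto
  finally show ?thesis using *[of k] by simp
qed

section \<open>Words, subtrees and their labels\<close>

definition words :: "nat \<Rightarrow> bool list set" where
  "words G = {w. length w = G}"

lemma finite_words [simp]: "finite (words G)"
  using finite_lists_length_eq[of "UNIV :: bool set" G] by (simp add: words_def)

lemma card_words [simp]: "card (words G) = 2 ^ G"
  using card_lists_length_eq[of "UNIV :: bool set" G] by (simp add: words_def card_UNIV_bool)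

definition descendants :: "bool list \<Rightarrow> bool list set" where
  "descendants u = range (\<lambda>w. w @ u)"

definition marks :: "'a set \<Rightarrow> ('a + 'a) set" where
  "marks A = Inl ` A \<union> Inr ` A"

lemma marks_mono: "A \<subseteq> B \<Longrightarrow> marks A \<subseteq> marks B"
  by (auto simp: marks_def)

lemma descendants_append: "descendants (w @ u) \<subseteq> descendants u"
  by (auto simp: descendants_def)

lemma disjoint_descendants:
  assumes "v \<in> words G" "w \<in> words G" "v \<noteq> w"
  shows "descendants (v @ u) \<inter> descendants (w @ u) = {}"
proof -
  have "x @ v @ u \<noteq> y @ w @ u" for x y
    using assms by (simp add: words_def)
  then show ?thesis by (auto simp: descendants_def)
qed

context dyadic_bbm
begin

lemma block_subset_descendants: "block u n \<subseteq> descendants u"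
  by (auto simp: descendants_def block_def)

lemma block_disjoint_descendants: "w \<in> words G \<Longrightarrow> block u G \<inter> descendants (w @ u) = {}"
  by (auto simp: descendants_def block_def words_def)

definition increment :: "bool list \<Rightarrow> bool list \<Rightarrow> 'w \<Rightarrow> real \<times> (real ^ 'd)" where
  "increment u w \<omega> = (elapsed u w \<omega>, displacement u w \<omega> \<omega>)"

lemma measurable_increment:
  assumes "marks (block u (length w)) \<subseteq> I"
  shows "increment u w \<in> borel_measurable (label_sigma I)"
proof -
  have "(\<lambda>\<omega>. (elapsed u w \<omega>, displacement u w \<omega> \<omega>)) \<in> borel_measurable (label_sigma I)"
    using assms by (intro borel_measurable_Pair measurable_elapsed measurable_displacement_diag) (auto simp: marks_def)
  then show ?thesis by (simp add: increment_def[abs_def])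
qed

lemma measurable_increment_M [measurable]: "increment u w \<in> borel_measurable M"
  by (rule measurable_label_sigma_M[of _ UNIV]) (auto intro: measurable_increment)

text \<open>Here \<open>z\<close> is the time and place of birth of \<open>u\<close>, and \<open>n\<close> blocks of \<open>G\<close> generations are still to go.\<close>

primrec hit :: "(bool list \<Rightarrow> real \<times> (real ^ 'd) \<Rightarrow> 'w \<Rightarrow> bool) \<Rightarrow> nat \<Rightarrow> (real \<times> (real ^ 'd)) set \<Rightarrow>
    nat \<Rightarrow> bool list \<Rightarrow> real \<times> (real ^ 'd) \<Rightarrow> 'w \<Rightarrow> bool" where
  "hit F G S 0 u z \<omega> = F u z \<omega>"
| "hit F G S (Suc n) u z \<omega> =
    (\<exists>w\<in>words G. increment u w \<omega> \<in> S \<and> hit F G S n (w @ u) (z + increment u w \<omega>) \<omega>)"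

text \<open>The event depends on the sample point through the subtree of \<open>u\<close> only.
  Measurability is joint in the birth data and the sample point, so that random birth data may be
  substituted.\<close>

definition adapted :: "(bool list \<Rightarrow> real \<times> (real ^ 'd) \<Rightarrow> 'w \<Rightarrow> bool) \<Rightarrow> bool" where
  "adapted F \<longleftrightarrow> (\<forall>u. Measurable.pred (borel \<Otimes>\<^sub>M label_sigma (marks (descendants u))) (\<lambda>p. F u (fst p) (snd p)))"

lemma measurable_adapted:
  assumes F: "adapted F" and f: "f \<in> borel_measurable N" and g: "g \<in> N \<rightarrow>\<^sub>M label_sigma I"
    and I: "marks (descendants u) \<subseteq> I"
  shows "Measurable.pred N (\<lambda>y. F u (f y) (g y))"
proof -
  have "(\<lambda>y. (f y, g y)) \<in> N \<rightarrow>\<^sub>M borel \<Otimes>\<^sub>M label_sigma (marks (descendants u))"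
    using measurable_compose[OF g measurable_label_sigma_mono[OF measurable_ident_sets[OF refl] I]] f by simp
  from measurable_compose[OF this, of "\<lambda>p. F u (fst p) (snd p)"] F show ?thesis
    by (simp add: adapted_def)
qed

lemma measurable_adapted_M:
  assumes F: "adapted F" and f: "f \<in> borel_measurable M"
  shows "Measurable.pred M (\<lambda>\<omega>. F u (f \<omega>) \<omega>)"
  by (rule measurable_adapted[OF F f, of _ UNIV]) (auto intro: measurable_label_sigma_M[of _ UNIV])

lemma adapted_hit:
  assumes F: "adapted F" and S [measurable]: "S \<in> sets borel"
  shows "adapted (hit F G S n)"
proof (induction n)
  case 0
  then show ?case using F by (simp add: adapted_def)
next
  case (Suc n)
  show ?case unfolding adapted_def
  proof
    fix u
    let ?N = "borel \<Otimes>\<^sub>M label_sigma (marks (descendants u)) :: ((real \<times> (real ^ 'd)) \<times> 'w) measure"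
    have [measurable]: "(\<lambda>p. increment u w (snd p)) \<in> borel_measurable ?N" for w
      by (rule measurable_compose[OF measurable_snd measurable_increment]) (intro marks_mono block_subset_descendants)
    have [measurable]: "Measurable.pred ?N (\<lambda>p. hit F G S n (w @ u) (fst p + increment u w (snd p)) (snd p))" for w
      by (rule measurable_adapted[OF Suc, of _ _ _ "marks (descendants u)"]) (auto intro!: marks_mono descendants_append)
    show "Measurable.pred ?N (\<lambda>p. hit F G S (Suc n) u (fst p) (snd p))"
      by simp
  qed
qed

text \<open>Given the first \<open>G\<close> generations, the subtrees of their offspring are independent.\<close>

lemma one_step:
  assumes H: "adapted H" and A [measurable]: "A \<in> sets borel"
    and Q [measurable]: "Measurable.pred (label_sigma (marks (block u G))) Q"
    and h: "0 \<le> h" "h \<le> 1" "\<And>v a. a \<in> A \<Longrightarrow> h \<le> prob {\<omega> \<in> space M. H v (z + a) \<omega>}"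
  shows "emeasure M {\<omega> \<in> space M. Q \<omega> \<and> (\<forall>w\<in>words G. increment u w \<omega> \<in> A \<longrightarrow> \<not> H (w @ u) (z + increment u w \<omega>) \<omega>)}
    \<le> (\<integral>\<^sup>+\<omega>. (if Q \<omega> then ennreal ((1 - h) ^ card {w \<in> words G. increment u w \<omega> \<in> A}) else 0) \<partial>M)"
proof -
  \<comment> \<open>\<open>?I\<close> holds the labels that determine the increments,
    \<open>?J\<close> those that decide \<open>H\<close> for the offspring. Their disjointness
    allows the increments to be frozen.\<close>
  let ?I = "marks (block u G)" and ?J = "\<Union>w\<in>words G. marks (descendants (w @ u))"
  let ?N = "label_sigma ?I \<Otimes>\<^sub>M label_sigma ?J"
  have QM [measurable]: "Measurable.pred M Q" using Q by (rule measurable_label_sigma_M)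
  have disj: "?I \<inter> ?J = {}"
    using block_disjoint_descendants by (fastforce simp: marks_def)
  let ?P = "\<lambda>\<omega> \<omega>'. Q \<omega> \<and> (\<forall>w\<in>words G. increment u w \<omega> \<in> A \<longrightarrow> \<not> H (w @ u) (z + increment u w \<omega>) \<omega>')"
  have m1 [measurable]: "Measurable.pred M (\<lambda>\<omega>. H (w @ u) (z + increment u w \<omega>) \<omega>)" for w
    by (rule measurable_adapted_M[OF H]) simp
  have set: "{\<omega> \<in> space M. ?P \<omega> \<omega>} \<in> events" by measurable
  have i1: "(\<lambda>p. increment u w (fst p)) \<in> borel_measurable ?N" if "w \<in> words G" for w
    by (rule measurable_compose[OF measurable_fst measurable_increment]) (use that in \<open>auto simp: words_def\<close>)
  have i2: "Measurable.pred ?N (\<lambda>p. H (w @ u) (z + increment u w (fst p)) (snd p))" if "w \<in> words G" for w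
    by (rule measurable_adapted[OF H, of _ _ _ ?J]) (use that i1 in auto)
  have i3: "Measurable.pred ?N (\<lambda>p. Q (fst p))" by measurable
  have i4: "Measurable.pred ?N (\<lambda>p. increment u w (fst p) \<in> A)" if "w \<in> words G" for w
    using i1[OF that] by measurable
  have P: "Measurable.pred ?N (\<lambda>p. ?P (fst p) (snd p))"
    using i3 i2 i4 by (intro pred_intros_logic pred_intros_finite) auto
  let ?f = "\<lambda>p. (if ?P (fst p) (snd p) then 1 else 0) :: ennreal"
  have f: "?f \<in> borel_measurable ?N"
    using P by measurable
  have "emeasure M {\<omega> \<in> space M. ?P \<omega> \<omega>} = (\<integral>\<^sup>+\<omega>. indicator {\<omega> \<in> space M. ?P \<omega> \<omega>} \<omega> \<partial>M)"
    by (rule nn_integral_indicator[symmetric, OF set])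
  also have "\<dots> = (\<integral>\<^sup>+\<omega>. ?f (\<omega>, \<omega>) \<partial>M)"
    by (intro nn_integral_cong) (auto simp: indicator_def)
  also have "\<dots> = (\<integral>\<^sup>+\<omega>. \<integral>\<^sup>+\<omega>'. ?f (\<omega>, \<omega>') \<partial>M \<partial>M)"
    by (rule diagonal_label_sigma[OF disj f])
  also have "\<dots> \<le> (\<integral>\<^sup>+\<omega>. (if Q \<omega> then ennreal ((1 - h) ^ card {w \<in> words G. increment u w \<omega> \<in> A}) else 0) \<partial>M)"
  proof (rule nn_integral_mono)
    fix \<omega> assume "\<omega> \<in> space M"
    define C where "C = {w \<in> words G. increment u w \<omega> \<in> A}"
    define E where "E w = {\<omega>' \<in> space M. \<not> H (w @ u) (z + increment u w \<omega>) \<omega>'}" for w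
    have C: "finite C" "C \<subseteq> words G" by (auto simp: C_def)
    have pH: "Measurable.pred (label_sigma (marks (descendants (w @ u)))) (\<lambda>\<omega>'. H (w @ u) a \<omega>')" for w a
      by (rule measurable_adapted[OF H, of _ _ "\<lambda>x. x" "marks (descendants (w @ u))"]) auto
    have ind: "indep_sets (\<lambda>w. sets (label_sigma (marks (descendants (w @ u))))) (words G)"
    proof (rule indep_label_sigma_family, unfold disjoint_family_on_def, safe)
      fix v w x assume "v \<in> words G" "w \<in> words G" "v \<noteq> w" and x: "x \<in> marks (descendants (v @ u))" "x \<in> marks (descendants (w @ u))"
      from disjoint_descendants[OF this(1-3), of u] x show "x \<in> {}" by (auto simp: marks_def)
    qed
    have E: "E w \<in> sets (label_sigma (marks (descendants (w @ u))))" for w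
    proof -
      note [measurable] = pH[of w "z + increment u w \<omega>"]
      have "{\<omega>' \<in> space (label_sigma (marks (descendants (w @ u)))). \<not> H (w @ u) (z + increment u w \<omega>) \<omega>'} \<in> sets (label_sigma (marks (descendants (w @ u))))"
        by measurable
      then show ?thesis by (simp add: E_def)
    qed
    have Eev: "E w \<in> events" for w using E sets_label_sigma_subset by blast
    have Ep: "prob (E w) \<le> 1 - h" if "w \<in> C" for w
    proof -
      have "prob (space M - E w) = 1 - prob (E w)" by (rule prob_compl[OF Eev])
      moreover have "space M - E w = {\<omega>' \<in> space M. H (w @ u) (z + increment u w \<omega>) \<omega>'}" by (auto simp: E_def)
      moreover have "h \<le> prob {\<omega>' \<in> space M. H (w @ u) (z + increment u w \<omega>) \<omega>'}"
        using that by (intro h) (simp add: C_def)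
      ultimately show ?thesis by simp
    qed
    \<comment> \<open>Empty \<open>C\<close> is treated apart: the bound is then 1, and an empty
      intersection would be \<open>UNIV\<close> instead of \<open>space M\<close>.\<close>
    show "(\<integral>\<^sup>+\<omega>'. ?f (\<omega>, \<omega>') \<partial>M) \<le> (if Q \<omega> then ennreal ((1 - h) ^ card {w \<in> words G. increment u w \<omega> \<in> A}) else 0)"
    proof (cases "Q \<omega> \<and> C \<noteq> {}")
      case True
      have "(\<integral>\<^sup>+\<omega>'. ?f (\<omega>, \<omega>') \<partial>M) = (\<integral>\<^sup>+\<omega>'. indicator (\<Inter>w\<in>C. E w) \<omega>' \<partial>M)"
        using True by (intro nn_integral_cong) (auto simp: C_def E_def indicator_def)
      also have "\<dots> = emeasure M (\<Inter>w\<in>C. E w)"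
        using C True Eev by (intro nn_integral_indicator sets.finite_INT) auto
      also have "\<dots> = ennreal (prob (\<Inter>w\<in>C. E w))" by (simp add: emeasure_eq_measure)
      also have "prob (\<Inter>w\<in>C. E w) = (\<Prod>w\<in>C. prob (E w))"
        using C True E by (intro indep_setsD[OF ind]) auto
      also have "\<dots> \<le> (\<Prod>w\<in>C. 1 - h)" using Ep by (intro prod_mono) auto
      also have "\<dots> = (1 - h) ^ card C" by simp
      finally show ?thesis using True by (simp add: C_def ennreal_leI)
    next
      case False
      show ?thesis
      proof (cases "Q \<omega>")
        case True
        with False have "C = {}" by simp
        moreover have "(\<integral>\<^sup>+\<omega>'. ?f (\<omega>, \<omega>') \<partial>M) \<le> (\<integral>\<^sup>+\<omega>'. 1 \<partial>M)"
          by (intro nn_integral_mono) auto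
        ultimately show ?thesis using True by (simp add: C_def[symmetric] emeasure_space_1)
      qed simp
    qed
  qed
  finally show ?thesis .
qed

text \<open>As long as the hitting probability is below \<open>2 ^ (- G)\<close>, each block multiplies it at least by half the
  mean number of good descendants.\<close>

lemma hit_prob:
  assumes F: "adapted F" and S [measurable]: "S \<in> sets borel"
    and m: "2 \<le> m" "\<And>u w. w \<in> words G \<Longrightarrow> m / 2 ^ G \<le> prob {\<omega> \<in> space M. increment u w \<omega> \<in> S}"
    and p: "0 \<le> p" "\<And>u z. z \<in> K 0 \<Longrightarrow> p \<le> prob {\<omega> \<in> space M. F u z \<omega>}"
    and K: "\<And>n z a. n < N \<Longrightarrow> z \<in> K (Suc n) \<Longrightarrow> a \<in> S \<Longrightarrow> z + a \<in> K n"
  shows "n \<le> N \<Longrightarrow> z \<in> K n \<Longrightarrow> min (p * (m / 2) ^ n) (1 / 2 ^ G) \<le> prob {\<omega> \<in> space M. hit F G S n u z \<omega>}"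
proof (induction n arbitrary: u z)
  case 0
  then show ?case using p(2)[of z u] by simp
next
  case (Suc n)
  \<comment> \<open>The cap ensures that \<open>h\<close> times the number of good offspring never
    exceeds 1, as \<open>power_one_minus_le\<close> demands.\<close>
  define h where "h = min (p * (m / 2) ^ n) (1 / 2 ^ G)"
  have h0: "0 \<le> h" using p m by (simp add: h_def)
  have hG: "h * 2 ^ G \<le> 1" unfolding h_def by (simp add: min_def field_simps)
  have h1: "h \<le> 1" using order_trans[OF _ hG, of h] h0 by (simp add: mult_le_cancel_left1)
  define X where "X \<omega> = card {w \<in> words G. increment u w \<omega> \<in> S}" for \<omega>
  have XG: "X \<omega> \<le> 2 ^ G" for \<omega>
    unfolding X_def card_words[symmetric] by (intro card_mono) auto
  have XGr: "real (X \<omega>) \<le> 2 ^ G" for \<omega>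
    using of_nat_mono[OF XG, where 'a = real] by simp
  have hX: "h * real (X \<omega>) \<le> 1" for \<omega>
  proof -
    from XGr[of \<omega>] have "h * real (X \<omega>) \<le> h * 2 ^ G" using h0 by (rule mult_left_mono)
    then show ?thesis using hG by simp
  qed
  have X_sum: "real (X \<omega>) = (\<Sum>w\<in>words G. indicator {\<omega>. increment u w \<omega> \<in> S} \<omega>)" for \<omega>
    by (simp add: X_def indicator_def sum.If_cases Int_def)
  have Xm [measurable]: "(\<lambda>\<omega>. real (X \<omega>)) \<in> borel_measurable M" unfolding X_sum by measurable
  have EX: "m \<le> expectation (\<lambda>\<omega>. real (X \<omega>))"
  proof -
    have "m = (\<Sum>w\<in>words G. m / 2 ^ G)" by simp
    also have "\<dots> \<le> (\<Sum>w\<in>words G. prob {\<omega> \<in> space M. increment u w \<omega> \<in> S})"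
      by (intro sum_mono m)
    also have "\<dots> = (\<Sum>w\<in>words G. expectation (indicator {\<omega> \<in> space M. increment u w \<omega> \<in> S}))"
      by simp
    also have "\<dots> = expectation (\<lambda>\<omega>. \<Sum>w\<in>words G. indicator {\<omega> \<in> space M. increment u w \<omega> \<in> S} \<omega>)"
      by (intro Bochner_Integration.integral_sum[symmetric] integrable_real_indicator) (auto simp: emeasure_eq_measure)
    also have "\<dots> = expectation (\<lambda>\<omega>. real (X \<omega>))"
      unfolding X_sum by (intro Bochner_Integration.integral_cong sum.cong) (auto simp: indicator_def)
    finally show ?thesis .
  qed
  have iX: "integrable M (\<lambda>\<omega>. real (X \<omega>))"
    by (rule integrable_const_bound[of _ "2 ^ G"]) (use XGr in auto)
  have m1 [measurable]: "Measurable.pred M (hit F G S (Suc n) u z)"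
    by (rule measurable_adapted_M[OF adapted_hit[OF F S]]) simp
  have "emeasure M {\<omega> \<in> space M. \<not> hit F G S (Suc n) u z \<omega>} =
    emeasure M {\<omega> \<in> space M. True \<and> (\<forall>w\<in>words G. increment u w \<omega> \<in> S \<longrightarrow> \<not> hit F G S n (w @ u) (z + increment u w \<omega>) \<omega>)}"
    by (intro arg_cong[where f = "emeasure M"]) auto
  also have "\<dots> \<le> (\<integral>\<^sup>+\<omega>. (if True then ennreal ((1 - h) ^ card {w \<in> words G. increment u w \<omega> \<in> S}) else 0) \<partial>M)"
    using Suc K h0 h1 by (intro one_step adapted_hit F S) (auto simp: h_def)
  also have "\<dots> \<le> (\<integral>\<^sup>+\<omega>. ennreal (1 - h / 2 * real (X \<omega>)) \<partial>M)"
  proof (intro nn_integral_mono)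
    fix \<omega>
    show "(if True then ennreal ((1 - h) ^ card {w \<in> words G. increment u w \<omega> \<in> S}) else 0) \<le> ennreal (1 - h / 2 * real (X \<omega>))"
      using power_one_minus_le[OF h0 h1 hX, of \<omega>] by (simp add: X_def[symmetric] ennreal_leI)
  qed
  also have "\<dots> = ennreal (expectation (\<lambda>\<omega>. 1 - h / 2 * real (X \<omega>)))"
  proof (rule nn_integral_eq_integral)
    show "AE \<omega> in M. 0 \<le> 1 - h / 2 * real (X \<omega>)"
      using hX by (intro AE_I2) (simp add: order_trans[OF hX])
  qed (use iX in auto)
  also have "expectation (\<lambda>\<omega>. 1 - h / 2 * real (X \<omega>)) = 1 - h / 2 * expectation (\<lambda>\<omega>. real (X \<omega>))"
    using iX by (simp add: prob_space)
  also have "\<dots> \<le> 1 - h / 2 * m" using EX h0 by (intro diff_left_mono mult_left_mono) auto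
  finally have *: "emeasure M {\<omega> \<in> space M. \<not> hit F G S (Suc n) u z \<omega>} \<le> ennreal (1 - h / 2 * m)"
    by (simp add: ennreal_leI)
  have "1 - prob {\<omega> \<in> space M. hit F G S (Suc n) u z \<omega>} = prob {\<omega> \<in> space M. \<not> hit F G S (Suc n) u z \<omega>}"
    by (subst prob_neg[symmetric]) (auto simp del: hit.simps)
  with * have **: "1 - prob {\<omega> \<in> space M. hit F G S (Suc n) u z \<omega>} \<le> max 0 (1 - h / 2 * m)"
    by (auto simp: emeasure_eq_measure ennreal_le_iff2 max_def simp del: hit.simps)
  \<comment> \<open>Since \<open>m / 2 \<ge> 1\<close>, a lower bound that has reached the cap is
    kept there by all further blocks.\<close>
  have "min (p * (m / 2) ^ Suc n) (1 / 2 ^ G) \<le> min (p * (m / 2) ^ Suc n) (m / 2 * (1 / 2 ^ G))"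
  proof (intro min.mono order_refl)
    show "1 / 2 ^ G \<le> m / 2 * (1 / 2 ^ G)" using m mult_right_mono[of 1 "m / 2" "1 / 2 ^ G"] by simp
  qed
  also have "\<dots> = m / 2 * h"
    using m by (simp add: h_def min_mult_distrib_left mult_ac)
  finally have "min (p * (m / 2) ^ Suc n) (1 / 2 ^ G) \<le> h / 2 * m" by (simp add: mult_ac)
  moreover have "min (p * (m / 2) ^ Suc n) (1 / 2 ^ G) \<le> 1"
    by (rule order_trans[OF min.cobounded2]) simp
  ultimately show ?case using ** by (auto simp: max_def simp del: hit.simps split: if_splits)
qed

end

section \<open>A particle staying close to a target\<close>

text \<open>The point \<open>i\<close> of level \<open>n + 1\<close> is at most one increment of
  that level away from the point \<open>i div 2\<close> of level \<open>n\<close>, so one increment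
  per level suffices.\<close>

lemma dyadic_chaining:
  fixes f :: "real \<Rightarrow> 'a::real_normed_vector"
  assumes b: "\<And>n i. i < 2 ^ n \<Longrightarrow> norm (f (real (Suc i) / 2 ^ n) - f (real i / 2 ^ n)) \<le> b n"
  shows "i \<le> 2 ^ n \<Longrightarrow> norm (f (real i / 2 ^ n) - f 0) \<le> (\<Sum>m\<le>n. b m)"
proof (induction n arbitrary: i)
  case 0
  have "0 \<le> b 0" using b[of 0 0] by (auto intro: order_trans[OF norm_ge_zero])
  moreover have "i = 0 \<or> i = 1" using 0 by auto
  ultimately show ?case using b[of 0 0] by auto
next
  case (Suc n)
  have b0: "0 \<le> b (Suc n)" using b[of 0 "Suc n"] by (auto intro: order_trans[OF norm_ge_zero])
  define j where "j = i div 2"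
  have j: "j \<le> 2 ^ n" using Suc.prems by (simp add: j_def)
  have e: "real (2 * j) / 2 ^ Suc n = real j / 2 ^ n" by simp
  show ?case
  proof (cases "even i")
    case True
    then have "i = 2 * j" by (simp add: j_def)
    then show ?thesis using Suc.IH[OF j] b0 e by simp
  next
    case False
    then have i: "i = Suc (2 * j)" by (simp add: j_def)
    then have "2 * j < 2 ^ Suc n" using Suc.prems by simp
    from b[OF this] have "norm (f (real i / 2 ^ Suc n) - f (real j / 2 ^ n)) \<le> b (Suc n)"
      unfolding i e .
    moreover have "norm (f (real i / 2 ^ Suc n) - f 0) \<le> norm (f (real i / 2 ^ Suc n) - f (real j / 2 ^ n)) + norm (f (real j / 2 ^ n) - f 0)"
      using norm_triangle_ineq[of "f (real i / 2 ^ Suc n) - f (real j / 2 ^ n)" "f (real j / 2 ^ n) - f 0"] by simp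
    ultimately show ?thesis using Suc.IH[OF j] by simp
  qed
qed

lemma exp_minus_le: "0 < y \<Longrightarrow> exp (- y) \<le> 2 / y\<^sup>2" for y :: real
proof -
  assume y: "0 < y"
  have "y\<^sup>2 / 2 \<le> exp y" using exp_lower_Taylor_quadratic[of y] y by simp
  then show ?thesis using y by (simp add: exp_minus field_simps)
qed

lemma norm_le_card:
  fixes x :: "real ^ 'd"
  assumes "\<And>i. \<bar>x $ i\<bar> \<le> c"
  shows "norm x \<le> real CARD('d) * c"
proof -
  have "norm x \<le> (\<Sum>i\<in>UNIV. \<bar>x $ i\<bar>)" by (rule norm_le_l1_cart)
  also have "\<dots> \<le> (\<Sum>i\<in>(UNIV :: 'd set). c)" by (intro sum_mono assms)
  finally show ?thesis by simp
qed

text \<open>The condition \<open>G\<close> concerns the increment up to \<open>s\<close> and is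
  independent of the later motion, so that motion only has to violate the bound with probability at
  most 1/2. By Brownian scaling \<open>h\<close> is of order \<open>b^2\<close>; the numerical
  factor lets the union bound over all dyadic scales close.\<close>

lemma (in brownian_motion) stays_close:
  assumes s: "0 < s" and b: "0 < b" and h: "h = b\<^sup>2 / (10 ^ 4 * 2 ^ CARD('d))"
    and G: "G \<in> sets borel"
  shows "prob {\<omega> \<in> space M. W s \<omega> - W 0 \<omega> \<in> G} / 2 \<le>
    prob {\<omega> \<in> space M. W s \<omega> - W 0 \<omega> \<in> G \<and> (\<forall>n. \<forall>i\<le>2 ^ n. norm (W (s + real i / 2 ^ n * h) \<omega> - W s \<omega>) \<le> b)}"
proof -
  have h0: "0 < h" using b h by simp
  \<comment> \<open>The scale \<open>n\<close> increments may not exceed \<open>b' n\<close>; the ratio lies between \<open>2 powr (- 1 / 4)\<close> and \<open>1\<close>,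
    so that a fourth-moment type bound is summable over the \<open>2 ^ n\<close> intervals.\<close>
  define b' where "b' n = b / 10 * (9 / 10) ^ n" for n :: nat
  have b'0: "0 < b' n" for n using b by (simp add: b'_def)
  have b'_sum: "(\<Sum>m\<le>n. b' m) \<le> b" for n
  proof -
    have "(\<Sum>m\<le>n. b' m) = b / 10 * ((1 - (9 / 10) ^ Suc n) / (1 - 9 / 10))"
      unfolding b'_def sum_distrib_left[symmetric] lessThan_Suc_atMost[symmetric] by (subst sum_gp_strict) simp
    also have "\<dots> \<le> b" using b by (simp add: field_simps)
    finally show ?thesis .
  qed
  define q where "q n i = s + real i / 2 ^ n * h" for n i :: nat
  have q: "s \<le> q n i" "q n i < q n (Suc i)" "q n (Suc i) - q n i = h / 2 ^ n" for n i
    using h0 by (auto simp: q_def field_simps)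
  have [measurable]: "random_variable borel (W 0)" "random_variable borel (W s)" "random_variable borel (W (q n i))" for n i
    using s q(1)[of n i] by (auto intro!: measurable_at)
  note G [measurable]
  define A where "A = {\<omega> \<in> space M. W s \<omega> - W 0 \<omega> \<in> G}"
  define B where "B n i = {\<omega> \<in> space M. b' n < norm (W (q n (Suc i)) \<omega> - W (q n i) \<omega>)}" for n i
  have [measurable]: "A \<in> events" "B n i \<in> events" for n i unfolding A_def B_def by measurable
  have ind: "prob (A \<inter> B n i) = prob A * prob (B n i)" for n i
  proof -
    define N where "N = {y :: real ^ 'd. b' n < norm y}"
    have N: "N \<in> sets borel" unfolding N_def by measurable
    \<comment> \<open>\<open>increments_indep\<close> wants strictly increasing consecutive times.
      For \<open>i = 0\<close> the interval begins at \<open>s\<close> and two increments suffice;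
      otherwise the gap from \<open>s\<close> to \<open>q n i\<close> is a third one in
      between.\<close>
    define k where "k = (if i = 0 then 1 else 2 :: nat)"
    define t where "t j = (if j = 0 then 0 else if j = 1 then s else if j = k then q n i else q n (Suc i))" for j :: nat
    have t: "0 \<le> t 0" "j < Suc k \<Longrightarrow> t j < t (Suc j)" for j
    proof -
      show "0 \<le> t 0" by (simp add: t_def)
      have "s < q n i" if "0 < i" using that h0 by (simp add: q_def)
      moreover assume "j < Suc k"
      then have "j = 0 \<or> j = 1 \<or> j = 2 \<and> i \<noteq> 0" by (auto simp: k_def split: if_splits)
      ultimately show "t j < t (Suc j)" using s q(1)[of n i] q(2)[of n i] by (auto simp: t_def k_def)
    qed
    have iv: "indep_vars (\<lambda>_. borel) (\<lambda>j \<omega>. W (t (Suc j)) \<omega> - W (t j) \<omega>) {..<Suc k}"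
      by (rule increments_indep) (use t in auto)
    define Y where "Y j = (if j = 0 then G else N)" for j :: nat
    have k: "k \<noteq> 0" "t 0 = 0" "t (Suc 0) = s" "t (Suc k) = q n (Suc i)" "t k = q n i"
      by (auto simp: k_def t_def q_def)
    have "prob (\<Inter>j\<in>{0, k}. (\<lambda>\<omega>. W (t (Suc j)) \<omega> - W (t j) \<omega>) -` Y j \<inter> space M) =
      (\<Prod>j\<in>{0, k}. prob ((\<lambda>\<omega>. W (t (Suc j)) \<omega> - W (t j) \<omega>) -` Y j \<inter> space M))"
      using N G by (intro indep_varsD[OF iv]) (auto simp: Y_def)
    also have "\<dots> = prob A * prob (B n i)"
      using k(1) by (simp add: k Y_def A_def B_def N_def vimage_def Int_def conj_commute)
    also have "(\<Inter>j\<in>{0, k}. (\<lambda>\<omega>. W (t (Suc j)) \<omega> - W (t j) \<omega>) -` Y j \<inter> space M) = A \<inter> B n i"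
      using k(1) by (auto simp: k Y_def A_def B_def N_def)
    finally show ?thesis .
  qed
  \<comment> \<open>\<open>1 / 2 ^ n\<close> pays for the \<open>2 ^ n\<close> intervals of the
    scale, and the rest sums over \<open>n\<close> to 1/2. The ratio is admissible because
    \<open>1 / (2 * (9 / 10) ^ 4) < 4 / 5\<close>.\<close>
  have pB: "prob (B n i) \<le> 1 / 10 * (4 / 5) ^ n / 2 ^ n" for n i
  proof -
    have d: "distributed M lborel (\<lambda>\<omega>. W (q n (Suc i)) \<omega> - W (q n i) \<omega>) (gauss_density (h / 2 ^ n))"
      using increment_distr[of "q n i" "q n (Suc i)"] q[of n i] s by (simp add: gauss_density_def)
    have "prob (B n i) \<le> 2 ^ CARD('d) * exp (- (b' n)\<^sup>2 / (4 * (h / 2 ^ n)))"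
      unfolding B_def by (rule gauss_tail[OF d]) (use h0 b'0[of n] in auto)
    also have "\<dots> \<le> 2 ^ CARD('d) * (2 / ((b' n)\<^sup>2 / (4 * (h / 2 ^ n)))\<^sup>2)"
      using exp_minus_le[of "(b' n)\<^sup>2 / (4 * (h / 2 ^ n))"] h0 b'0[of n] by (intro mult_left_mono) auto
    also have "\<dots> = 2 ^ CARD('d) * (32 * h\<^sup>2 / ((2 ^ n)\<^sup>2 * (b' n) ^ 4))"
      using h0 b'0[of n] by (simp add: field_simps power2_eq_square power4_eq_xxxx)
    also have "(b' n) ^ 4 = b ^ 4 / 10 ^ 4 * (6561 / 10000) ^ n"
      by (simp add: b'_def power_mult_distrib power_divide flip: power_mult) (simp add: power_mult mult.commute[of n])
    also have "h\<^sup>2 = b ^ 4 / (10 ^ 8 * (2 ^ CARD('d))\<^sup>2)"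
      by (simp add: h power_divide power_mult_distrib flip: power_mult)
    also have "2 ^ CARD('d) * (32 * (b ^ 4 / (10 ^ 8 * (2 ^ CARD('d))\<^sup>2)) / ((2 ^ n)\<^sup>2 * (b ^ 4 / 10 ^ 4 * (6561 / 10000) ^ n)))
       = 32 / 10 ^ 4 / 2 ^ CARD('d) * (1 / (2 * (6561 / 10000))) ^ n / 2 ^ n"
    proof -
      define x :: real where "x = (6561 / 10000) ^ n"
      have x: "0 < x" "(1 / (2 * (6561 / 10000))) ^ n = 1 / (2 ^ n * x)"
        by (simp_all only: x_def power_divide power_mult_distrib power_one) simp
      show ?thesis unfolding x(2) x_def[symmetric] using b x(1) by (simp add: power2_eq_square field_simps)
    qed
    also have "\<dots> \<le> 1 / 10 * (4 / 5) ^ n / 2 ^ n"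
    proof (intro divide_right_mono mult_mono)
      show "32 / 10 ^ 4 / 2 ^ CARD('d) \<le> 1 / (10 :: real)"
      proof -
        have "1 \<le> (2 :: real) ^ CARD('d)" by simp
        then have "4 \<le> (2 :: real) ^ CARD('d) * 125" by linarith
        then show ?thesis by (simp add: field_simps)
      qed
      show "(1 / (2 * (6561 / 10000))) ^ n \<le> (4 / 5 :: real) ^ n"
        by (intro power_mono) auto
    qed auto
    finally show ?thesis .
  qed
  have pU: "prob (\<Union>i<2 ^ n. A \<inter> B n i) \<le> prob A * (1 / 10 * (4 / 5) ^ n)" for n
  proof -
    have "prob (\<Union>i<2 ^ n. A \<inter> B n i) \<le> (\<Sum>i<2 ^ n. prob (A \<inter> B n i))"
      by (intro finite_measure_subadditive_finite) auto
    also have "\<dots> \<le> (\<Sum>i<(2 :: nat) ^ n. prob A * (1 / 10 * (4 / 5) ^ n / 2 ^ n))"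
      unfolding ind by (intro sum_mono mult_left_mono pB) auto
    also have "\<dots> = prob A * (1 / 10 * (4 / 5) ^ n)" by simp
    finally show ?thesis .
  qed
  have sg: "(\<lambda>n. prob A * (1 / 10 * (4 / 5) ^ n)) sums (prob A * (1 / 10 * (1 / (1 - 4 / 5))))"
    by (intro sums_mult geometric_sums) auto
  have summ: "summable (\<lambda>n. prob (\<Union>i<2 ^ n. A \<inter> B n i))"
    by (rule summable_comparison_test_ev[OF always_eventually sums_summable[OF sg]]) (use pU in auto)
  have "prob (\<Union>n. \<Union>i<2 ^ n. A \<inter> B n i) \<le> (\<Sum>n. prob (\<Union>i<2 ^ n. A \<inter> B n i))"
    by (intro finite_measure_subadditive_countably summ) auto
  also have "\<dots> \<le> (\<Sum>n. prob A * (1 / 10 * (4 / 5) ^ n))"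
    by (intro suminf_le pU summ sums_summable[OF sg])
  also have "\<dots> = prob A / 2" using sums_unique[OF sg] by simp
  finally have U: "prob (\<Union>n. \<Union>i<2 ^ n. A \<inter> B n i) \<le> prob A / 2" .
  have "prob A - prob (\<Union>n. \<Union>i<2 ^ n. A \<inter> B n i) = prob (A - (\<Union>n. \<Union>i<2 ^ n. A \<inter> B n i))"
    by (intro finite_measure_Diff[symmetric]) auto
  also have "\<dots> \<le> prob {\<omega> \<in> space M. W s \<omega> - W 0 \<omega> \<in> G \<and> (\<forall>n. \<forall>i\<le>2 ^ n. norm (W (s + real i / 2 ^ n * h) \<omega> - W s \<omega>) \<le> b)}"
  proof (rule finite_measure_mono)
    have "{\<omega> \<in> space M. W s \<omega> - W 0 \<omega> \<in> G \<and> (\<forall>n. \<forall>i\<le>2 ^ n. norm (W (q n i) \<omega> - W s \<omega>) \<le> b)} \<in> events"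
      by measurable
    then show "{\<omega> \<in> space M. W s \<omega> - W 0 \<omega> \<in> G \<and> (\<forall>n. \<forall>i\<le>2 ^ n. norm (W (s + real i / 2 ^ n * h) \<omega> - W s \<omega>) \<le> b)} \<in> events"
      unfolding q_def .
    show "A - (\<Union>n. \<Union>i<2 ^ n. A \<inter> B n i) \<subseteq> {\<omega> \<in> space M. W s \<omega> - W 0 \<omega> \<in> G \<and> (\<forall>n. \<forall>i\<le>2 ^ n. norm (W (s + real i / 2 ^ n * h) \<omega> - W s \<omega>) \<le> b)}"
    proof safe
      fix \<omega> assume A: "\<omega> \<in> A" and nB: "\<omega> \<notin> (\<Union>n. \<Union>i<2 ^ n. A \<inter> B n i)"
      show "\<omega> \<in> space M" "W s \<omega> - W 0 \<omega> \<in> G" using A by (auto simp: A_def)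
      fix n i :: nat assume i: "i \<le> 2 ^ n"
      have "norm (W (s + real i / 2 ^ n * h) \<omega> - W (s + 0 * h) \<omega>) \<le> (\<Sum>m\<le>n. b' m)"
      proof (rule dyadic_chaining[OF _ i, of "\<lambda>x. W (s + x * h) \<omega>" b'])
        fix n i :: nat assume "i < 2 ^ n"
        then have "\<omega> \<notin> B n i" using A nB by auto
        then show "norm (W (s + real (Suc i) / 2 ^ n * h) \<omega> - W (s + real i / 2 ^ n * h) \<omega>) \<le> b' n"
          using A by (auto simp: B_def A_def q_def)
      qed
      then show "norm (W (s + real i / 2 ^ n * h) \<omega> - W s \<omega>) \<le> b" using b'_sum[of n] by simp
    qed
  qed
  finally show ?thesis using U by (simp add: A_def)
qed

context dyadic_bbm
begin

text \<open>Here \<open>z\<close> is the time and place of birth of \<open>u\<close>. By path continuity the condition at the dyadic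
  points of \<open>{t..t + h}\<close> extends to the whole interval.\<close>

definition stays :: "real \<Rightarrow> real \<Rightarrow> real \<Rightarrow> real ^ 'd \<Rightarrow> bool list \<Rightarrow> real \<times> (real ^ 'd) \<Rightarrow> 'w \<Rightarrow> bool" where
  "stays t h b x u z \<omega> \<longleftrightarrow> fst z \<le> t \<and> t + h < fst z + T u \<omega> \<and>
    (\<forall>n. \<forall>i\<in>{..2 ^ n}. norm (snd z + path_at u (t + real i / 2 ^ n * h - fst z) \<omega> - x) \<le> b)"

lemma adapted_stays: "adapted (stays t h b x)"
  unfolding adapted_def
proof
  fix u
  let ?N = "borel \<Otimes>\<^sub>M label_sigma (marks (descendants u)) :: ((real \<times> (real ^ 'd)) \<times> 'w) measure"
  have u: "Inl u \<in> marks (descendants u)" "Inr u \<in> marks (descendants u)"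
    by (auto simp: marks_def descendants_def intro: image_eqI[of _ _ u] range_eqI[of _ _ "[]"])
  have [measurable]: "(\<lambda>p. fst (fst p)) \<in> borel_measurable ?N" "(\<lambda>p. snd (fst p)) \<in> borel_measurable ?N"
    by (rule measurable_compose[OF measurable_fst], intro borel_measurable_continuous_onI continuous_intros)+
  have [measurable]: "(\<lambda>p. T u (snd p)) \<in> borel_measurable ?N"
    by (rule measurable_compose[OF measurable_snd measurable_T_label_sigma[OF u(1)]])
  have [measurable]: "(\<lambda>p. path_at u (t + real i / 2 ^ n * h - fst (fst p)) (snd p)) \<in> borel_measurable ?N" for n i
    by (rule measurable_path_at[OF _ _ u(2)]) measurable
  show "Measurable.pred ?N (\<lambda>p. stays t h b x u (fst p) (snd p))"
    unfolding stays_def by measurable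
qed

lemma stays_imp:
  assumes r: "regular \<omega>" and h: "0 < h"
    and st: "stays t h b x u (birth_time (\<lambda>u. T u \<omega>) u, birth_place (\<lambda>u. T u \<omega>) (\<lambda>u s. W u s \<omega>) u) \<omega>"
    and s: "t \<le> s" "s \<le> t + h"
  shows "u \<in> alive (\<lambda>u. T u \<omega>) s" "norm (position (\<lambda>u. T u \<omega>) (\<lambda>u s. W u s \<omega>) s u - x) \<le> b"
proof -
  let ?s = "birth_time (\<lambda>u. T u \<omega>) u" and ?y = "birth_place (\<lambda>u. T u \<omega>) (\<lambda>u s. W u s \<omega>) u"
  have st: "?s \<le> t" "t + h < ?s + T u \<omega>"
    "\<And>n i. i \<le> 2 ^ n \<Longrightarrow> norm (?y + path_at u (t + real i / 2 ^ n * h - ?s) \<omega> - x) \<le> b"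
    using st by (auto simp: stays_def)
  show "u \<in> alive (\<lambda>u. T u \<omega>) s" using st s by (auto simp: alive_def)
  have c: "continuous_on {0..} (\<lambda>s. W u s \<omega>)" using r by (auto simp: regular_def)
  define q where "q = (s - t) / h"
  have q: "0 \<le> q" "q \<le> 1" "s = t + q * h" using s h by (auto simp: q_def field_simps)
  \<comment> \<open>Rounding down keeps the index at most \<open>2 ^ n\<close>, the range for which
    \<open>stays\<close> controls the position.\<close>
  define i where "i n = nat \<lfloor>2 ^ n * q\<rfloor>" for n :: nat
  have ib: "q - (1 / 2) ^ n \<le> real (i n) / 2 ^ n \<and> real (i n) / 2 ^ n \<le> q" for n
  proof -
    have "real (i n) \<le> 2 ^ n * q" "2 ^ n * q - 1 \<le> real (i n)"
      using q(1) unfolding i_def by (simp_all add: of_nat_nat)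
    then have "(2 ^ n * q - 1) / 2 ^ n \<le> real (i n) / 2 ^ n" "real (i n) / 2 ^ n \<le> 2 ^ n * q / 2 ^ n"
      by (intro divide_right_mono; simp)+
    then show ?thesis by (simp add: diff_divide_distrib power_divide)
  qed
  have i2: "i n \<le> 2 ^ n" for n
  proof -
    have "real (i n) / 2 ^ n \<le> 1" using ib[of n] q(2) by linarith
    then have "real (i n) \<le> real (2 ^ n)" by (simp add: divide_le_eq)
    then show ?thesis by (simp only: of_nat_le_iff)
  qed
  have "(\<lambda>n. real (i n) / 2 ^ n) \<longlonglongrightarrow> q"
  proof (rule tendsto_sandwich[of "\<lambda>n. q - (1 / 2) ^ n" _ _ "\<lambda>_. q"])
    show "(\<lambda>n. q - (1 / 2) ^ n) \<longlonglongrightarrow> q" by real_asymp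
  qed (use ib in auto)
  then have "(\<lambda>n. t + real (i n) / 2 ^ n * h - ?s) \<longlonglongrightarrow> t + q * h - ?s"
    by (intro tendsto_intros)
  moreover have nn: "0 \<le> t + real (i n) / 2 ^ n * h - ?s" for n
  proof -
    have "0 \<le> real (i n) / 2 ^ n * h" using h by simp
    then show ?thesis using st(1) by linarith
  qed
  moreover have "0 \<le> t + q * h - ?s" using st(1) q(1) h mult_nonneg_nonneg[of q h] by linarith
  ultimately have l: "(\<lambda>n. W u (t + real (i n) / 2 ^ n * h - ?s) \<omega>) \<longlonglongrightarrow> W u (s - ?s) \<omega>"
    unfolding q(3)
    by (intro continuous_on_tendsto_compose[OF c]) auto
  have "norm (?y + W u (s - ?s) \<omega> - x) \<le> b"
  proof (rule Lim_norm_ubound[OF sequentially_bot tendsto_diff[OF tendsto_add[OF tendsto_const l] tendsto_const]], rule always_eventually, rule allI)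
    fix n
    show "norm (?y + W u (t + real (i n) / 2 ^ n * h - ?s) \<omega> - x) \<le> b"
      using st(3)[OF i2[of n]] by (simp only: path_at_eq[OF c nn])
  qed
  then show "norm (position (\<lambda>u. T u \<omega>) (\<lambda>u s. W u s \<omega>) s u - x) \<le> b"
    by (simp add: position_def)
qed

text \<open>Started from the true birth data of \<open>u\<close>, the argument updated by
  \<open>increment\<close> remains the true birth data of the current particle down to the bottom of
  the recursion.\<close>

lemma hit_imp:
  assumes "regular \<omega>"
  shows "hit F G S n u (birth_time (\<lambda>u. T u \<omega>) u, birth_place (\<lambda>u. T u \<omega>) (\<lambda>u s. W u s \<omega>) u) \<omega> \<Longrightarrow>
    \<exists>v. F v (birth_time (\<lambda>u. T u \<omega>) v, birth_place (\<lambda>u. T u \<omega>) (\<lambda>u s. W u s \<omega>) v) \<omega>"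
proof (induction n arbitrary: u)
  case (Suc n)
  then obtain w where "hit F G S n (w @ u) ((birth_time (\<lambda>u. T u \<omega>) u, birth_place (\<lambda>u. T u \<omega>) (\<lambda>u s. W u s \<omega>) u) + increment u w \<omega>) \<omega>"
    by auto
  then show ?case
    using Suc.IH[of "w @ u"] by (simp add: increment_def birth_time_append birth_place_append[OF assms])
qed auto

lemma lifetime_gt:
  assumes "0 \<le> a" "0 < \<beta>"
  shows "prob {\<omega> \<in> space M. a < T u \<omega>} = exp (- \<beta> * a)"
  using erlang_distributed_gt[of "T u" 0 \<beta> a] lifetime_distr[of u] assms by (simp add: erlang_CDF_0)

text \<open>The tolerance is shared: at time \<open>t\<close> the particle is within
  \<open>b / 2\<close> of \<open>x\<close>, and up to \<open>t + h\<close> it moves by at most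
  \<open>b / 2\<close>. Not branching concerns the lifetime and the rest the path, so the two
  probabilities multiply.\<close>

lemma stays_prob:
  assumes \<beta>: "0 < \<beta>" and b: "0 < b" and h: "h = (b / 2)\<^sup>2 / (10 ^ 4 * 2 ^ CARD('d))"
    and s: "0 < s1" "s1 \<le> t - \<sigma>" "t - \<sigma> \<le> s2" and D: "\<And>i. \<bar>(x - y) $ i\<bar> \<le> D"
  shows "exp (- \<beta> * (s2 + h)) * ((b / real CARD('d) / sqrt (2 * pi * s2)) ^ CARD('d) *
      exp (- (real CARD('d) * (D + b)\<^sup>2) / (2 * s1))) / 2
    \<le> prob {\<omega> \<in> space M. stays t h b x u (\<sigma>, y) \<omega>}"
proof -
  let ?d = "real CARD('d)"
  interpret W: brownian_motion M "W u" by (rule motion)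
  define s where "s = t - \<sigma>"
  \<comment> \<open>A box of half-width \<open>c\<close> lies in a ball of radius
    \<open>b / 2\<close>, by \<open>norm_le_card\<close>.\<close>
  define c where "c = b / (2 * ?d)"
  have d1: "1 \<le> ?d" by simp
  have h0: "0 < h" using b h by simp
  have d2: "1 \<le> ?d * 2" using d1 by linarith
  have c0: "0 < c" "c \<le> b" using b d2 by (auto simp: c_def field_simps)
  have D0: "0 \<le> D" using D by (meson abs_ge_zero order_trans)
  define Box where "Box = {w :: real ^ 'd. \<forall>i. \<bar>w $ i - (x - y) $ i\<bar> \<le> c}"
  have Box [measurable]: "Box \<in> sets borel" unfolding Box_def by measurable
  have dist: "distributed M lborel (\<lambda>\<omega>. W u s \<omega> - W u 0 \<omega>) (gauss_density s)"
    using W.increment_distr[of 0 s] s assms(4) by (simp add: gauss_density_def s_def)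
  have "(b / ?d / sqrt (2 * pi * s2)) ^ CARD('d) * exp (- (?d * (D + b)\<^sup>2) / (2 * s1))
    \<le> (2 * c / sqrt (2 * pi * s2)) ^ CARD('d) * exp (- (\<Sum>i\<in>UNIV. (\<bar>(x - y) $ i\<bar> + c)\<^sup>2) / (2 * s1))"
  proof (rule mult_mono)
    have "(\<Sum>i\<in>UNIV. (\<bar>(x - y) $ i\<bar> + c)\<^sup>2) \<le> (\<Sum>i\<in>(UNIV :: 'd set). (D + b)\<^sup>2)"
      using D c0 by (intro sum_mono power_mono add_mono) auto
    also have "\<dots> = ?d * (D + b)\<^sup>2" by simp
    finally have "(\<Sum>i\<in>UNIV. (\<bar>(x - y) $ i\<bar> + c)\<^sup>2) / (2 * s1) \<le> ?d * (D + b)\<^sup>2 / (2 * s1)"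
      using assms(4) by (intro divide_right_mono) auto
    then show "exp (- (?d * (D + b)\<^sup>2) / (2 * s1)) \<le> exp (- (\<Sum>i\<in>UNIV. (\<bar>(x - y) $ i\<bar> + c)\<^sup>2) / (2 * s1))"
      by simp
  qed (use b s assms(4) in \<open>auto simp: c_def\<close>)
  also have "\<dots> \<le> prob {\<omega> \<in> space M. \<forall>i. \<bar>(W u s \<omega> - W u 0 \<omega>) $ i - (x - y) $ i\<bar> \<le> c}"
    by (rule gauss_box[OF dist]) (use assms c0 in \<open>auto simp: s_def\<close>)
  also have "\<dots> = prob {\<omega> \<in> space M. W u s \<omega> - W u 0 \<omega> \<in> Box}"
    by (simp add: Box_def)
  finally have p1: "(b / ?d / sqrt (2 * pi * s2)) ^ CARD('d) * exp (- (?d * (D + b)\<^sup>2) / (2 * s1)) / 2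
    \<le> prob {\<omega> \<in> space M. W u s \<omega> - W u 0 \<omega> \<in> Box} / 2" by simp
  also have "\<dots> \<le> prob {\<omega> \<in> space M. W u s \<omega> - W u 0 \<omega> \<in> Box \<and> (\<forall>n. \<forall>i\<le>2 ^ n. norm (W u (s + real i / 2 ^ n * h) \<omega> - W u s \<omega>) \<le> b / 2)}"
    by (rule W.stays_close) (use assms b in \<open>auto simp: s_def\<close>)
  also have "\<dots> \<le> prob {\<omega> \<in> space M. \<forall>n. \<forall>i\<in>{..2 ^ n}. norm (y + path_at u (t + real i / 2 ^ n * h - \<sigma>) \<omega> - x) \<le> b}"
  proof (rule finite_measure_mono_AE)
    have [measurable]: "path_at u q \<in> borel_measurable M" for q
      using measurable_label_sigma_M[OF measurable_path_at_const[of u UNIV]] by simp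
    show "{\<omega> \<in> space M. \<forall>n. \<forall>i\<in>{..2 ^ n}. norm (y + path_at u (t + real i / 2 ^ n * h - \<sigma>) \<omega> - x) \<le> b} \<in> events"
      by measurable
    show "AE \<omega> in M. \<omega> \<in> {\<omega> \<in> space M. W u s \<omega> - W u 0 \<omega> \<in> Box \<and> (\<forall>n. \<forall>i\<le>2 ^ n. norm (W u (s + real i / 2 ^ n * h) \<omega> - W u s \<omega>) \<le> b / 2)} \<longrightarrow>
       \<omega> \<in> {\<omega> \<in> space M. \<forall>n. \<forall>i\<in>{..2 ^ n}. norm (y + path_at u (t + real i / 2 ^ n * h - \<sigma>) \<omega> - x) \<le> b}"
      using AE_regular[OF \<beta>]
    proof (eventually_elim, intro impI CollectI conjI allI ballI)
      fix \<omega>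
      assume "\<omega> \<in> {\<omega> \<in> space M. W u s \<omega> - W u 0 \<omega> \<in> Box \<and> (\<forall>n. \<forall>i\<le>2 ^ n. norm (W u (s + real i / 2 ^ n * h) \<omega> - W u s \<omega>) \<le> b / 2)}"
      then show "\<omega> \<in> space M" by simp
    next
      fix \<omega> n and i :: nat
      assume r: "regular \<omega>" and A: "\<omega> \<in> {\<omega> \<in> space M. W u s \<omega> - W u 0 \<omega> \<in> Box \<and> (\<forall>n. \<forall>i\<le>2 ^ n. norm (W u (s + real i / 2 ^ n * h) \<omega> - W u s \<omega>) \<le> b / 2)}"
        and i: "i \<in> {..2 ^ n}"
      from A have B: "W u s \<omega> - W u 0 \<omega> \<in> Box"
        and cl: "\<forall>n. \<forall>i\<le>2 ^ n. norm (W u (s + real i / 2 ^ n * h) \<omega> - W u s \<omega>) \<le> b / 2" by auto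
      have c: "continuous_on {0..} (\<lambda>s. W u s \<omega>)" "W u 0 \<omega> = 0" using r by (auto simp: regular_def)
      have "norm (W u s \<omega> - (x - y)) \<le> ?d * c"
        by (rule norm_le_card) (use B c in \<open>auto simp: Box_def\<close>)
      also have "?d * c = b / 2" by (simp add: c_def)
      finally have 1: "norm (W u s \<omega> - (x - y)) \<le> b / 2" .
      have 2: "norm (W u (s + real i / 2 ^ n * h) \<omega> - W u s \<omega>) \<le> b / 2" using cl i by auto
      have "path_at u (t + real i / 2 ^ n * h - \<sigma>) \<omega> = W u (s + real i / 2 ^ n * h) \<omega>"
      proof -
        have "0 \<le> s + real i / 2 ^ n * h" using assms(4,5) h0 by (simp add: s_def)
        have e: "t + real i / 2 ^ n * h - \<sigma> = s + real i / 2 ^ n * h" by (simp add: s_def)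
        show ?thesis unfolding e by (rule path_at_eq[OF c(1)]) fact
      qed
      then have e: "y + path_at u (t + real i / 2 ^ n * h - \<sigma>) \<omega> - x = (W u (s + real i / 2 ^ n * h) \<omega> - W u s \<omega>) + (W u s \<omega> - (x - y))"
        by simp
      show "norm (y + path_at u (t + real i / 2 ^ n * h - \<sigma>) \<omega> - x) \<le> b"
        unfolding e using norm_triangle_mono[OF 2 1] by (simp only: field_sum_of_halves)
    qed
  qed
  finally have p2: "(b / ?d / sqrt (2 * pi * s2)) ^ CARD('d) * exp (- (?d * (D + b)\<^sup>2) / (2 * s1)) / 2
    \<le> prob {\<omega> \<in> space M. \<forall>n. \<forall>i\<in>{..2 ^ n}. norm (y + path_at u (t + real i / 2 ^ n * h - \<sigma>) \<omega> - x) \<le> b}" (is "_ \<le> prob ?B") .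
  have A: "{\<omega> \<in> space M. s + h < T u \<omega>} \<in> sets (label_sigma {Inl u})" (is "?A \<in> _")
  proof -
    have [measurable]: "T u \<in> borel_measurable (label_sigma {Inl u})" by (rule measurable_T_label_sigma) simp
    have "{\<omega> \<in> space (label_sigma {Inl u}). s + h < T u \<omega>} \<in> sets (label_sigma {Inl u})" by measurable
    then show ?thesis by simp
  qed
  have B: "?B \<in> sets (label_sigma {Inr u})"
  proof -
    have [measurable]: "path_at u q \<in> borel_measurable (label_sigma {Inr u})" for q by (rule measurable_path_at_const) simp
    have "{\<omega> \<in> space (label_sigma {Inr u}). \<forall>n. \<forall>i\<in>{..2 ^ n}. norm (y + path_at u (t + real i / 2 ^ n * h - \<sigma>) \<omega> - x) \<le> b} \<in> sets (label_sigma {Inr u})"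
      by measurable
    then show ?thesis by simp
  qed
  have "exp (- \<beta> * (s2 + h)) \<le> exp (- \<beta> * (s + h))"
    using assms(6) \<beta> by (simp add: s_def)
  also have "\<dots> = prob ?A" using lifetime_gt[of "s + h" u] assms(4,5) h0 \<beta> by (simp add: s_def)
  finally have pA: "exp (- \<beta> * (s2 + h)) \<le> prob ?A" .
  have "exp (- \<beta> * (s2 + h)) * ((b / ?d / sqrt (2 * pi * s2)) ^ CARD('d) * exp (- (?d * (D + b)\<^sup>2) / (2 * s1)) / 2) \<le> prob ?A * prob ?B"
    by (rule mult_mono[OF pA p2]) (use b assms(4,5,6) in auto)
  also have "\<dots> = prob (?A \<inter> ?B)"
    by (rule indep_setD[OF indep_label_sigma A B, symmetric]) simp
  also have "?A \<inter> ?B = {\<omega> \<in> space M. stays t h b x u (\<sigma>, y) \<omega>}"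
    using assms(4,5) by (auto simp: stays_def s_def)
  finally show ?thesis by simp
qed

end

section \<open>Failure probabilities\<close>

text \<open>One half of Stirling's formula: successive right-hand sides have the quotient
  \<open>(1 + 1 / n) ^ Suc n\<close>, which is at least \<open>exp 1\<close>.\<close>

lemma exp_le_fact: "0 < n \<Longrightarrow> exp (real n) \<le> exp 1 * real n * real n ^ n / fact n"
proof (induction n)
  case (Suc n)
  show ?case
  proof (cases "n = 0")
    case False
    then have n: "0 < real n" by simp
    have "ln (real n / (real n + 1)) \<le> real n / (real n + 1) - 1" using n by (intro ln_le_minus_one) auto
    moreover have "1 + 1 / real n = inverse (real n / (real n + 1))" using n by (simp add: field_simps)
    then have "ln (1 + 1 / real n) = - ln (real n / (real n + 1))" using n by (simp add: ln_div)
    moreover have "real n / (real n + 1) - 1 = - (1 / (real n + 1))" using n by (simp add: field_simps)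
    ultimately have "1 / (real n + 1) \<le> ln (1 + 1 / real n)" by linarith
    then have "1 \<le> (real n + 1) * ln (1 + 1 / real n)" using n by (simp add: field_simps)
    also have "\<dots> = ln ((1 + 1 / real n) ^ Suc n)" using n by (subst ln_realpow) (auto simp: algebra_simps add_pos_pos)
    finally have "1 \<le> ln ((1 + 1 / real n) ^ Suc n)" .
    moreover have "0 < (1 + 1 / real n) ^ Suc n" using n by (intro zero_less_power add_pos_pos) auto
    ultimately have e: "exp 1 \<le> (1 + 1 / real n) ^ Suc n" by (simp only: ln_ge_iff)
    have "exp (real (Suc n)) = exp (real n) * exp 1" by (simp add: exp_add)
    also have "\<dots> \<le> (exp 1 * real n * real n ^ n / fact n) * (1 + 1 / real n) ^ Suc n"
      using Suc False e by (intro mult_mono) auto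
    also have "1 + 1 / real n = real (Suc n) / real n" using n by (simp add: field_simps)
    also have "(exp 1 * real n * real n ^ n / fact n) * (real (Suc n) / real n) ^ Suc n = exp 1 * (real (Suc n) ^ Suc n) / fact n"
      using n by (simp add: power_divide)
    also have "\<dots> = exp 1 * real (Suc n) * real (Suc n) ^ Suc n / fact (Suc n)"
      by (simp add: fact_Suc del: of_nat_Suc power_Suc)
    finally show ?thesis .
  qed simp
qed simp

context dyadic_bbm
begin

lemma measurable_fst_borel [measurable]: "fst \<in> borel_measurable (borel :: (real \<times> (real ^ 'd)) measure)"
  by (intro borel_measurable_continuous_onI continuous_intros)

lemma measurable_snd_borel [measurable]: "snd \<in> borel_measurable (borel :: (real \<times> (real ^ 'd)) measure)"
  by (intro borel_measurable_continuous_onI continuous_intros)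

definition step_set :: "real \<Rightarrow> real ^ 'd \<Rightarrow> (real \<times> (real ^ 'd)) set" where
  "step_set a v = {z. (a \<le> fst z \<and> fst z \<le> a + 1) \<and> (\<forall>i. \<bar>snd z $ i - a * v $ i\<bar> \<le> 1)}"

definition start_set :: "real \<Rightarrow> real \<Rightarrow> (real \<times> (real ^ 'd)) set" where
  "start_set B R = {z. 0 \<le> fst z \<and> fst z \<le> B \<and> (\<forall>i. \<bar>snd z $ i\<bar> \<le> R)}"

lemma sets_step_set [measurable]: "step_set a v \<in> sets borel"
  unfolding step_set_def by measurable

lemma sets_start_set [measurable]: "start_set B R \<in> sets borel"
  unfolding start_set_def by measurable

text \<open>A lower bound, from the Erlang and Gaussian densities, for the mean number of descendants after
  \<open>G = 2 \<beta> a\<close> generations whose increment lies in \<open>step_set a v\<close>. This choice of \<open>G\<close> nearly maximises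
  \<open>2 ^ G\<close> times the Erlang density at \<open>a\<close>.\<close>

definition growth :: "real \<Rightarrow> real \<Rightarrow> real" where
  "growth \<theta> a = 1 / (exp 1 * a) * exp (\<beta> * a - \<beta>) * ((2 / sqrt (2 * pi * (a + 1))) ^ CARD('d) *
    exp (- (\<beta> * \<theta>\<^sup>2 * a + real CARD('d) * sqrt (2 * \<beta>) + real CARD('d) / (2 * a))))"

text \<open>For \<open>G = 2 \<beta> a\<close>, Stirling turns the Erlang density near
  \<open>a\<close> into \<open>exp (\<beta> a) / 2 ^ G\<close> up to a factor of order
  \<open>1 / a\<close>. The displacement \<open>a v\<close> costs
  \<open>exp (- a (norm v)^2 / 2)\<close>, whence \<open>\<beta> \<theta>^2 a\<close>; the unit
  tolerance per coordinate adds only a bounded cross term and \<open>d / (2 a)\<close>.\<close>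

lemma step_prob:
  assumes \<beta>: "0 < \<beta>" and G: "0 < G" and a: "a = real G / (2 * \<beta>)"
    and v: "norm v \<le> \<theta> * sqrt (2 * \<beta>)" and \<theta>: "0 \<le> \<theta>" "\<theta> \<le> 1" and w: "w \<in> words G"
  shows "growth \<theta> a / 2 ^ G \<le> prob {\<omega> \<in> space M. increment u w \<omega> \<in> step_set a v}"
proof -
  let ?d = "real CARD('d)"
  have w: "length w = G" "w \<noteq> []" using w G by (auto simp: words_def)
  have a0: "0 < a" using G \<beta> a by simp
  have Ga: "real G = 2 * \<beta> * a" using a \<beta> by simp
  have Gf: "real G * fact (G - 1) = fact G" using G by (simp add: fact_reduce)
  have Gp: "real G * real G ^ (G - 1) = real G ^ G" using G by (simp add: power_eq_if)
  have 1: "1 / (exp 1 * a) * exp (\<beta> * a - \<beta>) / 2 ^ G \<le> \<beta> ^ G * a ^ (G - 1) * exp (- \<beta> * (a + 1)) / fact (G - 1)"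
  proof -
    have "exp (2 * \<beta> * a) \<le> exp 1 * real G * real G ^ G / fact G"
      using exp_le_fact[OF G] by (simp add: Ga)
    also have "\<dots> = exp 1 * (real G * real G ^ (G - 1) / fact (G - 1))"
      unfolding Gf[symmetric] Gp[symmetric] using G by (simp add: field_simps)
    also have "real G * real G ^ (G - 1) = (2 * \<beta>) ^ G * a ^ G"
      using Gp by (simp add: Ga power_mult_distrib)
    also have "a ^ G = a * a ^ (G - 1)" using G by (simp add: power_eq_if)
    finally have "exp (2 * \<beta> * a) \<le> exp 1 * a * 2 ^ G * (\<beta> ^ G * a ^ (G - 1) / fact (G - 1))"
      by (simp add: power_mult_distrib mult_ac)
    then have "exp (2 * \<beta> * a) * exp (- \<beta> * (a + 1)) \<le> exp 1 * a * 2 ^ G * (\<beta> ^ G * a ^ (G - 1) / fact (G - 1)) * exp (- \<beta> * (a + 1))"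
      by (rule mult_right_mono) simp
    also have "exp (2 * \<beta> * a) * exp (- \<beta> * (a + 1)) = exp (\<beta> * a - \<beta>)"
      by (simp add: exp_add[symmetric] algebra_simps)
    finally show ?thesis using a0 by (simp add: field_simps)
  qed
  have 2: "exp (- (\<beta> * \<theta>\<^sup>2 * a + ?d * sqrt (2 * \<beta>) + ?d / (2 * a))) \<le> exp (- (\<Sum>i\<in>UNIV. (\<bar>(a *\<^sub>R v) $ i\<bar> + 1)\<^sup>2) / (2 * a))"
  proof -
    have nv: "norm v ^ 2 = (\<Sum>i\<in>UNIV. (v $ i)\<^sup>2)" by (simp add: norm_vec_def L2_set_def sum_nonneg)
    have vi: "\<bar>v $ i\<bar> \<le> sqrt (2 * \<beta>)" for i
    proof -
      have "\<bar>v $ i\<bar> \<le> norm v" by (rule component_le_norm_cart)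
      also have "\<dots> \<le> 1 * sqrt (2 * \<beta>)" using v \<theta> \<beta> by (rule_tac order_trans[OF v], intro mult_right_mono) auto
      finally show ?thesis by simp
    qed
    have "(\<Sum>i\<in>UNIV. (\<bar>(a *\<^sub>R v) $ i\<bar> + 1)\<^sup>2) = (\<Sum>i\<in>UNIV. a\<^sup>2 * (v $ i)\<^sup>2 + 2 * a * \<bar>v $ i\<bar> + 1)"
      using a0 by (intro sum.cong) (auto simp: power2_sum abs_mult power_mult_distrib)
    also have "\<dots> = a\<^sup>2 * (norm v)\<^sup>2 + 2 * a * (\<Sum>i\<in>UNIV. \<bar>v $ i\<bar>) + ?d"
      by (simp add: sum.distrib nv sum_distrib_left)
    also have "\<dots> \<le> a\<^sup>2 * (\<theta> * sqrt (2 * \<beta>))\<^sup>2 + 2 * a * (\<Sum>i\<in>(UNIV :: 'd set). sqrt (2 * \<beta>)) + ?d"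
      using v a0 vi by (intro add_mono mult_left_mono power_mono sum_mono) auto
    also have "\<dots> = 2 * a * (\<beta> * \<theta>\<^sup>2 * a + ?d * sqrt (2 * \<beta>) + ?d / (2 * a))"
      using a0 \<beta> by (simp add: field_simps power2_eq_square)
    finally have "(\<Sum>i\<in>UNIV. (\<bar>(a *\<^sub>R v) $ i\<bar> + 1)\<^sup>2) / (2 * a) \<le> \<beta> * \<theta>\<^sup>2 * a + ?d * sqrt (2 * \<beta>) + ?d / (2 * a)"
      using a0 by (simp only: divide_le_eq mult.commute[of _ "2 * a"]) simp
    then show ?thesis by simp
  qed
  have "growth \<theta> a / 2 ^ G = (1 / (exp 1 * a) * exp (\<beta> * a - \<beta>) / 2 ^ G) * ((2 * 1 / sqrt (2 * pi * (a + 1))) ^ CARD('d) *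
    exp (- (\<beta> * \<theta>\<^sup>2 * a + real CARD('d) * sqrt (2 * \<beta>) + real CARD('d) / (2 * a))))"
    by (simp add: growth_def)
  also have "\<dots> \<le> (\<beta> ^ G * a ^ (G - 1) * exp (- \<beta> * (a + 1)) / fact (G - 1)) * ((2 * 1 / sqrt (2 * pi * (a + 1))) ^ CARD('d) *
    exp (- (\<Sum>i\<in>UNIV. (\<bar>(a *\<^sub>R v) $ i\<bar> + 1)\<^sup>2) / (2 * a)))"
    using a0 \<beta> by (intro mult_mono[OF 1] mult_left_mono[OF 2]) auto
  also have "\<dots> \<le> prob {\<omega> \<in> space M. a \<le> elapsed u w \<omega> \<and> elapsed u w \<omega> \<le> a + 1} * ((2 * 1 / sqrt (2 * pi * (a + 1))) ^ CARD('d) *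
    exp (- (\<Sum>i\<in>UNIV. (\<bar>(a *\<^sub>R v) $ i\<bar> + 1)\<^sup>2) / (2 * a)))"
    using elapsed_ge[OF \<beta> w(2) a0, of u] a0 by (intro mult_right_mono) (auto simp: w(1))
  also have "\<dots> \<le> prob {\<omega> \<in> space M. (a \<le> elapsed u w \<omega> \<and> elapsed u w \<omega> \<le> a + 1) \<and> (\<forall>i. \<bar>displacement u w \<omega> \<omega> $ i - (a *\<^sub>R v) $ i\<bar> \<le> 1)}"
    by (rule elapsed_displacement_ge[OF \<beta> w(2) a0]) simp
  also have "\<dots> = prob {\<omega> \<in> space M. increment u w \<omega> \<in> step_set a v}"
    by (simp add: increment_def step_set_def)
  finally show ?thesis .
qed

text \<open>A union bound over the words; the inner \<open>2 ^ g\<close> stems from the Erlang tail.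
  The exponentials have to beat both factors, which is why \<open>g\<close> is later taken as a
  small multiple of \<open>B\<close>.\<close>

lemma start_failure:
  assumes \<beta>: "0 < \<beta>" and g: "0 < g" and B: "0 < B" "0 \<le> R"
  shows "prob {\<omega> \<in> space M. \<not> (\<forall>w\<in>words g. increment [] w \<omega> \<in> start_set B R)} \<le>
    2 ^ g * (2 ^ g * exp (- \<beta> * B / 2) + 2 ^ CARD('d) * exp (- R\<^sup>2 / (4 * B)))"
proof -
  define bad where "bad w = {\<omega> \<in> space M. increment [] w \<omega> \<notin> start_set B R}" for w
  have [measurable]: "bad w \<in> events" for w unfolding bad_def by measurable
  have "prob (bad w) \<le> 2 ^ g * exp (- \<beta> * B / 2) + 2 ^ CARD('d) * exp (- R\<^sup>2 / (4 * B))" if "w \<in> words g" for w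
  proof -
    have w: "length w = g" "w \<noteq> []" using that g by (auto simp: words_def)
    let ?X = "{\<omega> \<in> space M. B < elapsed [] w \<omega>}" and ?Y = "{\<omega> \<in> space M. elapsed [] w \<omega> \<le> B \<and> R < norm (displacement [] w \<omega> \<omega>)}"
    have "prob (bad w) \<le> prob (?X \<union> ?Y)"
    proof (rule finite_measure_mono_AE)
      show "AE \<omega> in M. \<omega> \<in> bad w \<longrightarrow> \<omega> \<in> ?X \<union> ?Y"
        using AE_regular[OF \<beta>]
      proof (eventually_elim, intro impI)
        fix \<omega> assume r: "regular \<omega>" and b: "\<omega> \<in> bad w"
        show "\<omega> \<in> ?X \<union> ?Y"
          using b elapsed_nonneg[OF r, of "[]" w]
          by (auto intro: less_le_trans[OF _ component_le_norm_cart] simp: bad_def start_set_def increment_def not_less not_le)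
      qed
    qed measurable
    also have "\<dots> \<le> prob ?X + prob ?Y" by (intro measure_Un_le) measurable
    also have "\<dots> \<le> 2 ^ g * exp (- \<beta> * B / 2) + 2 ^ CARD('d) * exp (- R\<^sup>2 / (4 * B))"
      using elapsed_tail[OF \<beta> w(2), of B "[]"] displacement_tail[OF \<beta> w(2) B, of "[]"] w by (intro add_mono) auto
    finally show ?thesis .
  qed
  then have "(\<Sum>w\<in>words g. prob (bad w)) \<le> (\<Sum>w\<in>words g. 2 ^ g * exp (- \<beta> * B / 2) + 2 ^ CARD('d) * exp (- R\<^sup>2 / (4 * B)))"
    by (intro sum_mono)
  moreover have "prob (\<Union>w\<in>words g. bad w) \<le> (\<Sum>w\<in>words g. prob (bad w))"
    by (intro finite_measure_subadditive_finite) auto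
  moreover have "{\<omega> \<in> space M. \<not> (\<forall>w\<in>words g. increment [] w \<omega> \<in> start_set B R)} = (\<Union>w\<in>words g. bad w)"
    by (auto simp: bad_def)
  ultimately show ?thesis by simp
qed

text \<open>Within each subtree \<open>hit_prob\<close> reaches its cap thanks to
  \<open>big\<close>. Another \<open>one_step\<close> across the first \<open>g\<close> generations
  then raises the failure probability of one subtree to the power \<open>2 ^ g\<close>.\<close>

lemma target_failure:
  assumes m: "2 \<le> m" "\<And>u w. w \<in> words G \<Longrightarrow> m / 2 ^ G \<le> prob {\<omega> \<in> space M. increment u w \<omega> \<in> step_set a v}"
    and p: "0 \<le> p" "\<And>u \<sigma> y. real N * a \<le> \<sigma> \<Longrightarrow> \<sigma> \<le> B + real N * (a + 1) \<Longrightarrow>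
        (\<And>i. \<bar>y $ i - real N * (a * v $ i)\<bar> \<le> R + real N) \<Longrightarrow>
        p \<le> prob {\<omega> \<in> space M. F u (\<sigma>, y) \<omega>}"
    and F: "adapted F" and big: "1 / 2 ^ G \<le> p * (m / 2) ^ N"
  shows "prob {\<omega> \<in> space M. (\<forall>w\<in>words g. increment [] w \<omega> \<in> start_set B R) \<and>
      (\<forall>w\<in>words g. \<not> hit F G (step_set a v) N w (increment [] w \<omega>) \<omega>)} \<le> (1 - 1 / 2 ^ G) ^ 2 ^ g"
proof -
  \<comment> \<open>With \<open>n\<close> blocks to go, \<open>N - n\<close> are done. Each of them
    moves the window by \<open>a\<close> in time and \<open>a v\<close> in space and widens it by
    one unit in time and in every coordinate.\<close>
  define K where "K n = {z :: real \<times> (real ^ 'd). (real N - real n) * a \<le> fst z \<and> fst z \<le> B + (real N - real n) * (a + 1) \<and>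
    (\<forall>i. \<bar>snd z $ i - (real N - real n) * (a * v $ i)\<bar> \<le> R + (real N - real n))}" for n
  have hp: "1 / 2 ^ G \<le> prob {\<omega> \<in> space M. hit F G (step_set a v) N u z \<omega>}" if z: "z \<in> start_set B R" for u z
  proof -
    have "min (p * (m / 2) ^ N) (1 / 2 ^ G) \<le> prob {\<omega> \<in> space M. hit F G (step_set a v) N u z \<omega>}"
    proof (rule hit_prob[where K = K and N = N, OF F sets_step_set m p(1)])
      show "p \<le> prob {\<omega> \<in> space M. F u z \<omega>}" if "z \<in> K 0" for u z
        using p(2)[of "fst z" "snd z" u] that by (simp add: K_def)
      show "z \<in> K N" using z by (simp add: K_def start_set_def)
      show "z + s \<in> K n" if "n < N" and z: "z \<in> K (Suc n)" and s: "s \<in> step_set a v" for n z s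
      proof -
        have "\<bar>snd (z + s) $ i - (real N - real n) * (a * v $ i)\<bar> \<le> R + (real N - real n)" for i
        proof -
          have "\<bar>snd z $ i - (real N - real (Suc n)) * (a * v $ i)\<bar> \<le> R + (real N - real (Suc n))" "\<bar>snd s $ i - a * v $ i\<bar> \<le> 1"
            using z s by (auto simp: K_def step_set_def)
          moreover have "snd (z + s) $ i - (real N - real n) * (a * v $ i) =
            (snd z $ i - (real N - real (Suc n)) * (a * v $ i)) + (snd s $ i - a * v $ i)"
            by (simp add: algebra_simps)
          ultimately show ?thesis by simp
        qed
        then show ?thesis using z s by (auto simp: K_def step_set_def algebra_simps)
      qed
    qed auto
    then show ?thesis using big by (simp add: min_def split: if_splits)
  qed
  let ?Q = "\<lambda>\<omega>. \<forall>w\<in>words g. increment [] w \<omega> \<in> start_set B R"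
  have Q: "Measurable.pred (label_sigma (marks (block [] g))) ?Q"
  proof (rule pred_intros_finite)
    fix w assume "w \<in> words g"
    then have [measurable]: "increment [] w \<in> borel_measurable (label_sigma (marks (block [] g)))"
      by (intro measurable_increment) (simp add: words_def)
    show "Measurable.pred (label_sigma (marks (block [] g))) (\<lambda>\<omega>. increment [] w \<omega> \<in> start_set B R)" by measurable
  qed simp
  have "emeasure M {\<omega> \<in> space M. (\<forall>w\<in>words g. increment [] w \<omega> \<in> start_set B R) \<and>
      (\<forall>w\<in>words g. \<not> hit F G (step_set a v) N w (increment [] w \<omega>) \<omega>)} =
    emeasure M {\<omega> \<in> space M. ?Q \<omega> \<and> (\<forall>w\<in>words g. increment [] w \<omega> \<in> start_set B R \<longrightarrow>
      \<not> hit F G (step_set a v) N (w @ []) (0 + increment [] w \<omega>) \<omega>)}"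
    by (intro arg_cong[where f = "emeasure M"]) auto
  also have "\<dots> \<le> (\<integral>\<^sup>+\<omega>. (if ?Q \<omega> then ennreal ((1 - 1 / 2 ^ G) ^ card {w \<in> words g. increment [] w \<omega> \<in> start_set B R}) else 0) \<partial>M)"
    using hp by (intro one_step adapted_hit F Q) auto
  also have "\<dots> \<le> (\<integral>\<^sup>+\<omega>. ennreal ((1 - 1 / 2 ^ G) ^ 2 ^ g) \<partial>M)"
  proof (rule nn_integral_mono)
    fix \<omega>
    have "{w \<in> words g. increment [] w \<omega> \<in> start_set B R} = words g" if "?Q \<omega>" using that by auto
    then show "(if ?Q \<omega> then ennreal ((1 - 1 / 2 ^ G) ^ card {w \<in> words g. increment [] w \<omega> \<in> start_set B R}) else 0) \<le> ennreal ((1 - 1 / 2 ^ G) ^ 2 ^ g)"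
      by auto
  qed
  also have "\<dots> = ennreal ((1 - 1 / 2 ^ G) ^ 2 ^ g)" by (simp add: emeasure_space_1)
  finally show ?thesis by (simp add: emeasure_eq_measure ennreal_le_iff)
qed

end

section \<open>Asymptotics: growth against losses\<close>

text \<open>Apart from its exponential rate, \<open>growth\<close> decays only polynomially in
  \<open>a\<close>, so the sacrificed \<open>\<delta> a\<close> eventually outweighs the
  logarithms.\<close>

lemma (in dyadic_bbm) growth_eventually:
  assumes \<beta>: "0 < \<beta>" and \<delta>: "0 < \<delta>"
  shows "\<forall>\<^sub>F a in at_top. exp (a * (\<beta> * (1 - \<theta>\<^sup>2) - \<delta>)) \<le> growth \<theta> a / 2"
proof -
  define d where "d = real CARD('d)"
  have "\<forall>\<^sub>F a in at_top. 0 \<le> \<delta> * a - 1 - ln a - \<beta> + d * (ln 2 - ln (2 * pi * (a + 1)) / 2) - d * sqrt (2 * \<beta>) - d / (2 * a) - ln 2"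
    using \<delta> by real_asymp
  then show ?thesis using eventually_gt_at_top[of 0]
  proof eventually_elim
    case (elim a)
    have "growth \<theta> a / 2 = exp (- 1 - ln a) * exp (\<beta> * a - \<beta>) * (exp (d * (ln 2 - ln (2 * pi * (a + 1)) / 2)) *
      exp (- (\<beta> * \<theta>\<^sup>2 * a + d * sqrt (2 * \<beta>) + d / (2 * a)))) * exp (- ln 2)"
    proof -
      have "1 / (exp 1 * a) = exp (- 1 - ln a)" using elim by (simp add: exp_diff exp_minus field_simps)
      moreover have "2 / sqrt (2 * pi * (a + 1)) = exp (ln 2 - ln (2 * pi * (a + 1)) / 2)"
        using elim by (simp add: exp_diff ln_sqrt[symmetric])
      then have "(2 / sqrt (2 * pi * (a + 1))) ^ CARD('d) = exp (d * (ln 2 - ln (2 * pi * (a + 1)) / 2))"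
        by (simp add: d_def exp_of_nat_mult)
      ultimately show ?thesis by (simp add: growth_def d_def[symmetric] exp_minus inverse_eq_divide)
    qed
    also have "\<dots> = exp (a * (\<beta> * (1 - \<theta>\<^sup>2) - \<delta>) + (\<delta> * a - 1 - ln a - \<beta> + d * (ln 2 - ln (2 * pi * (a + 1)) / 2) - d * sqrt (2 * \<beta>) - d / (2 * a) - ln 2))"
      unfolding exp_add[symmetric] by (simp add: algebra_simps)
    finally show ?case using elim by simp
  qed
qed

text \<open>The factors bound the number of grid times, the number of grid targets and the
  probability of missing one target. In logarithms, an exponential in \<open>j\<close> competes with
  linear terms.\<close>

lemma count_eventually:
  fixes \<beta> \<epsilon> c \<kappa>1 \<kappa>2 :: real
  assumes "0 < \<beta>" "0 < \<epsilon>" "0 < c" "0 < \<kappa>1" "0 < \<kappa>2"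
  shows "\<forall>\<^sub>F j in sequentially. (\<kappa>1 * exp (2 * \<beta> * (real j + 1)) + 1) * (\<kappa>2 * real j * exp (\<beta> * (real j + 1)) + 3) ^ D *
    exp (- c * exp (ln 2 * (\<beta> * \<epsilon> * real j / 8 - 1))) \<le> exp (- real j)"
proof -
  define d where "d = real D"
  have "\<forall>\<^sub>F j in sequentially. ln (\<kappa>1 * exp (2 * \<beta> * (real j + 1)) + 1) + d * ln (\<kappa>2 * real j * exp (\<beta> * (real j + 1)) + 3)
    - c * exp (ln 2 * (\<beta> * \<epsilon> * real j / 8 - 1)) \<le> - real j"
    using assms by real_asymp
  then show ?thesis
  proof eventually_elim
    case (elim j)
    have p: "0 < \<kappa>1 * exp (2 * \<beta> * (real j + 1)) + 1" "0 < \<kappa>2 * real j * exp (\<beta> * (real j + 1)) + 3"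
      using assms by (auto intro!: add_nonneg_pos)
    have "(\<kappa>1 * exp (2 * \<beta> * (real j + 1)) + 1) * (\<kappa>2 * real j * exp (\<beta> * (real j + 1)) + 3) ^ D *
    exp (- c * exp (ln 2 * (\<beta> * \<epsilon> * real j / 8 - 1))) = exp (ln (\<kappa>1 * exp (2 * \<beta> * (real j + 1)) + 1) + d * ln (\<kappa>2 * real j * exp (\<beta> * (real j + 1)) + 3)
    - c * exp (ln 2 * (\<beta> * \<epsilon> * real j / 8 - 1)))"
      using p by (simp add: d_def exp_add exp_diff exp_of_nat_mult exp_minus field_simps)
    then show ?case using elim by simp
  qed
qed

lemma exponent_eventually:
  fixes \<kappa> c d \<epsilon> c1 :: real
  assumes "0 < \<kappa>" "0 < \<epsilon>"
  shows "\<forall>\<^sub>F j in sequentially. 0 \<le> \<kappa> * real j + c - d / 2 * ln (8 * pi * \<epsilon> * real j) - c1 / real j"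
  using assms by real_asymp

text \<open>A block takes between \<open>a\<close> and \<open>a + 1\<close>, and \<open>N\<close>
  blocks must surely fit before \<open>(1 - 2 \<epsilon>) J\<close>. Rounding \<open>N\<close> down
  loses at most \<open>a\<close>; the slack of one unit per block loses at most
  \<open>\<epsilon> J\<close>, since \<open>1 \<le> \<epsilon> (a + 1)\<close>.\<close>

lemma steps_bounds:
  fixes a \<epsilon> J :: real
  assumes a: "0 < a" and \<epsilon>: "0 < \<epsilon>" "2 * \<epsilon> \<le> 1" "1 \<le> \<epsilon> * (a + 1)" and J: "0 < J"
    and N: "N = nat \<lfloor>(1 - 2 * \<epsilon>) * J / (a + 1)\<rfloor>"
  shows "real N * (a + 1) \<le> (1 - 2 * \<epsilon>) * J" "(1 - 3 * \<epsilon>) * J - a \<le> real N * a" "real N \<le> \<epsilon> * J"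
proof -
  define y where "y = (1 - 2 * \<epsilon>) * J / (a + 1)"
  have y0: "0 \<le> y" using assms by (simp add: y_def)
  have N1: "real N \<le> y" "y - 1 \<le> real N"
    using y0 unfolding N y_def[symmetric] by (simp_all add: of_nat_nat)
  have yJ: "y * (a + 1) = (1 - 2 * \<epsilon>) * J" using a by (simp add: y_def)
  have y2: "y \<le> \<epsilon> * J"
  proof -
    have "(1 - 2 * \<epsilon>) * J \<le> 1 * J" using \<epsilon> J by (intro mult_right_mono) auto
    also have "\<dots> \<le> (\<epsilon> * (a + 1)) * J" using \<epsilon> J by (intro mult_right_mono) auto
    finally show ?thesis unfolding y_def using a by (simp add: divide_le_eq mult_ac)
  qed
  show "real N * (a + 1) \<le> (1 - 2 * \<epsilon>) * J"
    using mult_right_mono[OF N1(1), of "a + 1"] a yJ by simp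
  show "real N \<le> \<epsilon> * J" using N1 y2 by simp
  have "(y - 1) * a \<le> real N * a" using N1 a by (intro mult_right_mono) auto
  moreover have "y * a = (1 - 2 * \<epsilon>) * J - y" using yJ by (simp add: algebra_simps)
  ultimately show "(1 - 3 * \<epsilon>) * J - a \<le> real N * a" using y2 by (simp add: algebra_simps)
qed

context dyadic_bbm
begin

text \<open>The bound of \<open>stays_prob\<close> for a particle born between times \<open>(1 - 4 \<epsilon>) J\<close> and \<open>(1 - \<epsilon>) J\<close>, at distance of
  order \<open>\<epsilon> J\<close> from the target: it bridges the gap without branching.\<close>

definition hit_lower :: "real \<Rightarrow> real \<Rightarrow> real \<Rightarrow> real \<Rightarrow> real" where
  "hit_lower \<epsilon> b h J = exp (- \<beta> * (4 * \<epsilon> * J + h)) * ((b / real CARD('d) / sqrt (2 * pi * (4 * \<epsilon> * J))) ^ CARD('d) *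
      exp (- (real CARD('d) * ((4 * sqrt (2 * \<beta>) + sqrt \<beta> + 1) * \<epsilon> * J + b)\<^sup>2) / (2 * (\<epsilon> * J)))) / 2"

text \<open>The velocity \<open>x /\<^sub>R J\<close> would lead to \<open>x\<close> at time
  \<open>J\<close>. Steering stops earlier, and the last particle makes up for the remaining
  distance and for all accumulated errors.\<close>

lemma target_failure_at:
  assumes \<beta>: "0 < \<beta>" and G: "0 < G" and a: "a = real G / (2 * \<beta>)" and \<theta>: "0 \<le> \<theta>" "\<theta> \<le> 1"
    and \<epsilon>: "0 < \<epsilon>" "2 * \<epsilon> \<le> 1" "1 \<le> \<epsilon> * (a + 1)" and J: "a + 1 \<le> \<epsilon> * J"
    and N: "N = nat \<lfloor>(1 - 2 * \<epsilon>) * J / (a + 1)\<rfloor>"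
    and gr: "2 \<le> growth \<theta> a" and x: "norm x \<le> \<theta> * sqrt (2 * \<beta>) * J" and t: "J \<le> t" "t \<le> J + 1"
    and b: "0 < b" and h: "h = (b / 2)\<^sup>2 / (10 ^ 4 * 2 ^ CARD('d))"
    and big: "1 / 2 ^ G \<le> hit_lower \<epsilon> b h J * (growth \<theta> a / 2) ^ N"
  shows "prob {\<omega> \<in> space M. (\<forall>w\<in>words g. increment [] w \<omega> \<in> start_set (\<epsilon> * J) (sqrt \<beta> * \<epsilon> * J)) \<and>
      (\<forall>w\<in>words g. \<not> hit (stays t h b x) G (step_set a (x /\<^sub>R J)) N w (increment [] w \<omega>) \<omega>)} \<le> (1 - 1 / 2 ^ G) ^ 2 ^ g"
proof (rule target_failure[OF gr _ _ _ adapted_stays big])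
  have a0: "0 < a" using a G \<beta> by simp
  have J0: "0 < J" using J a0 \<epsilon> by (metis add_pos_pos less_le_trans zero_less_mult_pos zero_less_one)
  note sb = steps_bounds[OF a0 \<epsilon> J0 N]
  have "norm (x /\<^sub>R J) \<le> \<theta> * sqrt (2 * \<beta>)" using x J0 by (simp add: field_simps)
  then show "growth \<theta> a / 2 ^ G \<le> prob {\<omega> \<in> space M. increment u w \<omega> \<in> step_set a (x /\<^sub>R J)}" if "w \<in> words G" for u w
    by (intro step_prob \<beta> G a \<theta> that)
  show "0 \<le> hit_lower \<epsilon> b h J" using \<epsilon> J0 b by (simp add: hit_lower_def)
  fix u \<sigma> y
  assume \<sigma>: "real N * a \<le> \<sigma>" "\<sigma> \<le> \<epsilon> * J + real N * (a + 1)"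
    and y: "\<And>i. \<bar>y $ i - real N * (a * (x /\<^sub>R J) $ i)\<bar> \<le> sqrt \<beta> * \<epsilon> * J + real N"
  show "hit_lower \<epsilon> b h J \<le> prob {\<omega> \<in> space M. stays t h b x u (\<sigma>, y) \<omega>}"
    unfolding hit_lower_def
  proof (rule stays_prob[OF \<beta> b h])
    show "0 < \<epsilon> * J" using \<epsilon> J0 by simp
    \<comment> \<open>The start uses at most \<open>\<epsilon> J\<close> and the blocks at most
      \<open>(1 - 2 \<epsilon>) J\<close>. Conversely at most \<open>3 \<epsilon> J + a + 1\<close>
      is left, and \<open>a + 1 \<le> \<epsilon> J\<close>.\<close>
    show "\<epsilon> * J \<le> t - \<sigma>" using sb(1) \<sigma> t by (simp add: algebra_simps)
    show "t - \<sigma> \<le> 4 * \<epsilon> * J" using sb(2) \<sigma> t J by (simp add: algebra_simps)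
    fix i
    have xi: "\<bar>x $ i\<bar> \<le> sqrt (2 * \<beta>) * J"
    proof -
      have "\<bar>x $ i\<bar> \<le> norm x" by (rule component_le_norm_cart)
      also have "\<dots> \<le> \<theta> * (sqrt (2 * \<beta>) * J)" using x by simp
      also have "\<dots> \<le> 1 * (sqrt (2 * \<beta>) * J)" using \<theta> J0 \<beta> by (intro mult_right_mono) auto
      finally show ?thesis by simp
    qed
    have NJ: "real N * a \<le> J" "J - real N * a \<le> 4 * \<epsilon> * J"
    proof -
      have "real N * a \<le> (1 - 2 * \<epsilon>) * J" using sb(1) by (simp add: algebra_simps)
      also have "\<dots> \<le> 1 * J" using \<epsilon> J0 by (intro mult_right_mono) auto
      finally show "real N * a \<le> J" by simp
      show "J - real N * a \<le> 4 * \<epsilon> * J" using sb(2) J by (simp add: algebra_simps)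
    qed
    have "\<bar>x $ i - real N * (a * (x /\<^sub>R J) $ i)\<bar> = \<bar>x $ i\<bar> * ((J - real N * a) / J)"
    proof -
      have "x $ i - real N * (a * (x /\<^sub>R J) $ i) = x $ i * ((J - real N * a) / J)"
        using J0 by (simp add: field_simps)
      then show ?thesis using NJ J0 by (simp add: abs_mult)
    qed
    also have "\<dots> \<le> (sqrt (2 * \<beta>) * J) * ((4 * \<epsilon> * J) / J)"
      using xi NJ J0 \<beta> by (intro mult_mono divide_right_mono) auto
    also have "\<dots> = 4 * sqrt (2 * \<beta>) * \<epsilon> * J" using J0 by simp
    finally have "\<bar>x $ i - real N * (a * (x /\<^sub>R J) $ i)\<bar> \<le> 4 * sqrt (2 * \<beta>) * \<epsilon> * J" .
    \<comment> \<open>Three contributions: the untravelled part of the line to \<open>x\<close>, the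
      displacement of the start, and one unit for each of at most \<open>\<epsilon> J\<close>
      blocks.\<close>
    then show "\<bar>(x - y) $ i\<bar> \<le> (4 * sqrt (2 * \<beta>) + sqrt \<beta> + 1) * \<epsilon> * J"
      using y[of i] sb(3) by (simp add: algebra_simps abs_le_iff)
  qed
qed

text \<open>A comparison of rates in \<open>j\<close>: the blocks gain
  \<open>\<gamma> (1 - 3 \<epsilon>)\<close>, the shrinking target costs \<open>\<beta> k d\<close>
  through the power \<open>CARD('d)\<close> of its radius, and the survival and the jump of the last
  particle cost a multiple of \<open>\<epsilon>\<close>.\<close>

lemma hit_lower_eventually:
  fixes k r\<^sub>0 \<epsilon> \<gamma> a m :: real and d :: real
  defines "b \<equiv> \<lambda>j. r\<^sub>0 * exp (- \<beta> * k * (real j + 1)) / 2"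
  defines "h \<equiv> \<lambda>j. (b j / 2)\<^sup>2 / (10 ^ 4 * 2 ^ CARD('d))"
  defines "d \<equiv> real CARD('d)"
  assumes \<beta>: "0 < \<beta>" and k: "0 \<le> k" and r0: "0 < r\<^sub>0" and a: "0 < a"
    and \<epsilon>: "0 < \<epsilon>" "2 * \<epsilon> \<le> 1" "1 \<le> \<epsilon> * (a + 1)" and \<gamma>: "0 < \<gamma>" and m: "exp (a * \<gamma>) \<le> m / 2"
    and \<kappa>: "0 < \<gamma> * (1 - 3 * \<epsilon>) - \<beta> * k * d - \<epsilon> * (4 * \<beta> + d * (4 * sqrt (2 * \<beta>) + sqrt \<beta> + 1)\<^sup>2 / 2)"
  shows "\<forall>\<^sub>F j in sequentially. 1 / 2 ^ G \<le> hit_lower \<epsilon> (b j) (h j) (real j) * (m / 2) ^ nat \<lfloor>(1 - 2 * \<epsilon>) * real j / (a + 1)\<rfloor>"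
proof -
  define D where "D = 4 * sqrt (2 * \<beta>) + sqrt \<beta> + 1"
  \<comment> \<open>The net rate. Beyond it remain the constants collected in \<open>c\<close>, the
    term \<open>c1 / J\<close> from expanding the square, and a logarithm.\<close>
  define \<kappa>' where "\<kappa>' = \<gamma> * (1 - 3 * \<epsilon>) - \<beta> * k * d - \<epsilon> * (4 * \<beta> + d * D\<^sup>2 / 2)"
  have "0 < \<kappa>'" using \<kappa> by (simp add: \<kappa>'_def D_def)
  define c where "c = - \<beta> * r\<^sub>0\<^sup>2 + d * ln (r\<^sub>0 / 2) - d * \<beta> * k - d * ln d - d * D * r\<^sub>0 - ln 2 - \<gamma> * a"
  define c1 where "c1 = d * r\<^sub>0\<^sup>2 / (2 * \<epsilon>)"
  have D0: "0 \<le> D" using \<beta> by (simp add: D_def)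
  have d1: "1 \<le> d" by (simp add: d_def)
  show ?thesis
    using exponent_eventually[OF \<open>0 < \<kappa>'\<close> \<epsilon>(1), of c d c1] eventually_gt_at_top[of 0]
  proof eventually_elim
    case (elim j)
    define J where "J = real j"
    define N where "N = nat \<lfloor>(1 - 2 * \<epsilon>) * J / (a + 1)\<rfloor>"
    have J: "0 < J" using elim by (simp add: J_def)
    note sb = steps_bounds[OF a \<epsilon> J N_def]
    have b0: "0 < b j" using r0 by (simp add: b_def)
    have br: "b j \<le> r\<^sub>0"
    proof -
      have "exp (- \<beta> * k * (real j + 1)) \<le> 1" using \<beta> k by (simp add: mult_nonneg_nonneg)
      then have "r\<^sub>0 * exp (- \<beta> * k * (real j + 1)) \<le> r\<^sub>0 * 1" using r0 by (intro mult_left_mono) auto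
      then show ?thesis unfolding b_def using r0 by linarith
    qed
    have hr: "h j \<le> r\<^sub>0\<^sup>2"
    proof -
      have "(b j / 2)\<^sup>2 \<le> r\<^sub>0\<^sup>2" using br b0 by (intro power_mono) auto
      moreover have "1 \<le> (10 ^ 4 * 2 ^ CARD('d) :: real)"
        using mult_mono[of 1 "10 ^ 4 :: real" 1 "2 ^ CARD('d)"] by simp
      ultimately have "(b j / 2)\<^sup>2 / (10 ^ 4 * 2 ^ CARD('d)) \<le> r\<^sub>0\<^sup>2 / 1" by (intro frac_le) auto
      then show ?thesis by (simp add: h_def)
    qed
    have "(b j / d / sqrt (2 * pi * (4 * \<epsilon> * J))) = exp (ln (r\<^sub>0 / 2) - \<beta> * k * (J + 1) - ln d - ln (8 * pi * \<epsilon> * J) / 2)"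
    proof -
      have "exp (ln (8 * pi * \<epsilon> * J) / 2) = sqrt (2 * pi * (4 * \<epsilon> * J))"
        using J \<epsilon> by (simp add: ln_sqrt[symmetric] mult_ac)
      then have "exp (ln (r\<^sub>0 / 2) + - \<beta> * k * (J + 1) - ln d - ln (8 * pi * \<epsilon> * J) / 2) = b j / d / sqrt (2 * pi * (4 * \<epsilon> * J))"
        using r0 d1 unfolding exp_diff exp_add by (simp add: b_def J_def)
      then show ?thesis by simp
    qed
    then have e1: "(b j / d / sqrt (2 * pi * (4 * \<epsilon> * J))) ^ CARD('d) = exp (d * (ln (r\<^sub>0 / 2) - \<beta> * k * (J + 1) - ln d - ln (8 * pi * \<epsilon> * J) / 2))"
      by (simp add: d_def exp_of_nat_mult)
    have e2: "- (d * (D * \<epsilon> * J + r\<^sub>0)\<^sup>2 / (2 * (\<epsilon> * J))) \<le> - (d * (D * \<epsilon> * J + b j)\<^sup>2) / (2 * (\<epsilon> * J))"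
    proof -
      have "d * (D * \<epsilon> * J + b j)\<^sup>2 / (2 * (\<epsilon> * J)) \<le> d * (D * \<epsilon> * J + r\<^sub>0)\<^sup>2 / (2 * (\<epsilon> * J))"
        using br b0 D0 d1 J \<epsilon> by (intro divide_right_mono mult_left_mono power_mono) auto
      then show ?thesis by simp
    qed
    have e3: "d * (D * \<epsilon> * J + r\<^sub>0)\<^sup>2 / (2 * (\<epsilon> * J)) = \<epsilon> * (d * D\<^sup>2 / 2) * J + d * D * r\<^sub>0 + c1 / J"
      using J \<epsilon> by (simp add: c1_def field_simps power2_eq_square)
    \<comment> \<open>The positive net rate lifts the product to at least 1, hence above the cap of
      the recursion.\<close>
    have "1 / 2 ^ G \<le> (1 :: real)" by simp
    also have "\<dots> \<le> exp (\<kappa>' * J + c - d / 2 * ln (8 * pi * \<epsilon> * J) - c1 / J)"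
      using elim by (simp add: J_def)
    also have "\<dots> = exp (- \<beta> * (4 * \<epsilon> * J + r\<^sub>0\<^sup>2)) * (exp (d * (ln (r\<^sub>0 / 2) - \<beta> * k * (J + 1) - ln d - ln (8 * pi * \<epsilon> * J) / 2)) *
      exp (- (d * (D * \<epsilon> * J + r\<^sub>0)\<^sup>2 / (2 * (\<epsilon> * J))))) * exp (- ln 2) * exp (\<gamma> * ((1 - 3 * \<epsilon>) * J - a))"
      unfolding exp_add[symmetric] e3 by (simp add: \<kappa>'_def c_def algebra_simps)
    also have "\<dots> \<le> exp (- \<beta> * (4 * \<epsilon> * J + h j)) * ((b j / d / sqrt (2 * pi * (4 * \<epsilon> * J))) ^ CARD('d) *
      exp (- (d * (D * \<epsilon> * J + b j)\<^sup>2) / (2 * (\<epsilon> * J)))) * exp (- ln 2) * exp (\<gamma> * (real N * a))"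
    proof (intro mult_mono)
      show "exp (- \<beta> * (4 * \<epsilon> * J + r\<^sub>0\<^sup>2)) \<le> exp (- \<beta> * (4 * \<epsilon> * J + h j))" using hr \<beta> by simp
      show "exp (\<gamma> * ((1 - 3 * \<epsilon>) * J - a)) \<le> exp (\<gamma> * (real N * a))" using sb(2) \<gamma> by simp
      show "exp (d * (ln (r\<^sub>0 / 2) - \<beta> * k * (J + 1) - ln d - ln (8 * pi * \<epsilon> * J) / 2)) \<le> (b j / d / sqrt (2 * pi * (4 * \<epsilon> * J))) ^ CARD('d)"
        by (rule eq_refl[OF e1[symmetric]])
      show "exp (- (d * (D * \<epsilon> * J + r\<^sub>0)\<^sup>2 / (2 * (\<epsilon> * J)))) \<le> exp (- (d * (D * \<epsilon> * J + b j)\<^sup>2) / (2 * (\<epsilon> * J)))"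
        using e2 by (simp only: exp_le_cancel_iff)
    qed (use b0 d1 J \<epsilon> in auto)
    also have "\<dots> = hit_lower \<epsilon> (b j) (h j) J * exp (\<gamma> * (real N * a))"
      by (simp add: hit_lower_def D_def[symmetric] d_def[symmetric] exp_minus inverse_eq_divide)
    also have "exp (\<gamma> * (real N * a)) = exp (a * \<gamma>) ^ N"
      by (simp add: exp_of_nat_mult[symmetric] mult_ac)
    also have "hit_lower \<epsilon> (b j) (h j) J * exp (a * \<gamma>) ^ N \<le> hit_lower \<epsilon> (b j) (h j) J * (m / 2) ^ N"
      using m b0 J \<epsilon> by (intro mult_left_mono power_mono) (auto simp: hit_lower_def)
    finally show ?case by (simp add: J_def N_def)
  qed
qed

end

section \<open>Covering the ball\<close>

definition grid :: "real \<Rightarrow> int \<Rightarrow> (real ^ 'd) set" where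
  "grid \<delta> m = (\<lambda>z. \<chi> i. \<delta> * of_int (z i)) ` (UNIV \<rightarrow>\<^sub>E {- m..m})"

lemma finite_grid [simp]: "finite (grid \<delta> m)"
  unfolding grid_def by (intro finite_imageI finite_PiE) auto

lemma card_grid:
  assumes "0 \<le> m"
  shows "real (card (grid \<delta> m :: (real ^ 'd) set)) \<le> (2 * of_int m + 1) ^ CARD('d)"
proof -
  have "card (grid \<delta> m :: (real ^ 'd) set) \<le> card ((UNIV :: 'd set) \<rightarrow>\<^sub>E {- m..m})"
    unfolding grid_def by (intro card_image_le finite_PiE) auto
  also have "\<dots> = nat (2 * m + 1) ^ CARD('d)" by (simp add: card_PiE algebra_simps)
  finally have "real (card (grid \<delta> m :: (real ^ 'd) set)) \<le> real (nat (2 * m + 1) ^ CARD('d))"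
    by (simp only: of_nat_le_iff)
  then show ?thesis using assms by simp
qed

text \<open>Coordinates are rounded down; the margin \<open>CARD('d) * \<delta>\<close> in the
  hypothesis keeps the indices within \<open>{- m..m}\<close>.\<close>

lemma grid_near:
  fixes p :: "real ^ 'd"
  assumes \<delta>: "0 < \<delta>" and p: "norm p + real CARD('d) * \<delta> \<le> \<delta> * of_int m"
  obtains x where "x \<in> grid \<delta> m" "norm (p - x) \<le> real CARD('d) * \<delta>"
proof -
  define z where "z i = \<lfloor>p $ i / \<delta>\<rfloor>" for i
  define x :: "real ^ 'd" where "x = (\<chi> i. \<delta> * of_int (z i))"
  have d: "\<bar>(p - x) $ i\<bar> \<le> \<delta>" for i
  proof -
    have "of_int (z i) \<le> p $ i / \<delta>" "p $ i / \<delta> \<le> of_int (z i) + 1" unfolding z_def by linarith+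
    then have "\<delta> * of_int (z i) \<le> p $ i" "p $ i \<le> \<delta> * of_int (z i) + \<delta>"
      using \<delta> by (simp_all add: field_simps)
    then show ?thesis by (simp add: x_def)
  qed
  have n: "norm (p - x) \<le> real CARD('d) * \<delta>" using d by (rule norm_le_card)
  have "z i \<in> {- m..m}" for i
  proof -
    have "\<bar>x $ i\<bar> \<le> norm x" by (rule component_le_norm_cart)
    also have "\<dots> \<le> norm p + norm (p - x)" using norm_triangle_ineq4[of p "p - x"] by simp
    also have "\<dots> \<le> \<delta> * of_int m" using n p by simp
    finally have "\<delta> * \<bar>of_int (z i)\<bar> \<le> \<delta> * of_int m" using \<delta> by (simp add: x_def abs_mult)
    then have "\<bar>of_int (z i) :: real\<bar> \<le> of_int m" using \<delta> by simp
    then have "\<bar>z i\<bar> \<le> m" by linarith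
    then show ?thesis by auto
  qed
  then have "x \<in> grid \<delta> m" by (auto simp: grid_def x_def)
  then show ?thesis using n that by blast
qed

section \<open>Union bound over targets and times, Borel-Cantelli\<close>

context dyadic_bbm
begin

text \<open>Outside \<open>bad j\<close> every grid target is reached at every grid time and held
  until the next one. A point of the ball is then served by the target next to it, at the cost of
  enlarging \<open>\<theta>\<close> slightly.\<close>

lemma covering:
  assumes \<beta>: "0 < \<beta>" and \<theta>: "0 < \<theta>" "\<theta> < 1" and k: "0 \<le> k" "k < (1 - \<theta>\<^sup>2) / real CARD('d)" and r0: "0 < r\<^sub>0"
  shows "AE \<omega> in M. \<forall>\<^sub>F j in sequentially. \<forall>t\<in>{real j..real j + 1}. \<forall>p. norm p < \<theta> * sqrt (2 * \<beta>) * t \<longrightarrow>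
    (\<exists>u\<in>alive (\<lambda>u. T u \<omega>) t. norm (position (\<lambda>u. T u \<omega>) (\<lambda>u s. W u s \<omega>) t u - p) < r\<^sub>0 * exp (- \<beta> * k * t))"
proof -
  define d where "d = real CARD('d)"
  have d1: "1 \<le> d" by (simp add: d_def)
  define s where "s = sqrt (2 * \<beta>)"
  have s0: "0 < s" using \<beta> by (simp add: s_def)
  have kd: "k * d < 1 - \<theta>\<^sup>2" using k d1 by (simp add: d_def field_simps)
  have k1: "k \<le> 1"
  proof -
    have "k * 1 \<le> k * d" using k d1 by (intro mult_left_mono) auto
    then show ?thesis using kd zero_le_power2[of \<theta>] by linarith
  qed
  \<comment> \<open>\<open>\<phi> > \<theta>\<close> makes room for rounding to the grid and for
    replacing \<open>t \<le> j + 1\<close> by \<open>j\<close>; the upper bound keeps the net rate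
    positive.\<close>
  have "\<theta> < sqrt (1 - k * d)" using kd \<theta> by (intro real_less_rsqrt) simp
  then obtain \<phi> where \<phi>: "\<theta> < \<phi>" "\<phi> < sqrt (1 - k * d)" using dense by blast
  have \<phi>2: "\<phi>\<^sup>2 < 1 - k * d"
  proof -
    have "\<phi>\<^sup>2 < (sqrt (1 - k * d))\<^sup>2" using \<phi> \<theta> by (intro power_strict_mono) auto
    also have "\<dots> = 1 - k * d" using kd zero_le_power2[of \<theta>] by (intro real_sqrt_pow2) linarith
    finally show ?thesis .
  qed
  have kd0: "0 \<le> k * d" using k d1 by simp
  have \<phi>01: "0 \<le> \<phi>" "\<phi> \<le> 1"
    using \<phi> \<theta> \<phi>2 kd0 by (auto intro!: power2_le_imp_le[of \<phi> 1])
  \<comment> \<open>\<open>\<eta>\<close> is the available slack. A quarter is given up in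
    \<open>growth_eventually\<close>, at most another quarter in the terms proportional to
    \<open>\<epsilon>\<close>, whose coefficients are added up in \<open>E\<close>. The summand
    \<open>\<eta>\<close> of \<open>E\<close> forces \<open>\<epsilon> \<le> 1 / 4\<close>.\<close>
  define \<eta> where "\<eta> = \<beta> * (1 - \<phi>\<^sup>2) - \<beta> * k * d"
  have \<eta>: "0 < \<eta>" using \<phi>2 \<beta> by (simp add: \<eta>_def right_diff_distrib[symmetric] mult.assoc)
  define \<gamma> where "\<gamma> = \<beta> * (1 - \<phi>\<^sup>2) - \<eta> / 4"
  have \<gamma>: "0 < \<gamma>" "\<gamma> = \<eta> * (3 / 4) + \<beta> * k * d"
  proof -
    show "\<gamma> = \<eta> * (3 / 4) + \<beta> * k * d" by (simp add: \<gamma>_def \<eta>_def field_simps)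
    then show "0 < \<gamma>" using \<eta> \<beta> kd0 by (simp add: mult.assoc add_pos_nonneg)
  qed
  define D where "D = 4 * s + sqrt \<beta> + 1"
  define E where "E = 4 * \<beta> + d * D\<^sup>2 / 2 + 3 * \<gamma> + \<eta>"
  have E: "\<eta> < E"
  proof -
    have "0 \<le> d * D\<^sup>2 / 2" using d1 by simp
    then show ?thesis unfolding E_def using \<beta> \<gamma>(1) by linarith
  qed
  define \<epsilon> where "\<epsilon> = \<eta> / (4 * E)"
  have \<epsilon>: "0 < \<epsilon>" "2 * \<epsilon> \<le> 1" "\<epsilon> * E = \<eta> / 4" using E \<eta> by (auto simp: \<epsilon>_def field_simps)
  have \<kappa>: "0 < \<gamma> * (1 - 3 * \<epsilon>) - \<beta> * k * d - \<epsilon> * (4 * \<beta> + d * D\<^sup>2 / 2)"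
  proof -
    have "\<gamma> * (1 - 3 * \<epsilon>) - \<beta> * k * d - \<epsilon> * (4 * \<beta> + d * D\<^sup>2 / 2) = (\<gamma> - \<beta> * k * d) - \<epsilon> * (E - \<eta>)"
      unfolding E_def by (simp add: algebra_simps)
    also have "\<dots> = \<eta> * (3 / 4) - \<epsilon> * (E - \<eta>)" using \<gamma>(2) by simp
    also have "\<dots> = \<eta> / 2 + \<epsilon> * \<eta>" using \<epsilon>(3) by (simp add: algebra_simps)
    finally show ?thesis using \<eta> \<epsilon> by (simp add: add_pos_pos)
  qed
  have "filterlim (\<lambda>G. real G / (2 * \<beta>)) at_top sequentially" using \<beta> by real_asymp
  moreover have "\<forall>\<^sub>F a in at_top. exp (a * (\<beta> * (1 - \<phi>\<^sup>2) - \<eta> / 4)) \<le> growth \<phi> a / 2 \<and> 1 \<le> \<epsilon> * (a + 1)"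
  proof (rule eventually_conj)
    show "\<forall>\<^sub>F a in at_top. exp (a * (\<beta> * (1 - \<phi>\<^sup>2) - \<eta> / 4)) \<le> growth \<phi> a / 2"
      using \<beta> \<eta> by (intro growth_eventually) auto
    show "\<forall>\<^sub>F a in at_top. 1 \<le> \<epsilon> * (a + 1)" using \<epsilon>(1) by real_asymp
  qed
  ultimately have "\<forall>\<^sub>F G in sequentially. exp (real G / (2 * \<beta>) * \<gamma>) \<le> growth \<phi> (real G / (2 * \<beta>)) / 2 \<and> 1 \<le> \<epsilon> * (real G / (2 * \<beta>) + 1)"
    unfolding \<gamma>_def filterlim_iff by blast
  \<comment> \<open>\<open>G\<close> is fixed here, before \<open>j\<close> grows, so the hitting
    probability \<open>q = 1 / 2 ^ G\<close> is a constant.\<close>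
  from eventually_conj[OF this eventually_gt_at_top[of 0]]
  obtain G where G: "exp (real G / (2 * \<beta>) * \<gamma>) \<le> growth \<phi> (real G / (2 * \<beta>)) / 2"
    "1 \<le> \<epsilon> * (real G / (2 * \<beta>) + 1)" "0 < G"
    by (metis (no_types, lifting) eventually_happens' sequentially_bot)
  define a where "a = real G / (2 * \<beta>)"
  define m where "m = growth \<phi> a"
  have a0: "0 < a" using G \<beta> by (simp add: a_def)
  have m: "exp (a * \<gamma>) \<le> m / 2" using G by (simp add: a_def m_def)
  have m2: "2 \<le> m"
  proof -
    have "1 \<le> exp (a * \<gamma>)" using a0 \<gamma> by simp
    then show ?thesis using m by linarith
  qed
  have \<epsilon>a: "1 \<le> \<epsilon> * (a + 1)" using G by (simp add: a_def)
  define q :: real where "q = 1 / 2 ^ G"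
  have q: "0 < q" "q \<le> 1" by (auto simp: q_def)
  \<comment> \<open>Half of the smallest radius on \<open>{j..j + 1}\<close>. The particle is within
    \<open>b j\<close> of its target and the target within \<open>b j / 2\<close> of the given
    point, together less than \<open>2 * b j\<close>.\<close>
  define b where "b j = r\<^sub>0 * exp (- \<beta> * k * (real j + 1)) / 2" for j
  define h where "h j = (b j / 2)\<^sup>2 / (10 ^ 4 * 2 ^ CARD('d))" for j
  \<comment> \<open>Chosen so that \<open>2 ^ g j \<le> exp (\<beta> \<epsilon> j / 8)\<close>: two
    such factors meet \<open>exp (- \<beta> \<epsilon> j / 2)\<close> from the birth times, and one
    meets \<open>exp (- \<beta> \<epsilon> j / 4)\<close> from the displacements.\<close>
  define g where "g j = nat \<lfloor>\<beta> * \<epsilon> * real j / 8\<rfloor>" for j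
  define N where "N j = nat \<lfloor>(1 - 2 * \<epsilon>) * real j / (a + 1)\<rfloor>" for j
  \<comment> \<open>Rounding every coordinate with this mesh moves a point by at most
    \<open>d * \<delta> j = b j / 2\<close>.\<close>
  define \<delta> where "\<delta> j = b j / (2 * d)" for j
  define m' where "m' j = \<lceil>s * real j / \<delta> j\<rceil>" for j
  define X where "X j = {x \<in> (grid (\<delta> j) (m' j) :: (real ^ 'd) set). norm x \<le> \<phi> * s * real j}" for j
  \<comment> \<open>The mesh equals the holding time \<open>h j\<close>, so the intervals on which
    targets are held cover \<open>{j..j + 1}\<close>.\<close>
  define Tg where "Tg j = (\<lambda>i. real j + real i * h j) ` {..nat \<lfloor>1 / h j\<rfloor>}" for j
  define St where "St j \<omega> \<longleftrightarrow> (\<forall>w\<in>words (g j). increment [] w \<omega> \<in> start_set (\<epsilon> * real j) (sqrt \<beta> * \<epsilon> * real j))" for j \<omega>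
  define H where "H j t x w \<omega> \<longleftrightarrow> hit (stays t (h j) (b j) x) G (step_set a (x /\<^sub>R real j)) (N j) w (increment [] w \<omega>) \<omega>" for j t x w \<omega>
  \<comment> \<open>\<open>St j\<close> is part of the second kind of event because
    \<open>target_failure_at\<close> bounds a miss jointly with a good start.\<close>
  define bad where "bad j = {\<omega> \<in> space M. \<not> St j \<omega>} \<union>
    (\<Union>t\<in>Tg j. \<Union>x\<in>X j. {\<omega> \<in> space M. St j \<omega> \<and> (\<forall>w\<in>words (g j). \<not> H j t x w \<omega>)})" for j
  have b0: "0 < b j" for j using r0 by (simp add: b_def)
  have h0: "0 < h j" for j using b0[of j] by (simp add: h_def)
  have \<delta>0: "0 < \<delta> j" for j using b0[of j] d1 by (simp add: \<delta>_def)
  have fin: "finite (X j)" "finite (Tg j)" for j by (auto simp: X_def Tg_def)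
  have [measurable]: "Measurable.pred M (St j)" for j
    unfolding St_def[abs_def] by measurable
  have [measurable]: "Measurable.pred M (H j t x w)" for j t x w
    unfolding H_def[abs_def] by (rule measurable_adapted_M[OF adapted_hit[OF adapted_stays sets_step_set]]) simp
  have bad_meas: "bad j \<in> events" for j
    unfolding bad_def using fin by (intro sets.Un sets.finite_UN) measurable

  have card_T: "real (card (Tg j)) \<le> 16 * 10 ^ 4 * 2 ^ CARD('d) / r\<^sub>0\<^sup>2 * exp (2 * \<beta> * (real j + 1)) + 1" for j
  proof -
    have "card (Tg j) \<le> card {..nat \<lfloor>1 / h j\<rfloor>}" unfolding Tg_def by (intro card_image_le) simp
    then have "real (card (Tg j)) \<le> real (nat \<lfloor>1 / h j\<rfloor>) + 1" by simp
    also have "\<dots> \<le> 1 / h j + 1" using h0[of j] by (simp add: of_nat_nat less_imp_le)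
    also have "1 / h j = 16 * 10 ^ 4 * 2 ^ CARD('d) / r\<^sub>0\<^sup>2 * exp (2 * \<beta> * k * (real j + 1))"
      using r0 by (simp add: h_def b_def power_mult_distrib power_divide exp_minus power2_eq_square field_simps flip: exp_add)
    also have "\<dots> \<le> 16 * 10 ^ 4 * 2 ^ CARD('d) / r\<^sub>0\<^sup>2 * exp (2 * \<beta> * (real j + 1))"
      using k1 \<beta> by (intro mult_left_mono) (auto simp: mult_left_le)
    finally show ?thesis by simp
  qed
  have card_X: "real (card (X j)) \<le> (8 * d * s / r\<^sub>0 * real j * exp (\<beta> * (real j + 1)) + 3) ^ CARD('d)" for j
  proof -
    have m0: "0 \<le> m' j"
    proof -
      have "0 \<le> s * real j / \<delta> j" using s0 \<delta>0[of j] by simp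
      then show ?thesis unfolding m'_def by linarith
    qed
    have "card (X j) \<le> card (grid (\<delta> j) (m' j) :: (real ^ 'd) set)" unfolding X_def by (intro card_mono) auto
    then have "real (card (X j)) \<le> (2 * of_int (m' j) + 1) ^ CARD('d)"
      using card_grid[OF m0, of "\<delta> j", where 'd = 'd] by linarith
    also have "\<dots> \<le> (8 * d * s / r\<^sub>0 * real j * exp (\<beta> * (real j + 1)) + 3) ^ CARD('d)"
    proof (rule power_mono)
      have "of_int (m' j) \<le> s * real j / \<delta> j + 1" unfolding m'_def by linarith
      moreover have "s * real j / \<delta> j = 4 * d * s / r\<^sub>0 * real j * exp (\<beta> * k * (real j + 1))"
        using r0 d1 by (simp add: \<delta>_def b_def exp_minus field_simps flip: exp_add)
      moreover have "4 * d * s / r\<^sub>0 * real j * exp (\<beta> * k * (real j + 1)) \<le> 4 * d * s / r\<^sub>0 * real j * exp (\<beta> * (real j + 1))"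
        using k1 \<beta> r0 d1 s0 by (intro mult_left_mono) (auto simp: mult_left_le)
      ultimately show "2 * of_int (m' j) + 1 \<le> 8 * d * s / r\<^sub>0 * real j * exp (\<beta> * (real j + 1)) + 3" by simp
    qed (use m0 in simp)
    finally show ?thesis .
  qed

  have pow: "(1 - q) ^ 2 ^ g j \<le> exp (- q * exp (ln 2 * (\<beta> * \<epsilon> * real j / 8 - 1)))" for j
  proof -
    have "\<beta> * \<epsilon> * real j / 8 - 1 \<le> real (g j)" unfolding g_def by linarith
    then have "exp (ln 2 * (\<beta> * \<epsilon> * real j / 8 - 1)) \<le> exp (ln 2 * real (g j))" by simp
    also have "\<dots> = 2 ^ g j" by (simp add: exp_of_nat_mult mult.commute[of "ln 2"])
    finally have *: "q * exp (ln 2 * (\<beta> * \<epsilon> * real j / 8 - 1)) \<le> q * 2 ^ g j" using q by (intro mult_left_mono) auto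
    have "(1 - q) ^ 2 ^ g j \<le> exp (- q) ^ 2 ^ g j"
      using q exp_ge_add_one_self[of "- q"] by (intro power_mono) auto
    also have "\<dots> = exp (- (q * 2 ^ g j))" by (simp add: exp_of_nat_mult[symmetric] mult.commute)
    also have "\<dots> \<le> exp (- q * exp (ln 2 * (\<beta> * \<epsilon> * real j / 8 - 1)))" using * by simp
    finally show ?thesis .
  qed

  define c2 where "c2 = 1 + (2 :: real) ^ CARD('d)"
  have ev1: "\<forall>\<^sub>F j in sequentially. q \<le> hit_lower \<epsilon> (b j) (h j) (real j) * (m / 2) ^ N j"
    unfolding q_def N_def b_def h_def
    by (rule hit_lower_eventually[OF \<beta> k(1) r0 a0 \<epsilon>(1,2) \<epsilon>a \<gamma>(1) m])
      (use \<kappa> in \<open>simp add: d_def[symmetric] D_def s_def\<close>)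
  have ev2: "\<forall>\<^sub>F j in sequentially. a + 1 \<le> \<epsilon> * real j" using \<epsilon>(1) by real_asymp
  have ev3: "\<forall>\<^sub>F j in sequentially. 1 \<le> \<beta> * \<epsilon> * real j / 8" using \<epsilon>(1) \<beta> by real_asymp
  have ev4: "\<forall>\<^sub>F j in sequentially. \<theta> * s * (real j + 1) + r\<^sub>0 \<le> \<phi> * s * real j"
  proof -
    have "\<forall>\<^sub>F j in sequentially. 0 \<le> (\<phi> - \<theta>) * s * real j - \<theta> * s - r\<^sub>0"
      using \<phi>(1) s0 by real_asymp
    then show ?thesis by eventually_elim (simp add: algebra_simps)
  qed
  have ev5: "\<forall>\<^sub>F j in sequentially. (16 * 10 ^ 4 * 2 ^ CARD('d) / r\<^sub>0\<^sup>2 * exp (2 * \<beta> * (real j + 1)) + 1) *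
      (8 * d * s / r\<^sub>0 * real j * exp (\<beta> * (real j + 1)) + 3) ^ CARD('d) *
      exp (- q * exp (ln 2 * (\<beta> * \<epsilon> * real j / 8 - 1))) \<le> exp (- real j)"
    by (rule count_eventually) (use \<beta> \<epsilon> q r0 d1 s0 in auto)

  have bad_le: "\<forall>\<^sub>F j in sequentially. norm (prob (bad j)) \<le> c2 * exp (- \<beta> * \<epsilon> / 8) ^ j + exp (- 1) ^ j"
    using ev1 ev2 ev3 ev5 eventually_gt_at_top[of 0]
  proof eventually_elim
    case (elim j)
    have j0: "0 < real j" using elim by simp
    have g0: "0 < g j" using elim(3) unfolding g_def by simp
    have gle: "real (g j) \<le> \<beta> * \<epsilon> * real j / 8" unfolding g_def using elim(3) by (intro of_nat_floor) linarith
    have g2: "2 ^ g j \<le> exp (\<beta> * \<epsilon> * real j / 8)"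
    proof -
      have "(2 :: real) ^ g j \<le> exp 1 ^ g j" using exp_ge_add_one_self[of 1] by (intro power_mono) auto
      also have "\<dots> = exp (real (g j))" by (simp add: exp_of_nat_mult[symmetric])
      finally show ?thesis using gle by (meson exp_le_cancel_iff order_trans)
    qed
    have "prob {\<omega> \<in> space M. \<not> St j \<omega>} \<le> 2 ^ g j * (2 ^ g j * exp (- \<beta> * (\<epsilon> * real j) / 2) + 2 ^ CARD('d) * exp (- (sqrt \<beta> * \<epsilon> * real j)\<^sup>2 / (4 * (\<epsilon> * real j))))"
      unfolding St_def by (rule start_failure) (use \<beta> g0 \<epsilon> j0 in auto)
    also have "\<dots> \<le> exp (\<beta> * \<epsilon> * real j / 8) * (exp (\<beta> * \<epsilon> * real j / 8) * exp (- \<beta> * (\<epsilon> * real j) / 2) + 2 ^ CARD('d) * exp (- (sqrt \<beta> * \<epsilon> * real j)\<^sup>2 / (4 * (\<epsilon> * real j))))"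
      using g2 by (intro mult_mono add_mono) auto
    also have "\<dots> = exp (- \<beta> * \<epsilon> * real j / 4) + 2 ^ CARD('d) * exp (- \<beta> * \<epsilon> * real j / 8)"
    proof -
      have "- (sqrt \<beta> * \<epsilon> * real j)\<^sup>2 / (4 * (\<epsilon> * real j)) = - \<beta> * \<epsilon> * real j / 4"
        using \<beta> \<epsilon> j0 by (simp add: power2_eq_square field_simps)
      then show ?thesis by (simp add: distrib_left mult.left_commute[of _ "2 ^ CARD('d)"] mult.assoc[symmetric] exp_add[symmetric])
    qed
    also have "\<dots> \<le> exp (- \<beta> * \<epsilon> * real j / 8) + 2 ^ CARD('d) * exp (- \<beta> * \<epsilon> * real j / 8)"
      using \<beta> \<epsilon> by simp
    also have "\<dots> = c2 * exp (- \<beta> * \<epsilon> / 8) ^ j"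
      by (simp add: c2_def distrib_right exp_of_nat_mult[symmetric] mult_ac)
    finally have p1: "prob {\<omega> \<in> space M. \<not> St j \<omega>} \<le> c2 * exp (- \<beta> * \<epsilon> / 8) ^ j" .
    have p2: "prob {\<omega> \<in> space M. St j \<omega> \<and> (\<forall>w\<in>words (g j). \<not> H j t x w \<omega>)} \<le> (1 - q) ^ 2 ^ g j"
      if "t \<in> Tg j" "x \<in> X j" for t x
    proof -
      have t: "real j \<le> t" "t \<le> real j + 1"
      proof -
        from that obtain i where i: "i \<le> nat \<lfloor>1 / h j\<rfloor>" "t = real j + real i * h j" by (auto simp: Tg_def)
        have "real i \<le> 1 / h j" using i(1) h0[of j] by (simp add: le_nat_iff le_floor_iff)
        then have "real i * h j \<le> 1" using h0[of j] by (simp add: field_simps)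
        then show "real j \<le> t" "t \<le> real j + 1" using i h0[of j] by auto
      qed
      show ?thesis unfolding St_def H_def q_def
        by (rule target_failure_at[OF \<beta> G(3) a_def \<phi>01 \<epsilon>(1,2) \<epsilon>a elim(2) N_def _ _ t b0 h_def])
          (use m2 that elim(1) in \<open>auto simp: m_def X_def s_def q_def\<close>)
    qed
    have "prob (\<Union>t\<in>Tg j. \<Union>x\<in>X j. {\<omega> \<in> space M. St j \<omega> \<and> (\<forall>w\<in>words (g j). \<not> H j t x w \<omega>)})
      \<le> (\<Sum>t\<in>Tg j. prob (\<Union>x\<in>X j. {\<omega> \<in> space M. St j \<omega> \<and> (\<forall>w\<in>words (g j). \<not> H j t x w \<omega>)}))"
      using fin by (intro finite_measure_subadditive_finite) auto
    also have "\<dots> \<le> (\<Sum>t\<in>Tg j. \<Sum>x\<in>X j. prob {\<omega> \<in> space M. St j \<omega> \<and> (\<forall>w\<in>words (g j). \<not> H j t x w \<omega>)})"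
      using fin by (intro sum_mono finite_measure_subadditive_finite) auto
    also have "\<dots> \<le> (\<Sum>t\<in>Tg j. \<Sum>x\<in>X j. (1 - q) ^ 2 ^ g j)"
      by (intro sum_mono p2)
    also have "\<dots> = real (card (Tg j)) * real (card (X j)) * (1 - q) ^ 2 ^ g j" by simp
    also have "\<dots> \<le> (16 * 10 ^ 4 * 2 ^ CARD('d) / r\<^sub>0\<^sup>2 * exp (2 * \<beta> * (real j + 1)) + 1) *
      (8 * d * s / r\<^sub>0 * real j * exp (\<beta> * (real j + 1)) + 3) ^ CARD('d) *
      exp (- q * exp (ln 2 * (\<beta> * \<epsilon> * real j / 8 - 1)))"
      using q by (intro mult_mono card_T card_X pow mult_nonneg_nonneg) (use r0 d1 s0 in auto)
    also have "\<dots> \<le> exp (- real j)" by (rule elim(4))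
    also have "\<dots> = exp (- 1) ^ j" by (simp add: exp_of_nat_mult[symmetric])
    finally have p3: "prob (\<Union>t\<in>Tg j. \<Union>x\<in>X j. {\<omega> \<in> space M. St j \<omega> \<and> (\<forall>w\<in>words (g j). \<not> H j t x w \<omega>)}) \<le> exp (- 1) ^ j" .
    have "prob (bad j) \<le> prob {\<omega> \<in> space M. \<not> St j \<omega>} +
      prob (\<Union>t\<in>Tg j. \<Union>x\<in>X j. {\<omega> \<in> space M. St j \<omega> \<and> (\<forall>w\<in>words (g j). \<not> H j t x w \<omega>)})"
      unfolding bad_def using fin by (intro measure_Un_le sets.finite_UN) measurable
    then show ?case using p1 p3 by simp
  qed
  have summ: "summable (\<lambda>j. prob (bad j))"
  proof (rule summable_comparison_test_ev[OF bad_le])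
    show "summable (\<lambda>j. c2 * exp (- \<beta> * \<epsilon> / 8) ^ j + exp (- 1 :: real) ^ j)"
      using \<beta> \<epsilon> by (intro summable_add summable_mult summable_geometric) auto
  qed
  have "AE \<omega> in M. \<forall>\<^sub>F j in sequentially. \<omega> \<in> space M - bad j"
    by (rule borel_cantelli_AE1[OF bad_meas _ summ]) (simp add: emeasure_eq_measure)
  with AE_regular[OF \<beta>] show ?thesis
  proof eventually_elim
    fix \<omega> assume reg: "regular \<omega>" and good: "\<forall>\<^sub>F j in sequentially. \<omega> \<in> space M - bad j"
    from good ev4 eventually_gt_at_top[of 0]
    show "\<forall>\<^sub>F j in sequentially. \<forall>t\<in>{real j..real j + 1}. \<forall>p. norm p < \<theta> * sqrt (2 * \<beta>) * t \<longrightarrow>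
      (\<exists>u\<in>alive (\<lambda>u. T u \<omega>) t. norm (position (\<lambda>u. T u \<omega>) (\<lambda>u s. W u s \<omega>) t u - p) < r\<^sub>0 * exp (- \<beta> * k * t))"
    proof (eventually_elim, intro ballI allI impI)
      fix j :: nat and t and p :: "real ^ 'd"
      assume nb: "\<omega> \<in> space M - bad j" and ev4: "\<theta> * s * (real j + 1) + r\<^sub>0 \<le> \<phi> * s * real j" and j: "0 < j"
        and t: "t \<in> {real j..real j + 1}" and p: "norm p < \<theta> * sqrt (2 * \<beta>) * t"
      have br: "b j \<le> r\<^sub>0"
      proof -
        have "exp (- \<beta> * k * (real j + 1)) \<le> 1" using \<beta> k by (simp add: mult_nonneg_nonneg)
        then have "r\<^sub>0 * exp (- \<beta> * k * (real j + 1)) \<le> r\<^sub>0 * 1" using r0 by (intro mult_left_mono) auto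
        then show ?thesis unfolding b_def using r0 by linarith
      qed
      have "norm p < \<theta> * s * t" using p by (simp add: s_def)
      also have "\<dots> \<le> \<theta> * s * (real j + 1)" using t \<theta> s0 by (intro mult_left_mono) auto
      finally have pn: "norm p + r\<^sub>0 \<le> \<phi> * s * real j" using ev4 by simp
      have d\<delta>: "real CARD('d) * \<delta> j = b j / 2" using d1 by (simp add: \<delta>_def d_def)
      have "norm p + real CARD('d) * \<delta> j \<le> \<phi> * s * real j" using pn br b0[of j] unfolding d\<delta> by linarith
      also have "\<dots> \<le> 1 * s * real j" using \<phi>01 s0 by (intro mult_right_mono) auto
      also have "\<dots> \<le> \<delta> j * of_int (m' j)"
      proof -
        have "s * real j / \<delta> j \<le> of_int (m' j)" unfolding m'_def by linarith
        then show ?thesis using \<delta>0[of j] by (simp add: field_simps)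
      qed
      finally obtain x where x: "x \<in> grid (\<delta> j) (m' j)" "norm (p - x) \<le> b j / 2"
        using grid_near[OF \<delta>0, of p j "m' j"] unfolding d\<delta> by blast
      have "norm x \<le> norm p + norm (p - x)" using norm_triangle_ineq4[of p "p - x"] by simp
      then have xX: "x \<in> X j" using x pn br b0[of j] unfolding X_def by auto
      define i where "i = nat \<lfloor>(t - real j) / h j\<rfloor>"
      have i0: "0 \<le> (t - real j) / h j" using t h0[of j] by simp
      have i: "real i \<le> (t - real j) / h j" "(t - real j) / h j \<le> real i + 1"
        using i0 unfolding i_def by (simp_all add: of_nat_nat)
      have "(t - real j) / h j \<le> 1 / h j" using t h0[of j] by (intro divide_right_mono) auto
      then have "i \<le> nat \<lfloor>1 / h j\<rfloor>" unfolding i_def by (intro nat_mono floor_mono)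
      then have tT: "real j + real i * h j \<in> Tg j" by (auto simp: Tg_def)
      have ti: "real j + real i * h j \<le> t" "t \<le> real j + real i * h j + h j"
        using i h0[of j] by (simp_all add: field_simps)
      from nb tT xX obtain w where "H j (real j + real i * h j) x w \<omega>"
        by (auto simp: bad_def)
      then have "hit (stays (real j + real i * h j) (h j) (b j) x) G (step_set a (x /\<^sub>R real j)) (N j) w
         (birth_time (\<lambda>u. T u \<omega>) w, birth_place (\<lambda>u. T u \<omega>) (\<lambda>u s. W u s \<omega>) w) \<omega>"
        using birth_time_append[of \<omega> w "[]"] birth_place_append[OF reg, of w "[]"] by (simp add: H_def increment_def)
      from hit_imp[OF reg this] obtain v where
        "stays (real j + real i * h j) (h j) (b j) x v (birth_time (\<lambda>u. T u \<omega>) v, birth_place (\<lambda>u. T u \<omega>) (\<lambda>u s. W u s \<omega>) v) \<omega>" by blast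
      note v = stays_imp[OF reg h0 this ti]
      have "norm (position (\<lambda>u. T u \<omega>) (\<lambda>u s. W u s \<omega>) t v - p) \<le>
          norm (position (\<lambda>u. T u \<omega>) (\<lambda>u s. W u s \<omega>) t v - x) + norm (p - x)"
        using norm_triangle_ineq4[of "position (\<lambda>u. T u \<omega>) (\<lambda>u s. W u s \<omega>) t v - x" "p - x"] by simp
      also have "\<dots> < 2 * b j" using v x b0[of j] by simp
      also have "2 * b j = r\<^sub>0 * exp (- \<beta> * k * (real j + 1))" by (simp add: b_def)
      also have "\<dots> \<le> r\<^sub>0 * exp (- \<beta> * k * t)"
        using t r0 \<beta> k by (intro mult_left_mono) (auto intro!: mult_left_mono mult_nonneg_nonneg)
      finally show "\<exists>u\<in>alive (\<lambda>u. T u \<omega>) t. norm (position (\<lambda>u. T u \<omega>) (\<lambda>u s. W u s \<omega>) t u - p) < r\<^sub>0 * exp (- \<beta> * k * t)"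
        using v(1) by blast
    qed
  qed
qed

end

section \<open>From unit intervals to all large times\<close>

theorem corollary3:
  fixes M :: "'w measure"
    and T :: "bool list \<Rightarrow> 'w \<Rightarrow> real"
    and W :: "bool list \<Rightarrow> real \<Rightarrow> 'w \<Rightarrow> real ^ 'd"
    and \<beta> \<theta> k r\<^sub>0 :: real and r \<rho> :: "real \<Rightarrow> real"
  assumes "0 < \<beta>"
    and "dyadic_bbm M \<beta> T W"
    and "0 < \<theta>" "\<theta> < 1"
    and "0 \<le> k" "k < (1 - \<theta>\<^sup>2) / real CARD('d)"
    and "0 < r\<^sub>0"
    and "\<And>t. 0 < t \<Longrightarrow> r t = r\<^sub>0 * exp (- \<beta> * k * t)"
    and "\<And>t. 0 < t \<Longrightarrow> \<rho> t = \<theta> * sqrt (2 * \<beta>) * t"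
  shows "AE \<omega> in M. \<exists>t\<^sub>0>0. \<forall>t\<ge>t\<^sub>0.
    ball 0 (\<rho> t) \<subseteq> enlarged_support (bbm_measure T W t \<omega>) (r t)"
proof -
  interpret dyadic_bbm M \<beta> T W by fact
  show ?thesis
    using covering[OF assms(1,3-7)]
  proof eventually_elim
    case (elim \<omega>)
    then obtain J where J: "\<And>j t p. J \<le> j \<Longrightarrow> t \<in> {real j..real j + 1} \<Longrightarrow> norm p < \<theta> * sqrt (2 * \<beta>) * t \<Longrightarrow>
      \<exists>u\<in>alive (\<lambda>u. T u \<omega>) t. norm (position (\<lambda>u. T u \<omega>) (\<lambda>u s. W u s \<omega>) t u - p) < r\<^sub>0 * exp (- \<beta> * k * t)"
      unfolding eventually_sequentially by blast
    \<comment> \<open>The added 1 makes \<open>t\<close> positive, the range in which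
      \<open>r\<close> and \<open>\<rho>\<close> are given by their formulas; the interval used is
      the one starting at the integer part of \<open>t\<close>.\<close>
    show ?case
    proof (intro exI[of _ "real J + 1"] conjI allI impI subsetI)
      fix t and p :: "real ^ 'd" assume t: "real J + 1 \<le> t" and p: "p \<in> ball 0 (\<rho> t)"
      have "J \<le> nat \<lfloor>t\<rfloor>" "t \<in> {real (nat \<lfloor>t\<rfloor>)..real (nat \<lfloor>t\<rfloor>) + 1}"
        using t by (auto simp: le_nat_iff le_floor_iff of_nat_nat)
      moreover have "norm p < \<theta> * sqrt (2 * \<beta>) * t" using p t assms(9)[of t] by simp
      ultimately obtain u where u: "u \<in> alive (\<lambda>u. T u \<omega>) t"
        "norm (position (\<lambda>u. T u \<omega>) (\<lambda>u s. W u s \<omega>) t u - p) < r\<^sub>0 * exp (- \<beta> * k * t)"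
        using J by blast
      have "position (\<lambda>u. T u \<omega>) (\<lambda>u s. W u s \<omega>) t u \<in> msupp (bbm_measure T W t \<omega>)"
        unfolding msupp_bbm_measure using u(1) closure_subset by fast
      moreover have "p \<in> ball (position (\<lambda>u. T u \<omega>) (\<lambda>u s. W u s \<omega>) t u) (r t)"
        using u(2) t assms(8)[of t] by (simp add: dist_norm)
      ultimately show "p \<in> enlarged_support (bbm_measure T W t \<omega>) (r t)"
        unfolding enlarged_support_def by blast
    qed simp
  qed
qed

end
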